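(* (i) Let $\boldsymbol\omega=(\omega,\underline\omega)\in\boldsymbol\Omega_\alpha$, $\theta\in\mathcal C^1_{\omega,\boldsymbol\alpha}(\tilde E)$, $g\in\mathcal C^{1,2}_{\omega,\boldsymbol\alpha,loc}(\tilde E,E)$ and $\eta_t:=g(t,\theta_t)$. Then $\eta\in\mathcal C^1_{\omega,\boldsymbol\alpha}(E)$ with $$\partial_\omega\eta_t=(\partial_\omega g)(t,\theta_t)+\sum_{k=1}^{|\tilde E|}\partial_{y_k}g(t,\theta_t)\,\partial_\omega\theta^k_t .$$ (ii) Assume further that $\theta\in\mathcal C^2_{\boldsymbol\omega,\boldsymbol\alpha}(\tilde E)$ and $g\in\mathcal C^{2,3}_{\omega,\boldsymbol\alpha,loc}(\tilde E,E)$. Then, for appropriate $D^{\boldsymbol\omega}_t$, $\eta\in\mathcal C^2_{\boldsymbol\omega,\boldsymbol\alpha}(E)$ with $$D^{\boldsymbol\omega}_t\eta_t=(D^{\boldsymbol\omega}_tg)(t,\theta_t)+\sum_{k=1}^{|\tilde E|}\partial_{y_k}g(t,\theta_t)\,D^{\boldsymbol\omega}_t\theta^k_t .$$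
   Context: Fix $T>0$, $\mathbb T=[0,T]$, $\mathbb T^2=\{(s,t):0\le s<t\le T\}$, $d\ge1$; $E,\tilde E$ are Euclidean spaces ($E=\mathbb R^{|E|}$); $\varphi_{s,t}:=\varphi_t-\varphi_s$ for a path $\varphi$; $A:\tilde A:=\mathrm{Trace}(A\tilde A^* )$. Fix $\boldsymbol\alpha=(\alpha,\beta)$ with $\alpha\in(\frac13,\frac12)$, $\beta\in(1-2\alpha,\alpha]$. For $\gamma>0$, $\Omega_\gamma(E)$ is the set of continuous $\omega:\mathbb T\to E$ with $\|\omega\|_\gamma:=\sup_{\mathbb T^2}|\omega_{s,t}|/|t-s|^\gamma<\infty$; $\underline\Omega_\gamma(E)$ is the set of continuous $\underline\omega:\mathbb T^2\to E$ with $\|\underline\omega\|_\gamma:=\sup_{\mathbb T^2}|\underline\omega_{s,t}|/|t-s|^\gamma<\infty$. Rough paths: $\boldsymbol\Omega^0_\alpha$ is the set of $\boldsymbol\omega=(\omega,\underline\omega)\in\Omega_\alpha(\mathbb R^d)\times\underline\Omega_{2\alpha}(\mathbb R^{d\times d})$ with $\underline\omega_{s,t}-\underline\omega_{s,r}-\underline\omega_{r,t}=\omega_{s,r}\omega_{r,t}^*$ for $s<r<t$. $\boldsymbol\Omega_\alpha$ is the set of $\boldsymbol\omega\in\boldsymbol\Omega^0_\alpha$ for which there is a dense $A\subset[0,T)$ with $\limsup_{t\downarrow s}|v\cdot\omega_{s,t}|/(t-s)^{2\alpha}=\infty$ for all $s\in A$, $v\in\mathbb R^d\setminus\{0\}$.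 Bracket: $\langle\boldsymbol\omega\rangle_t:=\omega_{0,t}\omega_{0,t}^*-\underline\omega_{0,t}-\underline\omega_{0,t}^*$, which lies in $\Omega_{2\alpha}$ with values in symmetric $d\times d$ matrices. Controlled paths: $\mathcal C^1_{\omega,\boldsymbol\alpha}(E)$ is the set of $\theta\in\Omega_\beta(E)$ for which there is a (row-vector valued) $\partial_\omega\theta\in\Omega_\beta(E^{1\times d})$ with $R^{\omega,\theta}_{s,t}:=\theta_{s,t}-\partial_\omega\theta_s\,\omega_{s,t}$ in $\underline\Omega_{\alpha+\beta}(E)$. For $\boldsymbol\omega\in\boldsymbol\Omega_\alpha$, $\partial_\omega\theta$ is taken to be unique. Put $\|\theta\|_{\omega,\boldsymbol\alpha}:=\|\partial_\omega\theta\|_\beta+\|R^{\omega,\theta}\|_{\alpha+\beta}$ and $|||\theta|||_{\omega,\boldsymbol\alpha}:=\|\theta\|_{\omega,\boldsymbol\alpha}+|\partial_\omega\theta_0|$. For $\theta=(\theta_1,\dots,\theta_d)^*\in\mathcal C^1_{\omega,\boldsymbol\alpha}(E^d)$, $\partial_\omega\theta\in E^{d\times d}$ has $i$-th row $\partial_\omega\theta_i$. Integrals: for $\theta\in\mathcal C^1_{\omega,\boldsymbol\alpha}(E^d)$, $\int_0^t\theta_s\cdot d\boldsymbol\omega_s$ is the limit, as the mesh of partitions $0=t_0<\dots<t_n=T$ tends to $0$, of $\sum_i\big[\theta_{t_i\wedge t}\cdot\omega_{t_i\wedge t,t_{i+1}\wedge t}+\partial_\omega\theta_{t_i\wedge t}:\underline\omega_{t_i\wedge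 t,t_{i+1}\wedge t}\big]$. For $b\in\Omega_\beta(E^{d\times d})$, $\int b:d\langle\boldsymbol\omega\rangle$ is the Young integral. $\mathcal C^2_{\boldsymbol\omega,\boldsymbol\alpha}(E)$: the set of $\theta\in\mathcal C^1_{\omega,\boldsymbol\alpha}(E)$ with $\partial_\omega\theta\in\mathcal C^1_{\omega,\boldsymbol\alpha}(E^{1\times d})$ for which there is a symmetric $D^{\boldsymbol\omega}_t\theta\in\Omega_\beta(E^{d\times d})$ (in general not unique) with $d\theta_t=\partial_\omega\theta_t\,d\boldsymbol\omega_t+[D^{\boldsymbol\omega}_t\theta_t+\frac12\partial^2_{\omega\omega}\theta_t]:d\langle\boldsymbol\omega\rangle_t$, where $\partial^2_{\omega\omega}\theta:=\partial_\omega[(\partial_\omega\theta)^*]$. Function spaces (functions $g:\mathbb T\times\tilde E\to E$, $(t,y)\mapsto g(t,y)$; path derivatives are taken in $t$ for fixed $y$; $\partial_yg\in E^{1\times|\tilde E|}$): $\mathcal C^k_{loc}(\tilde E,E)$: $g$ is $k$ times differentiable in $y$. $\mathcal C^k_{\beta,loc}(\tilde E,E)$: $g\in\mathcal C^k_{loc}$ and, for $0\le i\le k$, $\partial_y^{(i)}g$ is Hölder-$\beta$ continuous in $t$ and $y\mapsto\partial^{(i)}_yg(\cdot,y)$ is continuous under $\|\cdot\|_\beta$. $\mathcal C^{1,2}_{\omega,\boldsymbol\alpha,loc}(\tilde E,E)$: $g\in\mathcal C^2_{loc}$, $g(\cdot,y)\in\mathcal C^1_{\omega,\boldsymbol\alpha}(E)$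 and $\partial_yg(\cdot,y)\in\mathcal C^1_{\omega,\boldsymbol\alpha}(E^{1\times|\tilde E|})$ for each $y$, the maps $y\mapsto g(\cdot,y)$ and $y\mapsto\partial_yg(\cdot,y)$ are continuous under $|||\cdot|||_{\omega,\boldsymbol\alpha}$, and $\partial_\omega g\in\mathcal C^1_{\beta,loc}(\tilde E,E^{1\times d})$. $\mathcal C^{2,3}_{\omega,\boldsymbol\alpha,loc}(\tilde E,E)$: $g\in\mathcal C^{1,2}_{\omega,\boldsymbol\alpha,loc}(\tilde E,E)$ with $\partial_\omega g\in\mathcal C^{1,2}_{\omega,\boldsymbol\alpha,loc}(\tilde E,E^{1\times d})$, $\partial_yg\in\mathcal C^{1,2}_{\omega,\boldsymbol\alpha,loc}(\tilde E,E^{1\times|\tilde E|})$, $g(\cdot,y)\in\mathcal C^2_{\boldsymbol\omega,\boldsymbol\alpha}(E)$ for every $y$, and there exists $D^{\boldsymbol\omega}_tg\in\mathcal C^1_{\beta,loc}(\tilde E,E^{d\times d})$.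
   Formalization: "k times differentiable in y" is read as having y-derivatives up to order k jointly continuous in (t,y), since (i) fails otherwise; the rough integral contracts ∂_ωθ with the transpose of the second-order part, as the printed limit need not exist for non-symmetric ∂_ωθ. *)

theory Defs
  imports "HOL-Analysis.Analysis"
begin

text \<open>
  Paths are total functions on \<^typ>\<open>real\<close>; only their values on \<open>{0..T}\<close> matter.
  Two-parameter functions matter only on \<open>triangle T\<close>.
  A Euclidean space \<open>E\<close> is a type of class \<^class>\<open>euclidean_space\<close>; the row space
  \<open>E\<^sup>1\<^sup>\<times>\<^sup>d\<close> and the column space \<open>E\<^sup>d\<close> are both \<open>'e^'d\<close>, and \<open>E\<^sup>d\<^sup>\<times>\<^sup>d\<close> is \<open>'e^'d^'d\<close>, with
  \<open>A $ i $ j\<close> the entry in row \<open>i\<close> and column \<open>j\<close>.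
  The domain \<open>real^'m\<close> of the space variable carries coordinates \<open>y $ k\<close>.
\<close>

definition triangle :: "real \<Rightarrow> (real \<times> real) set" where
  "triangle T = {(s, t). 0 \<le> s \<and> s < t \<and> t \<le> T}"

definition incr :: "(real \<Rightarrow> 'e::real_normed_vector) \<Rightarrow> real \<Rightarrow> real \<Rightarrow> 'e" where
  "incr \<phi> s t = \<phi> t - \<phi> s"


section \<open>Hoelder spaces\<close>

definition holder_quotients ::
  "real \<Rightarrow> real \<Rightarrow> (real \<Rightarrow> real \<Rightarrow> 'e::real_normed_vector) \<Rightarrow> real set" where
  "holder_quotients T \<gamma> U = (\<lambda>(s, t). norm (U s t) / \<bar>t - s\<bar> powr \<gamma>) ` triangle T"

text \<open>The supremum is meaningful only for functions in \<open>Omega2\<close>, where the quotients are bounded.\<close>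

definition holder_norm2 ::
  "real \<Rightarrow> real \<Rightarrow> (real \<Rightarrow> real \<Rightarrow> 'e::real_normed_vector) \<Rightarrow> real" where
  "holder_norm2 T \<gamma> U = Sup (holder_quotients T \<gamma> U)"

definition holder_norm :: "real \<Rightarrow> real \<Rightarrow> (real \<Rightarrow> 'e::real_normed_vector) \<Rightarrow> real" where
  "holder_norm T \<gamma> \<phi> = holder_norm2 T \<gamma> (incr \<phi>)"

definition Omega2 :: "real \<Rightarrow> real \<Rightarrow> (real \<Rightarrow> real \<Rightarrow> 'e::real_normed_vector) set" where
  "Omega2 T \<gamma> = {U. continuous_on (triangle T) (\<lambda>(s, t). U s t) \<and>
                    bdd_above (holder_quotients T \<gamma> U)}"

definition Omega :: "real \<Rightarrow> real \<Rightarrow> (real \<Rightarrow> 'e::real_normed_vector) set" where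
  "Omega T \<gamma> = {\<phi>. continuous_on {0..T} \<phi> \<and> bdd_above (holder_quotients T \<gamma> (incr \<phi>))}"


section \<open>Rough paths\<close>

definition outer :: "real^'d \<Rightarrow> real^'d \<Rightarrow> real^'d^'d" where
  "outer v w = (\<chi> i j. v $ i * w $ j)"

text \<open>\<open>A : B = Trace (A B\<^sup>*)\<close> for an \<open>E\<close>-valued matrix \<open>A\<close> and a real matrix \<open>B\<close>.\<close>

definition ddot :: "'e::real_vector^'d^'d \<Rightarrow> real^'d^'d \<Rightarrow> 'e" where
  "ddot A B = (\<Sum>i\<in>UNIV. \<Sum>j\<in>UNIV. B $ i $ j *\<^sub>R A $ i $ j)"

definition row_app :: "'e::real_vector^'d \<Rightarrow> real^'d \<Rightarrow> 'e" where
  "row_app a v = (\<Sum>j\<in>UNIV. v $ j *\<^sub>R a $ j)"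

type_synonym 'd rough = "(real \<Rightarrow> real^'d) \<times> (real \<Rightarrow> real \<Rightarrow> real^'d^'d)"

definition rough_paths0 :: "real \<Rightarrow> real \<Rightarrow> 'd::finite rough set" where
  "rough_paths0 T \<alpha> = {(x, X). x \<in> Omega T \<alpha> \<and> X \<in> Omega2 T (2 * \<alpha>) \<and>
     (\<forall>s r t. 0 \<le> s \<and> s < r \<and> r < t \<and> t \<le> T \<longrightarrow>
        X s t - X s r - X r t = outer (incr x s r) (incr x r t))}"

definition rough_paths :: "real \<Rightarrow> real \<Rightarrow> 'd::finite rough set" where
  "rough_paths T \<alpha> = {w \<in> rough_paths0 T \<alpha>.
     \<exists>A. A \<subseteq> {0..<T} \<and> {0..<T} \<subseteq> closure A \<and>
       (\<forall>s\<in>A. \<forall>v. v \<noteq> 0 \<longrightarrow>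
          Limsup (at_right s)
            (\<lambda>t. ereal (\<bar>v \<bullet> incr (fst w) s t\<bar> / (t - s) powr (2 * \<alpha>))) = \<infinity>)}"

text \<open>The second-order part, extended continuously by \<open>0\<close> to the diagonal: the value at \<open>(0, 0)\<close>
  enters the bracket, and the values at \<open>(t, t)\<close> enter the sums over stopped partitions.\<close>

definition area :: "'d::finite rough \<Rightarrow> real \<Rightarrow> real \<Rightarrow> real^'d^'d" where
  "area w s t = (if s < t then snd w s t else 0)"

definition bracket :: "'d::finite rough \<Rightarrow> real \<Rightarrow> real^'d^'d" where
  "bracket w t = outer (incr (fst w) 0 t) (incr (fst w) 0 t) - area w 0 t - transpose (area w 0 t)"


section \<open>Controlled paths\<close>

definition remainder ::
  "(real \<Rightarrow> real^'d) \<Rightarrow> (real \<Rightarrow> 'e::real_normed_vector) \<Rightarrow> (real \<Rightarrow> 'e^'d) \<Rightarrow> real \<Rightarrow> real \<Rightarrow> 'e" where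
  "remainder x \<theta> \<theta>' s t = incr \<theta> s t - row_app (\<theta>' s) (incr x s t)"

definition is_path_deriv ::
  "real \<Rightarrow> real \<Rightarrow> real \<Rightarrow> (real \<Rightarrow> real^'d) \<Rightarrow> (real \<Rightarrow> 'e::real_normed_vector) \<Rightarrow> (real \<Rightarrow> 'e^'d) \<Rightarrow> bool"
where
  "is_path_deriv T \<alpha> \<beta> x \<theta> \<theta>' \<longleftrightarrow>
     \<theta>' \<in> Omega T \<beta> \<and> remainder x \<theta> \<theta>' \<in> Omega2 T (\<alpha> + \<beta>)"

definition controlled1 ::
  "real \<Rightarrow> real \<Rightarrow> real \<Rightarrow> (real \<Rightarrow> real^'d) \<Rightarrow> (real \<Rightarrow> 'e::real_normed_vector) set" where
  "controlled1 T \<alpha> \<beta> x = {\<theta> \<in> Omega T \<beta>. \<exists>\<theta>'. is_path_deriv T \<alpha> \<beta> x \<theta> \<theta>'}"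

text \<open>Uniqueness of the path derivative on \<open>{0..T}\<close>. Applied to coordinates, the real-valued case
  gives uniqueness for paths with values in any Euclidean space. The roughness condition in
  \<open>rough_paths\<close>, with exponent \<open>2\<alpha>\<close>, forces it if \<open>\<beta> = \<alpha>\<close> but not if \<open>\<beta> < \<alpha>\<close>, because remainders
  are only of order \<open>\<alpha> + \<beta>\<close>.\<close>

definition path_deriv_unique :: "real \<Rightarrow> real \<Rightarrow> real \<Rightarrow> (real \<Rightarrow> real^'d) \<Rightarrow> bool" where
  "path_deriv_unique T \<alpha> \<beta> x \<longleftrightarrow>
     (\<forall>(\<phi> :: real \<Rightarrow> real) a b.
        \<phi> \<in> Omega T \<beta> \<and> is_path_deriv T \<alpha> \<beta> x \<phi> a \<and> is_path_deriv T \<alpha> \<beta> x \<phi> b \<longrightarrow>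
        (\<forall>t\<in>{0..T}. a t = b t))"

definition path_deriv ::
  "real \<Rightarrow> real \<Rightarrow> real \<Rightarrow> (real \<Rightarrow> real^'d) \<Rightarrow> (real \<Rightarrow> 'e::real_normed_vector) \<Rightarrow> real \<Rightarrow> 'e^'d" where
  "path_deriv T \<alpha> \<beta> x \<theta> = (SOME \<theta>'. is_path_deriv T \<alpha> \<beta> x \<theta> \<theta>')"

definition controlled_norm ::
  "real \<Rightarrow> real \<Rightarrow> real \<Rightarrow> (real \<Rightarrow> real^'d) \<Rightarrow> (real \<Rightarrow> 'e::real_normed_vector) \<Rightarrow> real" where
  "controlled_norm T \<alpha> \<beta> x \<theta> =
     holder_norm T \<beta> (path_deriv T \<alpha> \<beta> x \<theta>)
     + holder_norm2 T (\<alpha> + \<beta>) (remainder x \<theta> (path_deriv T \<alpha> \<beta> x \<theta>))"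

definition controlled_tnorm ::
  "real \<Rightarrow> real \<Rightarrow> real \<Rightarrow> (real \<Rightarrow> real^'d) \<Rightarrow> (real \<Rightarrow> 'e::real_normed_vector) \<Rightarrow> real" where
  "controlled_tnorm T \<alpha> \<beta> x \<theta> = controlled_norm T \<alpha> \<beta> x \<theta> + norm (path_deriv T \<alpha> \<beta> x \<theta> 0)"

text \<open>For an \<open>E\<^sup>d\<close>-valued path, \<open>path_deriv\<close> puts the index of the driving coordinate outside.
  The transpose is the matrix with \<open>i\<close>-th row \<open>\<partial>\<^sub>\<omega> \<theta>\<^sub>i\<close>.\<close>

definition path_deriv_mat ::
  "real \<Rightarrow> real \<Rightarrow> real \<Rightarrow> (real \<Rightarrow> real^'d) \<Rightarrow> (real \<Rightarrow> 'e::real_normed_vector^'d) \<Rightarrow> real \<Rightarrow> 'e^'d^'d"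
where
  "path_deriv_mat T \<alpha> \<beta> x \<theta> t = transpose (path_deriv T \<alpha> \<beta> x \<theta> t)"

definition path_deriv2 ::
  "real \<Rightarrow> real \<Rightarrow> real \<Rightarrow> (real \<Rightarrow> real^'d) \<Rightarrow> (real \<Rightarrow> 'e::real_normed_vector) \<Rightarrow> real \<Rightarrow> 'e^'d^'d" where
  "path_deriv2 T \<alpha> \<beta> x \<theta> = path_deriv_mat T \<alpha> \<beta> x (path_deriv T \<alpha> \<beta> x \<theta>)"


section \<open>Integrals\<close>

text \<open>\<open>L\<close> is the limit of \<open>\<Sum>\<^sub>i \<Xi> t\<^sub>i t\<^sub>i\<^sub>+\<^sub>1\<close> over partitions of \<open>[0, T]\<close> as the mesh tends to \<open>0\<close>.\<close>

definition has_mesh_limit ::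
  "real \<Rightarrow> (real \<Rightarrow> real \<Rightarrow> 'e::real_normed_vector) \<Rightarrow> 'e \<Rightarrow> bool" where
  "has_mesh_limit T \<Xi> L \<longleftrightarrow>
     (\<forall>\<epsilon>>0. \<exists>\<delta>>0. \<forall>(n::nat) p.
        p 0 = 0 \<and> p n = T \<and> (\<forall>i<n. p i < p (Suc i) \<and> p (Suc i) - p i < \<delta>) \<longrightarrow>
        norm ((\<Sum>i<n. \<Xi> (p i) (p (Suc i))) - L) < \<epsilon>)"

text \<open>The rough integral over \<open>[0, t]\<close>. With \<open>X\<^sub>s\<^sub>,\<^sub>t - X\<^sub>s\<^sub>,\<^sub>r - X\<^sub>r\<^sub>,\<^sub>t = x\<^sub>s\<^sub>,\<^sub>r x\<^sub>r\<^sub>,\<^sub>t\<^sup>*\<close>, the entry \<open>X $ j $ i\<close>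
  plays the role of the iterated integral of \<open>x\<^sub>j\<close> against \<open>x\<^sub>i\<close>, while entry \<open>(i, j)\<close> of
  \<open>path_deriv_mat\<close> is the derivative of \<open>\<theta>\<^sub>i\<close> in the direction \<open>x\<^sub>j\<close>. The compensator is therefore
  the contraction with the transpose of the second-order part. Contracting with \<open>X\<close> itself gives
  the same sums when \<open>path_deriv_mat\<close> is symmetric, and in general sums that do not converge.\<close>

definition has_rough_integral ::
  "real \<Rightarrow> real \<Rightarrow> real \<Rightarrow> 'd::finite rough \<Rightarrow> (real \<Rightarrow> 'e::real_normed_vector^'d) \<Rightarrow> real \<Rightarrow> 'e \<Rightarrow> bool"
where
  "has_rough_integral T \<alpha> \<beta> w \<theta> t I \<longleftrightarrow>
     has_mesh_limit T
       (\<lambda>r u. row_app (\<theta> (min r t)) (incr (fst w) (min r t) (min u t))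
            + ddot (path_deriv_mat T \<alpha> \<beta> (fst w) \<theta> (min r t))
                (transpose (area w (min r t) (min u t)))) I"

definition has_bracket_integral ::
  "real \<Rightarrow> 'd::finite rough \<Rightarrow> (real \<Rightarrow> 'e::real_normed_vector^'d^'d) \<Rightarrow> real \<Rightarrow> 'e \<Rightarrow> bool" where
  "has_bracket_integral T w b t J \<longleftrightarrow>
     has_mesh_limit T
       (\<lambda>r u. ddot (b (min r t)) (incr (bracket w) (min r t) (min u t))) J"


section \<open>Twice differentiable paths\<close>

text \<open>\<open>D\<close> is an admissible, in general not unique, choice of the time derivative of \<open>\<theta>\<close>.\<close>

definition is_time_deriv ::
  "real \<Rightarrow> real \<Rightarrow> real \<Rightarrow> 'd::finite rough \<Rightarrow> (real \<Rightarrow> 'e::real_normed_vector) \<Rightarrow> (real \<Rightarrow> 'e^'d^'d) \<Rightarrow> bool"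
where
  "is_time_deriv T \<alpha> \<beta> w \<theta> D \<longleftrightarrow>
     D \<in> Omega T \<beta> \<and> (\<forall>t\<in>{0..T}. transpose (D t) = D t) \<and>
     (\<forall>t\<in>{0..T}. \<exists>I J.
        has_rough_integral T \<alpha> \<beta> w (path_deriv T \<alpha> \<beta> (fst w) \<theta>) t I \<and>
        has_bracket_integral T w
          (\<lambda>s. D s + (1/2) *\<^sub>R path_deriv2 T \<alpha> \<beta> (fst w) \<theta> s) t J \<and>
        \<theta> t - \<theta> 0 = I + J)"

definition controlled2 ::
  "real \<Rightarrow> real \<Rightarrow> real \<Rightarrow> 'd::finite rough \<Rightarrow> (real \<Rightarrow> 'e::real_normed_vector) set" where
  "controlled2 T \<alpha> \<beta> w =
     {\<theta> \<in> controlled1 T \<alpha> \<beta> (fst w).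
        path_deriv T \<alpha> \<beta> (fst w) \<theta> \<in> controlled1 T \<alpha> \<beta> (fst w) \<and>
        (\<exists>D. is_time_deriv T \<alpha> \<beta> w \<theta> D)}"


section \<open>Function spaces\<close>

definition dy :: "(real \<Rightarrow> real^'m \<Rightarrow> 'e::real_normed_vector) \<Rightarrow> real \<Rightarrow> real^'m \<Rightarrow> 'e^'m" where
  "dy g t y = (\<chi> k. frechet_derivative (g t) (at y) (axis k 1))"

text \<open>\<open>C\<^sup>k\<close> in \<open>y\<close> is understood as: the \<open>y\<close>-derivatives up to order \<open>k\<close> exist and are continuous in
  \<open>(t, y)\<close> on \<open>[0, T] \<times> real^'m\<close>.\<close>

definition C1_loc :: "real \<Rightarrow> (real \<Rightarrow> real^'m \<Rightarrow> 'e::real_normed_vector) set" where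
  "C1_loc T = {g. (\<forall>t\<in>{0..T}. \<forall>y. g t differentiable (at y)) \<and>
     continuous_on ({0..T} \<times> UNIV) (\<lambda>(t, y). g t y) \<and>
     continuous_on ({0..T} \<times> UNIV) (\<lambda>(t, y). dy g t y)}"

definition C2_loc :: "real \<Rightarrow> (real \<Rightarrow> real^'m \<Rightarrow> 'e::real_normed_vector) set" where
  "C2_loc T = {g \<in> C1_loc T. dy g \<in> C1_loc T}"

definition holder_field :: "real \<Rightarrow> real \<Rightarrow> (real \<Rightarrow> real^'m \<Rightarrow> 'e::real_normed_vector) \<Rightarrow> bool" where
  "holder_field T \<beta> f \<longleftrightarrow>
     (\<forall>y. (\<lambda>t. f t y) \<in> Omega T \<beta>) \<and>
     (\<forall>y. ((\<lambda>z. holder_norm T \<beta> (\<lambda>t. f t z - f t y)) \<longlongrightarrow> 0) (at y))"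

definition C1_beta_loc :: "real \<Rightarrow> real \<Rightarrow> (real \<Rightarrow> real^'m \<Rightarrow> 'e::real_normed_vector) set" where
  "C1_beta_loc T \<beta> = {g \<in> C1_loc T. holder_field T \<beta> g \<and> holder_field T \<beta> (dy g)}"

definition controlled_field ::
  "real \<Rightarrow> real \<Rightarrow> real \<Rightarrow> (real \<Rightarrow> real^'d) \<Rightarrow> (real \<Rightarrow> real^'m \<Rightarrow> 'e::real_normed_vector) \<Rightarrow> bool" where
  "controlled_field T \<alpha> \<beta> x f \<longleftrightarrow>
     (\<forall>y. (\<lambda>t. f t y) \<in> controlled1 T \<alpha> \<beta> x) \<and>
     (\<forall>y. ((\<lambda>z. controlled_tnorm T \<alpha> \<beta> x (\<lambda>t. f t z - f t y)) \<longlongrightarrow> 0) (at y))"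

definition domega ::
  "real \<Rightarrow> real \<Rightarrow> real \<Rightarrow> (real \<Rightarrow> real^'d) \<Rightarrow> (real \<Rightarrow> real^'m \<Rightarrow> 'e::real_normed_vector)
   \<Rightarrow> real \<Rightarrow> real^'m \<Rightarrow> 'e^'d" where
  "domega T \<alpha> \<beta> x g t y = path_deriv T \<alpha> \<beta> x (\<lambda>s. g s y) t"

definition C12_loc ::
  "real \<Rightarrow> real \<Rightarrow> real \<Rightarrow> (real \<Rightarrow> real^'d) \<Rightarrow> (real \<Rightarrow> real^'m \<Rightarrow> 'e::real_normed_vector) set" where
  "C12_loc T \<alpha> \<beta> x =
     {g \<in> C2_loc T. controlled_field T \<alpha> \<beta> x g \<and> controlled_field T \<alpha> \<beta> x (dy g) \<and>
        domega T \<alpha> \<beta> x g \<in> C1_beta_loc T \<beta>}"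

definition is_time_deriv_field ::
  "real \<Rightarrow> real \<Rightarrow> real \<Rightarrow> 'd::finite rough \<Rightarrow> (real \<Rightarrow> real^'m \<Rightarrow> 'e::real_normed_vector)
   \<Rightarrow> (real \<Rightarrow> real^'m \<Rightarrow> 'e^'d^'d) \<Rightarrow> bool" where
  "is_time_deriv_field T \<alpha> \<beta> w g Dg \<longleftrightarrow>
     Dg \<in> C1_beta_loc T \<beta> \<and> (\<forall>y. is_time_deriv T \<alpha> \<beta> w (\<lambda>t. g t y) (\<lambda>t. Dg t y))"

definition C23_loc ::
  "real \<Rightarrow> real \<Rightarrow> real \<Rightarrow> 'd::finite rough \<Rightarrow> (real \<Rightarrow> real^'m \<Rightarrow> 'e::real_normed_vector) set" where
  "C23_loc T \<alpha> \<beta> w =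
     {g \<in> C12_loc T \<alpha> \<beta> (fst w).
        domega T \<alpha> \<beta> (fst w) g \<in> C12_loc T \<alpha> \<beta> (fst w) \<and>
        dy g \<in> C12_loc T \<alpha> \<beta> (fst w) \<and>
        (\<forall>y. (\<lambda>t. g t y) \<in> controlled2 T \<alpha> \<beta> w) \<and>
        (\<exists>Dg. is_time_deriv_field T \<alpha> \<beta> w g Dg)}"

end

(* Write X for the second-order part of w and D2 for the matrix of second path derivatives. By the
   sewing lemma and Chen's relation, theta solves the equation defining C^2 if and only if
     theta_t - theta_s = theta'_s x_{s,t} + 1/2 D2_s : x_{s,t} x_{s,t}^*
                          + D2_s : A_{s,t} + D_s : <w>_{s,t} + O(|t - s|^nu)
   for some nu > 1, where A = (X^* - X)/2 is the antisymmetric part. This turns the Ito formula into a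
   Taylor expansion of g in both variables. The cross terms agree because the y-derivative and the
   path derivative of g commute (integrate in y and use uniqueness of the path derivative), and
   A kills them because they are symmetric in the two driving indices. *)

theory Submission
  imports Defs
begin

section \<open>Sewing and mesh limits\<close>

text \<open>The expansion freezes the space variable at the right endpoint: g(t, \<theta>_t) - g(s,
  \<theta>_s) is the time increment at y = \<theta>_t plus a space increment at time s. The
  existence of the integrals in the definition of C^2 gives no rate at all. The rate comes from
  sewing, whose constant depends only on the Hoelder constants of the germ, and these are locally
  uniform because y enters continuously in Hoelder norms. Hence orders of magnitude carry a
  parameter set from the start. A second obstacle is that path derivatives are chosen, not computed:
  uniqueness on [0, T] identifies the choice with each derivative found by calculation. The
  exponents balance as follows: germ defects, and products of a controlled remainder with an
  increment of x, have order 2\<alpha> + \<beta> > 1; third-order Taylor errors have order 3\<alpha>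
  > 1; terms of order 2\<alpha> < 1 have to match exactly.\<close>

lemma powr_le_split:
  fixes d h l a :: real
  assumes "0 \<le> d" "d \<le> h" "d \<le> l" "0 \<le> a"
  shows "d powr (1 + 2 * a) \<le> h powr a * l powr a * d"
proof (cases "d = 0")
  case False
  then have "d powr (1 + 2 * a) = d powr a * d powr a * d"
    using assms by (simp add: powr_add[symmetric] powr_mult_base algebra_simps)
  also have "\<dots> \<le> h powr a * l powr a * d"
    using assms by (intro mult_right_mono mult_mono powr_mono2) auto
  finally show ?thesis .
qed auto

text \<open>The sum of the geometric series of dyadic corrections, with ratio
  \<open>2 powr - a\<close> for a = (\<mu> - 1) / 2; the factor \<open>T powr a\<close> is the mesh
  power at level zero. It depends on the exponent and the horizon alone, which makes sewing uniform
  over families of germs.\<close>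

definition sew_const :: "real \<Rightarrow> real \<Rightarrow> real" where
  "sew_const T \<mu> = T powr ((\<mu> - 1) / 2) / (1 - 2 powr - ((\<mu> - 1) / 2))"

lemma sew_const_nonneg: "\<mu> > 1 \<Longrightarrow> 0 \<le> sew_const T \<mu>"
  using powr_less_one[of 2 "- ((\<mu> - 1) / 2)"] unfolding sew_const_def
  by (intro divide_nonneg_nonneg powr_ge_zero) simp

text \<open>The bound \<open>powr_le_split\<close> spends half of the excess \<open>\<mu> - 1\<close> on the mesh, which makes the dyadic
  corrections summable, and keeps the other half as decay in \<open>t - s\<close>.\<close>

lemma sewing:
  fixes \<Xi> :: "real \<Rightarrow> real \<Rightarrow> 'e::banach"
  assumes T: "T > 0" and \<mu>: "\<mu> > 1" and K: "K \<ge> 0"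
    and diag: "\<And>s. \<Xi> s s = 0"
    and delta: "\<And>s r t. 0 \<le> s \<Longrightarrow> s < r \<Longrightarrow> r < t \<Longrightarrow> t \<le> T \<Longrightarrow>
       norm (\<Xi> s t - \<Xi> s r - \<Xi> r t) \<le> K * (t - s) powr \<mu>"
  obtains I where "\<And>s t. 0 \<le> s \<Longrightarrow> s \<le> t \<Longrightarrow> t \<le> T \<Longrightarrow>
       norm (I t - I s - \<Xi> s t) \<le> K * sew_const T \<mu> * (t - s) powr ((1 + \<mu>) / 2)"
proof -
  define a where "a = (\<mu> - 1) / 2"
  have a: "a > 0" and \<mu>a: "\<mu> = 1 + 2 * a" using \<mu> by (auto simp: a_def field_simps)
  define q where "q = 2 powr - a"
  have q: "0 < q" "q < 1" using a by (auto simp: q_def powr_less_one)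
  define h where "h n = T / 2 ^ n" for n :: nat
  have h_pos: "h n > 0" for n using T by (simp add: h_def)
  have hpow: "h n powr b = T powr b * (2 powr - b) ^ n" for n b
  proof -
    have "(2 ^ n) powr b = (2 powr b) ^ n"
      by (induction n) (auto simp: powr_mult)
    then show ?thesis using T by (simp add: h_def powr_divide powr_minus_divide power_divide)
  qed
  \<comment> \<open>Clamping the dyadic grid of [0, T] into [s, t] lets one grid serve all
    subintervals, so that sums over different intervals can be compared cell by cell. Cells outside
    [s, t] collapse to a point and contribute nothing by \<open>diag\<close>.\<close>
  define cl where "cl s t r = max s (min r t)" for s t r :: real
  define pt where "pt n i = real i * h n" for n i
  have cl_mono: "cl s t p \<le> cl s t q" if "p \<le> q" for s t p q
    using that by (simp add: cl_def max.coboundedI2 min.coboundedI1)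
  have cl_ge: "s \<le> cl s t p" for s t p by (simp add: cl_def)
  have cl_le: "cl s t p \<le> t" if "s \<le> t" for s t p using that by (simp add: cl_def)
  have cl_diff: "cl s t (p + l) - cl s t p \<le> l" if "0 \<le> l" for s t p l
    using that by (simp add: cl_def max_def min_def)
  have pt0: "pt n 0 = 0" and ptT: "pt n (2 ^ n) = T" for n by (auto simp: pt_def h_def)
  have ptS: "pt n (Suc i) = pt n i + h n" for n i by (simp add: pt_def algebra_simps)
  have h_half: "h n = 2 * h (Suc n)" for n by (simp add: h_def)
  have pt_half: "pt (Suc n) (2 * i) = pt n i" for n i by (simp add: pt_def h_def)
  have pt_nonneg: "pt n i \<ge> 0" for n i using h_pos[of n] by (simp add: pt_def)
  \<comment> \<open>Clamped grid points may coincide, so the defect bound is needed for weak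
    inequalities too.\<close>
  have delta': "norm (\<Xi> s t - \<Xi> s r - \<Xi> r t) \<le> K * (t - s) powr \<mu>"
    if "0 \<le> s" "s \<le> r" "r \<le> t" "t \<le> T" for s r t
  proof (cases "s = r \<or> r = t")
    case True then show ?thesis using diag K by auto
  next
    case False then show ?thesis using delta that by auto
  qed
  define S where "S n s t = (\<Sum>i<2 ^ n. \<Xi> (cl s t (pt n i)) (cl s t (pt n (Suc i))))" for n s t
  have S0: "S 0 s t = \<Xi> s t" if "0 \<le> s" "s \<le> t" "t \<le> T" for s t
    using that ptT[of 0] pt0[of 0] T by (simp add: S_def cl_def)
  have step: "norm (S (Suc n) s t - S n s t) \<le> K * T powr a * (t - s) powr (1 + a) * q ^ n"
    if st: "0 \<le> s" "s \<le> t" "t \<le> T" for n s t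
  proof -
    have split: "S (Suc n) s t = (\<Sum>i<2 ^ n. \<Xi> (cl s t (pt n i)) (cl s t (pt (Suc n) (Suc (2 * i))))
        + \<Xi> (cl s t (pt (Suc n) (Suc (2 * i)))) (cl s t (pt n (Suc i))))"
    proof -
      have "(\<Sum>i<2 * m. f i) = (\<Sum>i<m. f (2 * i) + f (Suc (2 * i)))" for f :: "nat \<Rightarrow> 'e" and m
        by (induction m) (auto simp: algebra_simps)
      from this[of "\<lambda>i. \<Xi> (cl s t (pt (Suc n) i)) (cl s t (pt (Suc n) (Suc i)))" "2 ^ n"]
      show ?thesis using pt_half[of n] pt_half[of n "Suc _"] by (simp add: S_def)
    qed
    define d where "d i = cl s t (pt n (Suc i)) - cl s t (pt n i)" for i
    have "norm (S (Suc n) s t - S n s t)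
        = norm (\<Sum>i<2 ^ n. \<Xi> (cl s t (pt n i)) (cl s t (pt n (Suc i)))
            - \<Xi> (cl s t (pt n i)) (cl s t (pt (Suc n) (Suc (2 * i))))
            - \<Xi> (cl s t (pt (Suc n) (Suc (2 * i)))) (cl s t (pt n (Suc i))))"
      unfolding split S_def[of n]
      by (subst norm_minus_commute) (simp only: sum_subtractf[symmetric] diff_diff_eq)
    also have "\<dots> \<le> (\<Sum>i<2 ^ n. K * d i powr \<mu>)"
    proof (rule order_trans[OF norm_sum sum_mono])
      fix i assume "i \<in> {..<(2::nat) ^ n}"
      have "pt n i \<le> pt (Suc n) (Suc (2 * i))" "pt (Suc n) (Suc (2 * i)) \<le> pt n (Suc i)"
        using h_pos[of "Suc n"] h_half[of n] by (simp_all add: pt_def algebra_simps)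
      then show "norm (\<Xi> (cl s t (pt n i)) (cl s t (pt n (Suc i)))
            - \<Xi> (cl s t (pt n i)) (cl s t (pt (Suc n) (Suc (2 * i))))
            - \<Xi> (cl s t (pt (Suc n) (Suc (2 * i)))) (cl s t (pt n (Suc i)))) \<le> K * d i powr \<mu>"
        unfolding d_def using st by (intro delta' cl_mono order_trans[OF st(1) cl_ge] order_trans[OF cl_le st(3)]) auto
    qed
    also have "\<dots> \<le> (\<Sum>i<2 ^ n. K * (h n powr a * (t - s) powr a * d i))"
    proof (intro sum_mono mult_left_mono K)
      fix i
      show "d i powr \<mu> \<le> h n powr a * (t - s) powr a * d i"
        unfolding \<mu>a using a h_pos[of n] st
        using cl_mono[of "pt n i" "pt n (Suc i)" s t] cl_ge[of s t "pt n i"] cl_le[OF st(2), of "pt n (Suc i)"]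
        by (intro powr_le_split) (auto simp: d_def ptS cl_diff)
    qed
    also have "\<dots> = K * (h n powr a * (t - s) powr a) * (\<Sum>i<2 ^ n. d i)"
      by (simp add: sum_distrib_left mult_ac)
    also have "(\<Sum>i<2 ^ n. d i) = t - s"
      using sum_lessThan_telescope[of "\<lambda>i. cl s t (pt n i)" "2 ^ n"] st by (simp add: d_def pt0 ptT cl_def)
    also have "K * (h n powr a * (t - s) powr a) * (t - s) = K * T powr a * (t - s) powr (1 + a) * q ^ n"
      using st powr_mult_base[of "t - s" a] by (simp add: hpow q_def mult_ac)
    finally show ?thesis .
  qed
  define L where "L s t = \<Xi> s t + (\<Sum>n. S (Suc n) s t - S n s t)" for s t
  have geo: "(\<lambda>n. c * q ^ n) sums (c / (1 - q))" for c
    using sums_mult[OF geometric_sums[of q], of c] q by simp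
  have summn: "summable (\<lambda>n. norm (S (Suc n) s t - S n s t))" if "0 \<le> s" "s \<le> t" "t \<le> T" for s t
  proof (rule summable_comparison_test'[OF sums_summable[OF geo]])
    fix n :: nat
    show "norm (norm (S (Suc n) s t - S n s t)) \<le> K * T powr a * (t - s) powr (1 + a) * q ^ n"
      using step[OF that, of n] by simp
  qed
  have summ: "summable (\<lambda>n. S (Suc n) s t - S n s t)" if "0 \<le> s" "s \<le> t" "t \<le> T" for s t
    using summn[OF that] by (rule summable_norm_cancel)
  have lim: "(\<lambda>n. S n s t) \<longlonglongrightarrow> L s t" if st: "0 \<le> s" "s \<le> t" "t \<le> T" for s t
  proof -
    have "(\<lambda>n. \<Sum>i<n. S (Suc i) s t - S i s t) \<longlonglongrightarrow> (\<Sum>n. S (Suc n) s t - S n s t)"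
      using summ[OF st] by (rule summable_LIMSEQ)
    then have "(\<lambda>n. S n s t - S 0 s t) \<longlonglongrightarrow> (\<Sum>n. S (Suc n) s t - S n s t)"
      unfolding sum_lessThan_telescope[of "\<lambda>n. S n s t"] .
    from tendsto_add[OF tendsto_const[of "S 0 s t"] this] show ?thesis
      by (simp add: L_def S0[OF st])
  qed
  have bound: "norm (L s t - \<Xi> s t) \<le> K * sew_const T \<mu> * (t - s) powr ((1 + \<mu>) / 2)"
    if st: "0 \<le> s" "s \<le> t" "t \<le> T" for s t
  proof -
    have "norm (L s t - \<Xi> s t) \<le> (\<Sum>n. norm (S (Suc n) s t - S n s t))"
      unfolding L_def add_diff_cancel_left' using summn[OF st] by (rule summable_norm)
    also have "\<dots> \<le> (\<Sum>n. (K * T powr a * (t - s) powr (1 + a)) * q ^ n)"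
      using step[OF st] summn[OF st] sums_summable[OF geo] by (rule suminf_le)
    also have "\<dots> = (K * T powr a * (t - s) powr (1 + a)) / (1 - q)"
      by (rule sums_unique[symmetric, OF geo])
    also have "1 + a = (1 + \<mu>) / 2" by (simp add: \<mu>a)
    finally show ?thesis by (simp add: sew_const_def q_def a_def mult_ac)
  qed
  have add: "L 0 t - L 0 s = L s t" if st: "0 \<le> s" "s \<le> t" "t \<le> T" for s t
  proof -
    \<comment> \<open>Cells on either side of s cancel exactly, and only the cell that contains s
      leaves a defect. Counting that defect for all 2^n cells is affordable, since \<mu> > 1 makes
      2^n * 2^(-n \<mu>) tend to 0.\<close>
    have err: "norm (S n 0 t - S n 0 s - S n s t) \<le> K * T powr \<mu> * (2 powr (1 - \<mu>)) ^ n" for n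
    proof -
      have "norm (S n 0 t - S n 0 s - S n s t) =
          norm (\<Sum>i<2 ^ n. \<Xi> (cl 0 t (pt n i)) (cl 0 t (pt n (Suc i)))
             - \<Xi> (cl 0 s (pt n i)) (cl 0 s (pt n (Suc i))) - \<Xi> (cl s t (pt n i)) (cl s t (pt n (Suc i))))"
        by (simp add: S_def sum_subtractf)
      also have "\<dots> \<le> (\<Sum>i<(2::nat) ^ n. K * h n powr \<mu>)"
      proof (rule order_trans[OF norm_sum sum_mono])
        fix i
        have p: "0 \<le> pt n i" "pt n (Suc i) = pt n i + h n" "h n > 0"
          using pt_nonneg ptS h_pos by auto
        consider "pt n (Suc i) \<le> s" | "s \<le> pt n i" | "pt n i < s" "s < pt n (Suc i)" by linarith
        then show "norm (\<Xi> (cl 0 t (pt n i)) (cl 0 t (pt n (Suc i)))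
             - \<Xi> (cl 0 s (pt n i)) (cl 0 s (pt n (Suc i))) - \<Xi> (cl s t (pt n i)) (cl s t (pt n (Suc i))))
           \<le> K * h n powr \<mu>"
        proof cases
          case 1
          then have "cl 0 t (pt n i) = pt n i" "cl 0 s (pt n i) = pt n i" "cl s t (pt n i) = s"
            "cl 0 t (pt n (Suc i)) = pt n (Suc i)" "cl 0 s (pt n (Suc i)) = pt n (Suc i)"
            "cl s t (pt n (Suc i)) = s" using p st by (auto simp: cl_def)
          then show ?thesis using K diag by simp
        next
          case 2
          then have "cl 0 s (pt n i) = s" "cl 0 s (pt n (Suc i)) = s"
             "cl 0 t (pt n i) = cl s t (pt n i)" "cl 0 t (pt n (Suc i)) = cl s t (pt n (Suc i))"
            using p st by (auto simp: cl_def)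
          then show ?thesis using K diag by simp
        next
          case 3
          then have e: "cl 0 t (pt n i) = pt n i" "cl 0 s (pt n i) = pt n i" "cl s t (pt n i) = s"
            "cl 0 t (pt n (Suc i)) = min (pt n (Suc i)) t" "cl 0 s (pt n (Suc i)) = s"
            "cl s t (pt n (Suc i)) = min (pt n (Suc i)) t" using p st by (auto simp: cl_def)
          have "norm (\<Xi> (pt n i) (min (pt n (Suc i)) t) - \<Xi> (pt n i) s - \<Xi> s (min (pt n (Suc i)) t))
              \<le> K * (min (pt n (Suc i)) t - pt n i) powr \<mu>"
            using 3 p st by (intro delta') auto
          also have "\<dots> \<le> K * h n powr \<mu>"
            using 3 p st \<mu> K by (intro mult_left_mono powr_mono2) auto
          finally show ?thesis unfolding e .
        qed
      qed
      also have "\<dots> = K * T powr \<mu> * (2 ^ n * (2 powr - \<mu>) ^ n)"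
        by (simp add: hpow)
      also have "2 ^ n * (2 powr - \<mu>) ^ n = (2 powr (1 - \<mu>)) ^ n"
        using powr_mult_base[of 2 "- \<mu>"] by (simp only: power_mult_distrib[symmetric]) simp
      finally show ?thesis by (simp add: mult_ac)
    qed
    have "(\<lambda>n. K * T powr \<mu> * (2 powr (1 - \<mu>)) ^ n) \<longlonglongrightarrow> K * T powr \<mu> * 0"
      using \<mu> by (intro tendsto_intros LIMSEQ_power_zero) (auto simp: powr_less_one)
    then have "(\<lambda>n. S n 0 t - S n 0 s - S n s t) \<longlonglongrightarrow> 0"
      by (intro Lim_null_comparison[OF always_eventually[OF allI[OF err]]]) simp
    moreover have "(\<lambda>n. S n 0 t - S n 0 s - S n s t) \<longlonglongrightarrow> L 0 t - L 0 s - L s t"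
      using st by (intro tendsto_intros lim) auto
    ultimately have "L 0 t - L 0 s - L s t = 0" using LIMSEQ_unique by blast
    then show ?thesis by simp
  qed
  show thesis
    by (rule that[of "L 0"]) (simp add: add bound)
qed

text \<open>A function whose increments match the germ up to order \<nu> > 1 is its integral: over
  an arbitrary partition the increments telescope, and the errors sum to at most |C| T times the
  mesh to the power \<nu> - 1. Cells beyond \<open>t\<close> collapse under \<open>min\<close>, and
  there \<open>loc\<close> forces the germ to vanish.\<close>

lemma has_mesh_limit_local:
  fixes \<Xi> :: "real \<Rightarrow> real \<Rightarrow> 'e::real_normed_vector"
  assumes T: "T > 0" and \<nu>: "\<nu> > 1" and t: "0 \<le> t" "t \<le> T"
    and loc: "\<And>s u. 0 \<le> s \<Longrightarrow> s \<le> u \<Longrightarrow> u \<le> T \<Longrightarrow> norm (I u - I s - \<Xi> s u) \<le> C * (u - s) powr \<nu>"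
  shows "has_mesh_limit T (\<lambda>r u. \<Xi> (min r t) (min u t)) (I t - I 0)"
  unfolding has_mesh_limit_def
proof (intro allI impI)
  fix \<epsilon> :: real assume \<epsilon>: "\<epsilon> > 0"
  \<comment> \<open>Chosen so that (|C| T + 1) \<delta>^(\<nu> - 1) = \<epsilon>; the added 1 makes
    the final inequality strict and keeps the quotient defined for C = 0.\<close>
  define \<delta> where "\<delta> = (\<epsilon> / (\<bar>C\<bar> * T + 1)) powr (1 / (\<nu> - 1))"
  have pos: "\<bar>C\<bar> * T + 1 > 0" using T by (simp add: add_nonneg_pos)
  have \<delta>: "\<delta> > 0" using \<epsilon> pos by (simp add: \<delta>_def)
  have \<delta>p: "\<delta> powr (\<nu> - 1) = \<epsilon> / (\<bar>C\<bar> * T + 1)"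
    using \<epsilon> \<nu> pos by (simp add: \<delta>_def powr_powr)
  show "\<exists>\<delta>>0. \<forall>n p. p 0 = 0 \<and> p n = T \<and> (\<forall>i<n. p i < p (Suc i) \<and> p (Suc i) - p i < \<delta>) \<longrightarrow>
      norm ((\<Sum>i<n. \<Xi> (min (p i) t) (min (p (Suc i)) t)) - (I t - I 0)) < \<epsilon>"
  proof (intro exI[of _ \<delta>] conjI \<delta> allI impI, elim conjE)
    fix n :: nat and p :: "nat \<Rightarrow> real"
    assume p0: "p 0 = 0" and pn: "p n = T"
      and p: "\<forall>i<n. p i < p (Suc i) \<and> p (Suc i) - p i < \<delta>"
    have mono: "p i \<le> p j" if "i \<le> j" "j \<le> n" for i j
      using that
    proof (induction j rule: dec_induct)
      case (step k)
      then show ?case using p by (fastforce dest: Suc_le_lessD)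
    qed auto
    have range: "0 \<le> p i" "p i \<le> T" if "i \<le> n" for i
      using mono[of 0 i] mono[of i n] that p0 pn by auto
    have tel: "(\<Sum>i<n. I (min (p (Suc i)) t) - I (min (p i) t)) = I t - I 0"
      by (subst sum_lessThan_telescope) (use p0 pn t in auto)
    have "norm ((\<Sum>i<n. \<Xi> (min (p i) t) (min (p (Suc i)) t)) - (I t - I 0))
        = norm (\<Sum>i<n. I (min (p (Suc i)) t) - I (min (p i) t) - \<Xi> (min (p i) t) (min (p (Suc i)) t))"
      unfolding tel[symmetric] by (subst norm_minus_commute) (simp add: sum_subtractf)
    also have "\<dots> \<le> (\<Sum>i<n. \<bar>C\<bar> * (\<delta> powr (\<nu> - 1) * (p (Suc i) - p i)))"
    proof (rule order_trans[OF norm_sum sum_mono])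
      fix i assume "i \<in> {..<n}"
      then have i: "i < n" by simp
      define d where "d = min (p (Suc i)) t - min (p i) t"
      have pi: "p i < p (Suc i)" "p (Suc i) - p i < \<delta>" using p i by auto
      have d: "0 \<le> d" "d \<le> \<delta>" "d \<le> p (Suc i) - p i" using pi by (auto simp: d_def)
      have "norm (I (min (p (Suc i)) t) - I (min (p i) t) - \<Xi> (min (p i) t) (min (p (Suc i)) t))
          \<le> C * d powr \<nu>"
        unfolding d_def using range[of i] range[of "Suc i"] i t pi by (intro loc) auto
      also have "\<dots> \<le> \<bar>C\<bar> * d powr \<nu>" by (intro mult_right_mono) auto
      also have "d powr \<nu> = d powr (\<nu> - 1) * d"
        using d powr_mult_base[of d "\<nu> - 1"] by (simp add: mult.commute)
      also have "\<bar>C\<bar> * \<dots> \<le> \<bar>C\<bar> * (\<delta> powr (\<nu> - 1) * (p (Suc i) - p i))"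
        using d \<nu> by (intro mult_left_mono mult_mono powr_mono2) auto
      finally show "norm (I (min (p (Suc i)) t) - I (min (p i) t) - \<Xi> (min (p i) t) (min (p (Suc i)) t))
        \<le> \<bar>C\<bar> * (\<delta> powr (\<nu> - 1) * (p (Suc i) - p i))" .
    qed
    also have "\<dots> = \<bar>C\<bar> * T * \<delta> powr (\<nu> - 1)"
      unfolding sum_distrib_left[symmetric] sum_lessThan_telescope by (simp add: p0 pn)
    also have "\<dots> = \<epsilon> * (\<bar>C\<bar> * T / (\<bar>C\<bar> * T + 1))" by (simp add: \<delta>p)
    also have "\<dots> < \<epsilon> * 1" using \<epsilon> pos by (intro mult_strict_left_mono) auto
    finally show "norm ((\<Sum>i<n. \<Xi> (min (p i) t) (min (p (Suc i)) t)) - (I t - I 0)) < \<epsilon>" by simp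
  qed
qed

text \<open>Two limits can be compared because uniform partitions provide arbitrarily fine meshes;
  without them the implication in \<open>has_mesh_limit\<close> could be vacuous.\<close>

lemma has_mesh_limit_unique:
  assumes T: "T > 0" and "has_mesh_limit T \<Xi> L" "has_mesh_limit T \<Xi> M"
  shows "L = M"
proof (rule ccontr)
  assume "L \<noteq> M"
  define \<epsilon> where "\<epsilon> = norm (L - M) / 2"
  have \<epsilon>: "\<epsilon> > 0" using \<open>L \<noteq> M\<close> by (simp add: \<epsilon>_def)
  obtain \<delta>1 where \<delta>1: "\<delta>1 > 0" "\<forall>(n::nat) p. p 0 = 0 \<and> p n = T \<and>
      (\<forall>i<n. p i < p (Suc i) \<and> p (Suc i) - p i < \<delta>1) \<longrightarrow> norm ((\<Sum>i<n. \<Xi> (p i) (p (Suc i))) - L) < \<epsilon>"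
    using assms(2)[unfolded has_mesh_limit_def, rule_format, OF \<epsilon>] by (elim exE conjE) (rule that)
  obtain \<delta>2 where \<delta>2: "\<delta>2 > 0" "\<forall>(n::nat) p. p 0 = 0 \<and> p n = T \<and>
      (\<forall>i<n. p i < p (Suc i) \<and> p (Suc i) - p i < \<delta>2) \<longrightarrow> norm ((\<Sum>i<n. \<Xi> (p i) (p (Suc i))) - M) < \<epsilon>"
    using assms(3)[unfolded has_mesh_limit_def, rule_format, OF \<epsilon>] by (elim exE conjE) (rule that)
  obtain n :: nat where n: "T / min \<delta>1 \<delta>2 < real n" using reals_Archimedean2 by blast
  have n0: "n > 0" using n T \<delta>1(1) \<delta>2(1) by (cases n) (auto simp: divide_less_0_iff)
  define p where "p i = real i * (T / n)" for i
  have lt: "T / n < min \<delta>1 \<delta>2" 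
  proof -
    define m where "m = min \<delta>1 \<delta>2"
    have "m > 0" using \<delta>1(1) \<delta>2(1) by (simp add: m_def)
    then show ?thesis using n n0 T unfolding m_def[symmetric] by (simp add: field_simps)
  qed
  have pS: "p (Suc i) = p i + T / n" for i by (simp add: p_def distrib_right add_divide_distrib)
  have "T / n > 0" using n0 T by simp
  then have "p 0 = 0" "p n = T" "\<forall>i<n. p i < p (Suc i) \<and> p (Suc i) - p i < min \<delta>1 \<delta>2"
    using n0 lt unfolding pS by (auto simp: p_def)
  then have "norm ((\<Sum>i<n. \<Xi> (p i) (p (Suc i))) - L) < \<epsilon>" "norm ((\<Sum>i<n. \<Xi> (p i) (p (Suc i))) - M) < \<epsilon>"
    using \<delta>1(2)[rule_format, of p n] \<delta>2(2)[rule_format, of p n] by auto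
  then have "norm (L - M) < 2 * \<epsilon>"
    using norm_triangle_ineq4[of "(\<Sum>i<n. \<Xi> (p i) (p (Suc i))) - M" "(\<Sum>i<n. \<Xi> (p i) (p (Suc i))) - L"] by simp
  then show False by (simp add: \<epsilon>_def)
qed

text \<open>Both f t - f 0 and 0 are mesh limits of the zero germ. This is the uniqueness half of
  sewing.\<close>

lemma small_increments_const:
  fixes f :: "real \<Rightarrow> 'e::real_normed_vector"
  assumes T: "T > 0" and \<nu>: "\<nu> > 1" and t: "0 \<le> t" "t \<le> T"
    and loc: "\<And>s u. 0 \<le> s \<Longrightarrow> s \<le> u \<Longrightarrow> u \<le> T \<Longrightarrow> norm (f u - f s) \<le> C * (u - s) powr \<nu>"
  shows "f t = f 0"
proof -
  have "has_mesh_limit T (\<lambda>r u. (\<lambda>_ _. 0) (min r t) (min u t)) (f t - f 0)"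
    using loc by (intro has_mesh_limit_local[OF T \<nu> t]) simp
  moreover have "has_mesh_limit T (\<lambda>r u. (\<lambda>_ _. 0) (min r t) (min u t)) (0 :: 'e)"
    by (auto simp: has_mesh_limit_def intro: exI[of _ 1])
  ultimately show ?thesis using has_mesh_limit_unique[OF T] by fastforce
qed

section \<open>Uniform orders of magnitude\<close>

text \<open>The index set is arbitrary and the size \<open>r\<close> is separate from it, so one
  calculus covers pairs (s, t), such pairs with a parameter y, and triples s < r < t measured by the
  length t - s of the outer interval.\<close>

definition bigO_on :: "'i set \<Rightarrow> ('i \<Rightarrow> real) \<Rightarrow> real \<Rightarrow> ('i \<Rightarrow> 'e::real_normed_vector) \<Rightarrow> bool" where
  "bigO_on S r \<gamma> U \<longleftrightarrow> (\<exists>C. \<forall>i\<in>S. norm (U i) \<le> C * r i powr \<gamma>)"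

lemma bigO_onI: "(\<And>i. i \<in> S \<Longrightarrow> norm (U i) \<le> C * r i powr \<gamma>) \<Longrightarrow> bigO_on S r \<gamma> U"
  by (auto simp: bigO_on_def)

lemma bigO_onD:
  assumes "bigO_on S r \<gamma> U"
  shows "\<exists>C\<ge>0. \<forall>i\<in>S. norm (U i) \<le> C * r i powr \<gamma>"
proof -
  obtain C where C: "\<forall>i\<in>S. norm (U i) \<le> C * r i powr \<gamma>"
    using assms by (auto simp: bigO_on_def)
  have "norm (U i) \<le> \<bar>C\<bar> * r i powr \<gamma>" if "i \<in> S" for i
    using C that by (meson abs_ge_self mult_right_mono order_trans powr_ge_zero)
  then show ?thesis by (intro exI[of _ "\<bar>C\<bar>"]) auto
qed

lemma bigO_on_add:
  assumes "bigO_on S r \<gamma> U" "bigO_on S r \<gamma> V"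
  shows "bigO_on S r \<gamma> (\<lambda>i. U i + V i)"
proof -
  obtain C where C: "C \<ge> 0" "\<And>i. i \<in> S \<Longrightarrow> norm (U i) \<le> C * r i powr \<gamma>"
    using bigO_onD[OF assms(1)] by auto
  obtain D where D: "D \<ge> 0" "\<And>i. i \<in> S \<Longrightarrow> norm (V i) \<le> D * r i powr \<gamma>"
    using bigO_onD[OF assms(2)] by auto
  then show ?thesis
  proof (intro bigO_onI[where C = "C + D"])
    fix i assume "i \<in> S"
    then have "norm (U i) + norm (V i) \<le> (C + D) * r i powr \<gamma>"
      using C D by (simp add: distrib_right add_mono)
    then show "norm (U i + V i) \<le> (C + D) * r i powr \<gamma>"
      using norm_triangle_ineq order_trans by blast
  qed
qed

lemma bigO_on_bounded_linear:
  assumes "bounded_linear h" "bigO_on S r \<gamma> U"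
  shows "bigO_on S r \<gamma> (\<lambda>i. h (U i))"
proof -
  obtain B where B: "B > 0" "\<And>x. norm (h x) \<le> norm x * B"
    using bounded_linear.pos_bounded[OF assms(1)] by blast
  obtain C where C: "C \<ge> 0" "\<And>i. i \<in> S \<Longrightarrow> norm (U i) \<le> C * r i powr \<gamma>"
    using bigO_onD[OF assms(2)] by auto
  show ?thesis
  proof (rule bigO_onI[where C = "C * B"])
    fix i assume "i \<in> S"
    then have "norm (U i) * B \<le> C * r i powr \<gamma> * B" using C(2) B(1) by (intro mult_right_mono) auto
    then show "norm (h (U i)) \<le> C * B * r i powr \<gamma>" using B(2)[of "U i"] by (simp add: mult_ac)
  qed
qed

lemmas bigO_on_minus = bigO_on_bounded_linear[OF bounded_linear_minus[OF bounded_linear_ident]]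
lemmas bigO_on_scaleR = bigO_on_bounded_linear[OF bounded_linear_scaleR_right]

lemma bigO_on_diff:
  "bigO_on S r \<gamma> U \<Longrightarrow> bigO_on S r \<gamma> V \<Longrightarrow> bigO_on S r \<gamma> (\<lambda>i. U i - V i)"
  using bigO_on_add[OF _ bigO_on_minus, of S r \<gamma> U V] by simp

lemma bigO_on_bilinear:
  assumes "bounded_bilinear h" "bigO_on S r a U" "bigO_on S r b V" "\<gamma> = a + b"
  shows "bigO_on S r \<gamma> (\<lambda>i. h (U i) (V i))"
proof -
  obtain B where B: "B > 0" "\<And>x y. norm (h x y) \<le> norm x * norm y * B"
    using bounded_bilinear.pos_bounded[OF assms(1)] by blast
  obtain C where C: "C \<ge> 0" "\<And>i. i \<in> S \<Longrightarrow> norm (U i) \<le> C * r i powr a"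
    using bigO_onD[OF assms(2)] by auto
  obtain D where D: "D \<ge> 0" "\<And>i. i \<in> S \<Longrightarrow> norm (V i) \<le> D * r i powr b"
    using bigO_onD[OF assms(3)] by auto
  show ?thesis
  proof (rule bigO_onI[where C = "C * D * B"])
    fix i assume "i \<in> S"
    then have "norm (U i) * norm (V i) * B \<le> (C * r i powr a) * (D * r i powr b) * B"
      using B C D by (intro mult_right_mono mult_mono) auto
    then show "norm (h (U i) (V i)) \<le> C * D * B * r i powr \<gamma>"
      using B(2)[of "U i" "V i"] by (simp add: mult_ac powr_add assms(4))
  qed
qed

lemma bigO_on_mono:
  assumes "bigO_on S r a U" "b \<le> a" "\<And>i. i \<in> S \<Longrightarrow> 0 \<le> r i \<and> r i \<le> T"
  shows "bigO_on S r b U"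
proof -
  obtain C where C: "C \<ge> 0" "\<And>i. i \<in> S \<Longrightarrow> norm (U i) \<le> C * r i powr a"
    using bigO_onD[OF assms(1)] by auto
  show ?thesis
  proof (rule bigO_onI[where C = "C * T powr (a - b)"])
    fix i assume i: "i \<in> S"
    have "norm (U i) \<le> C * (r i powr (a - b) * r i powr b)"
      using C(2)[OF i] by (simp add: powr_add[symmetric])
    also have "\<dots> \<le> C * (T powr (a - b) * r i powr b)"
      using assms(2) assms(3)[OF i] C(1) by (intro mult_left_mono mult_right_mono powr_mono2) auto
    finally show "norm (U i) \<le> C * T powr (a - b) * r i powr b" by (simp add: mult_ac)
  qed
qed

lemma bigO_on_le:
  assumes "bigO_on S r \<gamma> V" "\<And>i. i \<in> S \<Longrightarrow> norm (U i) \<le> c * norm (V i)"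
  shows "bigO_on S r \<gamma> U"
proof -
  obtain C where C: "C \<ge> 0" "\<And>i. i \<in> S \<Longrightarrow> norm (V i) \<le> C * r i powr \<gamma>"
    using bigO_onD[OF assms(1)] by auto
  show ?thesis
  proof (rule bigO_onI[where C = "\<bar>c\<bar> * C"])
    fix i assume i: "i \<in> S"
    have "norm (U i) \<le> c * norm (V i)" by (rule assms(2)[OF i])
    also have "\<dots> \<le> \<bar>c\<bar> * norm (V i)" by (intro mult_right_mono) auto
    also have "\<dots> \<le> \<bar>c\<bar> * (C * r i powr \<gamma>)" using C(2)[OF i] by (intro mult_left_mono) auto
    finally show "norm (U i) \<le> \<bar>c\<bar> * C * r i powr \<gamma>" by (simp add: mult_ac)
  qed
qed

lemma bigO_on_cong:
  assumes "bigO_on S r \<gamma> V" "\<And>i. i \<in> S \<Longrightarrow> U i = V i"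
  shows "bigO_on S r \<gamma> U"
  using assms by (auto simp: bigO_on_def)

text \<open>Order zero stands for boundedness. Positive sizes matter here, because
  \<open>0 powr 0 = 0\<close> would otherwise demand that \<open>U\<close> vanish.\<close>

lemma bigO_on_0I:
  assumes "\<And>i. i \<in> S \<Longrightarrow> r i > 0" "\<And>i. i \<in> S \<Longrightarrow> norm (U i) \<le> B"
  shows "bigO_on S r 0 U"
  using assms by (intro bigO_onI[where C = B]) fastforce

section \<open>Hoelder bounds with a constant common to a parameter set\<close>

definition unif_holder ::
  "real \<Rightarrow> real \<Rightarrow> 'y set \<Rightarrow> ('y \<Rightarrow> real \<Rightarrow> real \<Rightarrow> 'e::real_normed_vector) \<Rightarrow> bool" where
  "unif_holder T \<gamma> Y U \<longleftrightarrow>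
     (\<exists>C. \<forall>y\<in>Y. \<forall>s t. 0 \<le> s \<and> s < t \<and> t \<le> T \<longrightarrow> norm (U y s t) \<le> C * (t - s) powr \<gamma>)"

text \<open>A single path is the case of a one-point parameter set, so that results on families need
  no second version.\<close>

abbreviation holder_O :: "real \<Rightarrow> real \<Rightarrow> (real \<Rightarrow> real \<Rightarrow> 'e::real_normed_vector) \<Rightarrow> bool" where
  "holder_O T \<gamma> U \<equiv> unif_holder T \<gamma> {()} (\<lambda>_. U)"

lemma unif_holderD:
  assumes "unif_holder T \<gamma> Y U"
  shows "\<exists>C\<ge>0. \<forall>y\<in>Y. \<forall>s t. 0 \<le> s \<and> s < t \<and> t \<le> T \<longrightarrow> norm (U y s t) \<le> C * (t - s) powr \<gamma>"
proof -
  obtain C where C: "\<forall>y\<in>Y. \<forall>s t. 0 \<le> s \<and> s < t \<and> t \<le> T \<longrightarrow> norm (U y s t) \<le> C * (t - s) powr \<gamma>"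
    using assms by (auto simp: unif_holder_def)
  have "norm (U y s t) \<le> \<bar>C\<bar> * (t - s) powr \<gamma>" if "y \<in> Y" "0 \<le> s" "s < t" "t \<le> T" for y s t
    using C that by (meson abs_ge_self mult_right_mono order_trans powr_ge_zero)
  then show ?thesis by (intro exI[of _ "\<bar>C\<bar>"]) auto
qed

text \<open>The parameter may depend on the index: with \<open>y i\<close> the value of a path at
  its right endpoint, bounds uniform in y become bounds along the path. Allowing t - s to be smaller
  than \<open>r\<close> lets increments over subintervals be measured by the outer interval.\<close>

lemma unif_holder_bigO:
  assumes "unif_holder T \<gamma> Y U" "\<gamma> \<ge> 0"
    and "\<And>i. i \<in> S \<Longrightarrow> y i \<in> Y \<and> 0 \<le> s i \<and> s i < t i \<and> t i \<le> T \<and> t i - s i \<le> r i"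
  shows "bigO_on S r \<gamma> (\<lambda>i. U (y i) (s i) (t i))"
proof -
  obtain C where C: "C \<ge> 0"
    "\<And>y s t. y \<in> Y \<Longrightarrow> 0 \<le> s \<Longrightarrow> s < t \<Longrightarrow> t \<le> T \<Longrightarrow> norm (U y s t) \<le> C * (t - s) powr \<gamma>"
    using unif_holderD[OF assms(1)] by auto
  show ?thesis
  proof (rule bigO_onI)
    fix i assume i: "i \<in> S"
    have "norm (U (y i) (s i) (t i)) \<le> C * (t i - s i) powr \<gamma>" using assms(3)[OF i] by (intro C) auto
    also have "\<dots> \<le> C * r i powr \<gamma>"
      using assms(2) assms(3)[OF i] C(1) by (intro mult_left_mono powr_mono2) auto
    finally show "norm (U (y i) (s i) (t i)) \<le> C * r i powr \<gamma>" .
  qed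
qed

lemmas holder_bigO = unif_holder_bigO[where Y = "{()}" and y = "\<lambda>_. ()", simplified]

lemma unif_holder_iff_bigO:
  "unif_holder T \<gamma> Y U \<longleftrightarrow>
     bigO_on (Y \<times> triangle T) (\<lambda>i. snd (snd i) - fst (snd i)) \<gamma> (\<lambda>i. U (fst i) (fst (snd i)) (snd (snd i)))"
  by (auto simp: unif_holder_def bigO_on_def triangle_def)

lemma holder_O_iff_bigO:
  "holder_O T \<gamma> U \<longleftrightarrow> bigO_on (triangle T) (\<lambda>i. snd i - fst i) \<gamma> (\<lambda>i. U (fst i) (snd i))"
  by (auto simp: unif_holder_def bigO_on_def triangle_def)

lemma bdd_above_holder_quotients_iff: "bdd_above (holder_quotients T \<gamma> U) \<longleftrightarrow> holder_O T \<gamma> U"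
proof -
  have "norm (U s t) / \<bar>t - s\<bar> powr \<gamma> \<le> C \<longleftrightarrow> norm (U s t) \<le> C * (t - s) powr \<gamma>" if "s < t" for s t C
    using that by (simp add: pos_divide_le_eq)
  then show ?thesis
    unfolding bdd_above_def holder_quotients_def unif_holder_def triangle_def by auto
qed

lemma norm_le_holder_norm2:
  assumes "holder_O T \<gamma> U" "0 \<le> s" "s < t" "t \<le> T"
  shows "norm (U s t) \<le> holder_norm2 T \<gamma> U * (t - s) powr \<gamma>"
proof -
  have "norm (U s t) / \<bar>t - s\<bar> powr \<gamma> \<in> holder_quotients T \<gamma> U"
    using assms by (auto simp: holder_quotients_def triangle_def intro!: image_eqI[of _ _ "(s, t)"])
  then have "norm (U s t) / \<bar>t - s\<bar> powr \<gamma> \<le> holder_norm2 T \<gamma> U"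
    unfolding holder_norm2_def using assms(1) by (intro cSup_upper) (auto simp: bdd_above_holder_quotients_iff)
  then show ?thesis using assms by (simp add: pos_divide_le_eq)
qed

lemma holder_norm2_nonneg:
  assumes "holder_O T \<gamma> U" "T > 0"
  shows "holder_norm2 T \<gamma> U \<ge> 0"
proof -
  have "0 \<le> norm (U 0 T)" by simp
  also have "\<dots> \<le> holder_norm2 T \<gamma> U * (T - 0) powr \<gamma>"
    using assms by (intro norm_le_holder_norm2) auto
  finally show ?thesis using assms(2) by (simp add: zero_le_mult_iff)
qed

lemma holder_O_continuous_on:
  assumes "holder_O T \<gamma> (incr \<phi>)" "\<gamma> > 0"
  shows "continuous_on {0..T} \<phi>"
proof -
  obtain C where C: "C \<ge> 0" "\<And>s t. 0 \<le> s \<Longrightarrow> s < t \<Longrightarrow> t \<le> T \<Longrightarrow> norm (\<phi> t - \<phi> s) \<le> C * (t - s) powr \<gamma>"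
    using unif_holderD[OF assms(1)] by (auto simp: incr_def)
  have "(\<phi> \<longlongrightarrow> \<phi> s) (at s within {0..T})" if s: "s \<in> {0..T}" for s
  proof -
    have "((\<lambda>t. C * \<bar>t - s\<bar> powr \<gamma>) \<longlongrightarrow> C * \<bar>s - s\<bar> powr \<gamma>) (at s within {0..T})"
      using assms(2) by (intro tendsto_intros) (auto simp: eventually_at_filter)
    then have "((\<lambda>t. C * \<bar>t - s\<bar> powr \<gamma>) \<longlongrightarrow> 0) (at s within {0..T})"
      by simp
    moreover have "norm (\<phi> t - \<phi> s) \<le> C * \<bar>t - s\<bar> powr \<gamma>" if "t \<in> {0..T}" for t
      using C(2)[of s t] C(2)[of t s] s that by (cases t s rule: linorder_cases) (auto simp: norm_minus_commute)
    then have "\<forall>\<^sub>F t in at s within {0..T}. norm (\<phi> t - \<phi> s) \<le> C * \<bar>t - s\<bar> powr \<gamma>"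
      by (auto simp: eventually_at_filter)
    ultimately have "((\<lambda>t. \<phi> t - \<phi> s) \<longlongrightarrow> 0) (at s within {0..T})"
      using Lim_null_comparison by fast
    then show ?thesis by (simp add: LIM_zero_iff)
  qed
  then show ?thesis by (simp add: continuous_on_def)
qed

lemma Omega_iff: "\<gamma> > 0 \<Longrightarrow> \<phi> \<in> Omega T \<gamma> \<longleftrightarrow> holder_O T \<gamma> (incr \<phi>)"
  using holder_O_continuous_on by (auto simp: Omega_def bdd_above_holder_quotients_iff)

section \<open>Contractions\<close>

lemma norm_row_app_le:
  fixes a :: "'e::real_normed_vector^'d"
  shows "norm (row_app a v) \<le> norm a * norm v * real CARD('d)"
proof -
  have "norm (row_app a v) \<le> (\<Sum>j\<in>(UNIV::'d set). norm a * norm v)"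
    unfolding row_app_def
  proof (rule order_trans[OF norm_sum sum_mono])
    fix j
    have "\<bar>v $ j\<bar> * norm (a $ j) \<le> norm v * norm a"
      by (intro mult_mono component_le_norm_cart Finite_Cartesian_Product.norm_nth_le) auto
    then show "norm (v $ j *\<^sub>R a $ j) \<le> norm a * norm v" by (simp add: mult.commute)
  qed
  then show ?thesis by (simp add: mult.commute)
qed

lemma bounded_bilinear_row_app:
  "bounded_bilinear (row_app :: 'e::real_normed_vector^'d \<Rightarrow> real^'d \<Rightarrow> 'e)"
proof
  show "\<exists>K. \<forall>(a::'e^'d) v. norm (row_app a v) \<le> norm a * norm v * K"
    using norm_row_app_le by blast
qed (auto simp: row_app_def scaleR_left_distrib scaleR_right_distrib sum.distrib scaleR_sum_right mult.commute)

lemma ddot_row_app: "ddot A B = (\<Sum>i\<in>UNIV. row_app (A $ i) (B $ i))"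
  by (simp add: ddot_def row_app_def)

lemma bounded_bilinear_ddot:
  "bounded_bilinear (ddot :: 'e::real_normed_vector^'d^'d \<Rightarrow> real^'d^'d \<Rightarrow> 'e)"
proof
  interpret row_app: bounded_bilinear "row_app :: 'e^'d \<Rightarrow> real^'d \<Rightarrow> 'e" by (rule bounded_bilinear_row_app)
  show "ddot (a + a') b = ddot a b + ddot a' b" for a a' :: "'e^'d^'d" and b
    by (simp add: ddot_row_app row_app.add_left sum.distrib)
  show "ddot a (b + b') = ddot a b + ddot a b'" for a :: "'e^'d^'d" and b b'
    by (simp add: ddot_row_app row_app.add_right sum.distrib)
  show "ddot (r *\<^sub>R a) b = r *\<^sub>R ddot a b" for a :: "'e^'d^'d" and b r
    by (simp add: ddot_row_app row_app.scaleR_left scaleR_sum_right)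
  show "ddot a (r *\<^sub>R b) = r *\<^sub>R ddot a b" for a :: "'e^'d^'d" and b r
    by (simp add: ddot_row_app row_app.scaleR_right scaleR_sum_right)
  obtain K where K: "K > 0" "\<And>(a::'e^'d) b. norm (row_app a b) \<le> norm a * norm b * K"
    using row_app.pos_bounded by blast
  show "\<exists>K. \<forall>(a::'e^'d^'d) b. norm (ddot a b) \<le> norm a * norm b * K"
  proof (intro exI allI)
    fix a :: "'e^'d^'d" and b
    have "norm (ddot a b) \<le> (\<Sum>j\<in>(UNIV::'d set). norm a * norm b * K)"
      unfolding ddot_row_app
    proof (rule order_trans[OF norm_sum sum_mono])
      fix i
      have "norm (a $ i) * norm (b $ i) * K \<le> norm a * norm b * K"
        using K(1) by (intro mult_mono Finite_Cartesian_Product.norm_nth_le) auto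
      then show "norm (row_app (a $ i) (b $ i)) \<le> norm a * norm b * K"
        using K(2)[of "a $ i" "b $ i"] by simp
    qed
    then show "norm (ddot a b) \<le> norm a * norm b * (real CARD('d) * K)" by (simp add: mult_ac)
  qed
qed

interpretation row_app: bounded_bilinear "row_app :: 'e::real_normed_vector^'d \<Rightarrow> real^'d \<Rightarrow> 'e"
  by (rule bounded_bilinear_row_app)

interpretation ddot: bounded_bilinear "ddot :: 'e::real_normed_vector^'d^'d \<Rightarrow> real^'d^'d \<Rightarrow> 'e"
  by (rule bounded_bilinear_ddot)

lemma norm_vec_le_sum: "norm (x :: 'e::real_normed_vector^'n) \<le> (\<Sum>i\<in>UNIV. norm (x $ i))"
  by (simp add: norm_vec_def L2_set_le_sum)

text \<open>Entrywise lifts of a product. \<open>row_comp\<close>, \<open>outer\<close>, both terms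
  of the Leibniz rule and the matrix of contractions in the Ito formula arise this way, so their
  continuity estimates come for free.\<close>

lemma bounded_bilinear_vec_right:
  assumes "bounded_bilinear h"
  shows "bounded_bilinear (\<lambda>a b. \<chi> j::'d::finite. h a (b $ j))"
proof -
  interpret h: bounded_bilinear h by fact
  obtain K where K: "K > 0" "\<And>a b. norm (h a b) \<le> norm a * norm b * K" using h.pos_bounded by blast
  show ?thesis
  proof
    show "\<exists>K. \<forall>a b. norm (\<chi> j::'d. h a (b $ j)) \<le> norm a * norm b * K"
    proof (intro exI allI)
      fix a and b :: "'b^'d"
      have "norm (\<chi> j. h a (b $ j)) \<le> (\<Sum>j\<in>(UNIV::'d set). norm a * norm b * K)"
      proof (rule order_trans[OF norm_vec_le_sum sum_mono])
        fix j :: 'd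
        have "norm a * norm (b $ j) * K \<le> norm a * norm b * K"
          using K(1) by (intro mult_right_mono mult_left_mono Finite_Cartesian_Product.norm_nth_le) auto
        then show "norm ((\<chi> j. h a (b $ j)) $ j) \<le> norm a * norm b * K" using K(2)[of a "b $ j"] by simp
      qed
      then show "norm (\<chi> j. h a (b $ j)) \<le> norm a * norm b * (real CARD('d) * K)" by (simp add: mult_ac)
    qed
  qed (simp_all add: vec_eq_iff h.add_left h.add_right h.scaleR_left h.scaleR_right)
qed

lemma bounded_bilinear_vec_left:
  assumes "bounded_bilinear h"
  shows "bounded_bilinear (\<lambda>a b. \<chi> j::'d::finite. h (a $ j) b)"
  using bounded_bilinear.flip[OF bounded_bilinear_vec_right[OF bounded_bilinear.flip[OF assms]]] .

text \<open>The product in the chain rule \<open>\<partial>\<^sub>y g \<partial>\<^sub>\<omega> \<theta>\<close>.\<close>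

definition row_comp :: "'e::real_normed_vector^'m \<Rightarrow> real^'m^'d \<Rightarrow> 'e^'d" where
  "row_comp P Q = (\<chi> j. row_app P (Q $ j))"

lemma bounded_linear_vec_lambda:
  assumes "\<And>j. bounded_linear (f j)"
  shows "bounded_linear (\<lambda>x. \<chi> j::'d::finite. f j x)"
proof -
  have add: "f j (x + y) = f j x + f j y" and sc: "f j (r *\<^sub>R x) = r *\<^sub>R f j x" for j x y r
    using assms bounded_linear.linear linear_add linear_scale by blast+
  obtain K where K: "\<And>j x. norm (f j x) \<le> norm x * K j"
    using bounded_linear.bounded[OF assms] by metis
  show ?thesis
  proof (rule bounded_linear_intro[where K = "\<Sum>j\<in>UNIV. K j"])
    fix x
    have "norm (\<chi> j. f j x) \<le> (\<Sum>j\<in>UNIV. norm (f j x))"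
      using norm_le_l1_cart by (simp add: norm_vec_def L2_set_le_sum)
    also have "\<dots> \<le> (\<Sum>j\<in>UNIV. norm x * K j)" by (intro sum_mono K)
    finally show "norm (\<chi> j. f j x) \<le> norm x * (\<Sum>j\<in>UNIV. K j)" by (simp add: sum_distrib_left)
  qed (simp_all add: vec_eq_iff add sc)
qed

lemma bounded_bilinear_row_comp:
  "bounded_bilinear (row_comp :: 'e::real_normed_vector^'m \<Rightarrow> real^'m^'d \<Rightarrow> 'e^'d)"
  unfolding row_comp_def[abs_def] by (rule bounded_bilinear_vec_right[OF bounded_bilinear_row_app])

interpretation row_comp: bounded_bilinear "row_comp :: 'e::real_normed_vector^'m \<Rightarrow> real^'m^'d \<Rightarrow> 'e^'d"
  by (rule bounded_bilinear_row_comp)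

lemma row_app_vec: "row_app a v $ i = row_app (\<chi> j. a $ j $ i) v"
  by (simp add: row_app_def)

lemma row_app_row_comp: "row_app (row_comp P Q) v = row_app P (row_app Q v)"
proof -
  have "row_app (row_comp P Q) v = (\<Sum>j\<in>UNIV. \<Sum>k\<in>UNIV. (v $ j * Q $ j $ k) *\<^sub>R P $ k)"
    by (simp add: row_app_def row_comp_def scaleR_sum_right)
  also have "\<dots> = row_app P (row_app Q v)"
    by (subst sum.swap) (simp add: row_app_def scaleR_sum_left)
  finally show ?thesis .
qed

lemma bounded_linear_transpose:
  "bounded_linear (transpose :: 'e::real_normed_vector^'n^'m \<Rightarrow> 'e^'m^'n)"
proof -
  have "bounded_linear (\<lambda>A::'e^'n^'m. \<chi> i. \<chi> j. A $ j $ i)"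
    by (intro bounded_linear_vec_lambda bounded_linear_compose[OF bounded_linear_vec_nth bounded_linear_vec_nth])
  then show ?thesis by (simp add: transpose_def[abs_def])
qed

section \<open>Hoelder bounds uniform over compact sets of the space variable\<close>

lemma unif_holder_cong:
  assumes "unif_holder T \<gamma> Y V"
    "\<And>y s t. y \<in> Y \<Longrightarrow> 0 \<le> s \<Longrightarrow> s < t \<Longrightarrow> t \<le> T \<Longrightarrow> U y s t = V y s t"
  shows "unif_holder T \<gamma> Y U"
  using assms unfolding unif_holder_def by fastforce

lemma unif_holder_mono:
  assumes "unif_holder T a Y U" "b \<le> a"
  shows "unif_holder T b Y U"
  using assms(1) unfolding unif_holder_iff_bigO
  by (rule bigO_on_mono[OF _ assms(2), where T = T]) (auto simp: triangle_def)

lemma unif_holder_Union: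
  assumes "finite F" "\<And>c. c \<in> F \<Longrightarrow> unif_holder T \<gamma> (V c) U"
  shows "unif_holder T \<gamma> (\<Union>c\<in>F. V c) U"
  using assms
proof (induction F)
  case empty
  then show ?case by (auto simp: unif_holder_def)
next
  case (insert c F)
  obtain C where C: "C \<ge> 0" "\<forall>y\<in>V c. \<forall>s t. 0 \<le> s \<and> s < t \<and> t \<le> T \<longrightarrow> norm (U y s t) \<le> C * (t - s) powr \<gamma>"
    using unif_holderD[OF insert.prems, of c] by auto
  have "unif_holder T \<gamma> (\<Union>c\<in>F. V c) U" by (rule insert.IH) (rule insert.prems, simp)
  then obtain D where D: "D \<ge> 0"
    "\<forall>y\<in>(\<Union>c\<in>F. V c). \<forall>s t. 0 \<le> s \<and> s < t \<and> t \<le> T \<longrightarrow> norm (U y s t) \<le> D * (t - s) powr \<gamma>"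
    using unif_holderD by blast
  have "norm (U y s t) \<le> (C + D) * (t - s) powr \<gamma>"
    if "y \<in> (\<Union>c\<in>insert c F. V c)" "0 \<le> s" "s < t" "t \<le> T" for y s t
  proof -
    have "norm (U y s t) \<le> C * (t - s) powr \<gamma> \<or> norm (U y s t) \<le> D * (t - s) powr \<gamma>"
      using C(2) D(2) that by auto
    moreover have "0 \<le> C * (t - s) powr \<gamma>" "0 \<le> D * (t - s) powr \<gamma>" using C(1) D(1) by auto
    ultimately show ?thesis unfolding distrib_right by linarith
  qed
  then show ?case unfolding unif_holder_def by blast
qed

text \<open>Where N z y < 1, the constant of \<open>U y\<close> increased by 1 also serves z, and
  finitely many such neighbourhoods cover K. The limit in \<open>N\<close> is punctured, so z = y is
  a separate case. \<open>N\<close> is left abstract to admit both the Hoelder seminorm and the norm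
  of controlled paths.\<close>

lemma unif_holder_compact:
  fixes U :: "'y::metric_space \<Rightarrow> real \<Rightarrow> real \<Rightarrow> 'e::real_normed_vector"
  assumes K: "compact K" and hol: "\<And>y. holder_O T \<gamma> (U y)"
    and N: "\<And>y. ((\<lambda>z. N z y) \<longlongrightarrow> 0) (at y)"
    and le: "\<And>y z s t. 0 \<le> s \<Longrightarrow> s < t \<Longrightarrow> t \<le> T \<Longrightarrow> norm (U z s t - U y s t) \<le> N z y * (t - s) powr \<gamma>"
  shows "unif_holder T \<gamma> K U"
proof -
  have "\<exists>V. open V \<and> y \<in> V \<and> unif_holder T \<gamma> V U" for y
  proof -
    have "\<forall>\<^sub>F z in at y. N z y < 1" using N[of y] by (rule order_tendstoD) simp
    then obtain V where V: "open V" "y \<in> V" "\<forall>z\<in>V. z \<noteq> y \<longrightarrow> N z y < 1"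
      unfolding eventually_at_topological by blast
    obtain C where C: "C \<ge> 0" "\<And>s t. 0 \<le> s \<Longrightarrow> s < t \<Longrightarrow> t \<le> T \<Longrightarrow> norm (U y s t) \<le> C * (t - s) powr \<gamma>"
      using unif_holderD[OF hol[of y]] by auto
    have "norm (U z s t) \<le> (C + 1) * (t - s) powr \<gamma>" if "z \<in> V" "0 \<le> s" "s < t" "t \<le> T" for z s t
    proof (cases "z = y")
      case True
      have "norm (U y s t) \<le> C * (t - s) powr \<gamma>" using that by (intro C(2)) auto
      also have "\<dots> \<le> (C + 1) * (t - s) powr \<gamma>" by (intro mult_right_mono) auto
      finally show ?thesis using True by simp
    next
      case False
      have "norm (U z s t) \<le> norm (U y s t) + norm (U z s t - U y s t)"
        using norm_triangle_ineq[of "U y s t" "U z s t - U y s t"] by simp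
      also have "\<dots> \<le> C * (t - s) powr \<gamma> + 1 * (t - s) powr \<gamma>"
      proof (intro add_mono)
        have "norm (U z s t - U y s t) \<le> N z y * (t - s) powr \<gamma>" using that by (intro le) auto
        also have "\<dots> \<le> 1 * (t - s) powr \<gamma>" using V(3) False that by (intro mult_right_mono) auto
        finally show "norm (U z s t - U y s t) \<le> 1 * (t - s) powr \<gamma>" .
      qed (use C(2) that in auto)
      finally show ?thesis unfolding distrib_right .
    qed
    then have "unif_holder T \<gamma> V U" unfolding unif_holder_def by blast
    then show ?thesis using V by blast
  qed
  then obtain V where V: "\<And>y. open (V y)" "\<And>y. y \<in> V y" "\<And>y. unif_holder T \<gamma> (V y) U" by metis
  obtain F where F: "finite F" "K \<subseteq> (\<Union>c\<in>F. V c)"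
    by (rule compactE_image[OF K, of K V]) (use V in auto)
  have "unif_holder T \<gamma> (\<Union>c\<in>F. V c) U" by (intro unif_holder_Union F V)
  then show ?thesis using F(2) unfolding unif_holder_def by blast
qed

lemma holder_field_unif_holder:
  assumes "holder_field T \<gamma> f" "compact K" "\<gamma> > 0"
  shows "unif_holder T \<gamma> K (\<lambda>y. incr (\<lambda>t. f t y))"
proof (rule unif_holder_compact[OF assms(2)])
  have hol: "holder_O T \<gamma> (incr (\<lambda>t. f t y))" for y
    using assms(1,3) by (simp add: holder_field_def Omega_iff)
  then show "holder_O T \<gamma> (incr (\<lambda>t. f t y))" for y .
  show "((\<lambda>z. holder_norm T \<gamma> (\<lambda>t. f t z - f t y)) \<longlongrightarrow> 0) (at y)" for y
    using assms(1) by (simp add: holder_field_def)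
  fix y z s t
  assume st: "0 \<le> s" "s < t" "t \<le> T"
  have "holder_O T \<gamma> (incr (\<lambda>t. f t z - f t y))"
    using bigO_on_diff[OF hol[of z, unfolded holder_O_iff_bigO] hol[of y, unfolded holder_O_iff_bigO]]
    unfolding holder_O_iff_bigO by (rule bigO_on_cong) (simp add: incr_def)
  from norm_le_holder_norm2[OF this st]
  show "norm (incr (\<lambda>t. f t z) s t - incr (\<lambda>t. f t y) s t)
      \<le> holder_norm T \<gamma> (\<lambda>t. f t z - f t y) * (t - s) powr \<gamma>"
    by (simp add: holder_norm_def incr_def algebra_simps)
qed

lemma continuous_on_triangle:
  assumes "continuous_on {0..T} \<phi>"
  shows "continuous_on (triangle T) (\<lambda>i. \<phi> (fst i))" "continuous_on (triangle T) (\<lambda>i. \<phi> (snd i))"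
  by (rule continuous_on_compose2[OF assms]; auto simp: triangle_def intro!: continuous_intros)+

lemma bigO_on_triangle_bounded:
  fixes \<phi> :: "real \<Rightarrow> 'e::real_normed_vector"
  assumes "continuous_on {0..T} \<phi>"
  shows "bigO_on (triangle T) (\<lambda>i. snd i - fst i) 0 (\<lambda>i. \<phi> (fst i))"
    "bigO_on (triangle T) (\<lambda>i. snd i - fst i) 0 (\<lambda>i. \<phi> (snd i))"
proof -
  have "bounded (\<phi> ` {0..T})"
    using assms by (intro compact_imp_bounded compact_continuous_image) auto
  then obtain B where B: "\<forall>s\<in>{0..T}. norm (\<phi> s) \<le> B" unfolding bounded_iff by auto
  show "bigO_on (triangle T) (\<lambda>i. snd i - fst i) 0 (\<lambda>i. \<phi> (fst i))"
    "bigO_on (triangle T) (\<lambda>i. snd i - fst i) 0 (\<lambda>i. \<phi> (snd i))"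
    using B by (intro bigO_on_0I[where B = B]; auto simp: triangle_def)+
qed

section \<open>Calculus of path derivatives\<close>

text \<open>The assumption \<open>unique\<close> is what ties \<open>path_deriv\<close>, an
  arbitrary choice, to derivatives obtained by calculation. Estimates are therefore proved for
  \<open>is_path_deriv\<close> and transferred to the choice afterwards.\<close>

locale rough_setting =
  fixes T \<alpha> \<beta> :: real and w :: "'d::finite rough"
  assumes T_pos: "T > 0"
    and alpha: "1/3 < \<alpha>" "\<alpha> < 1/2"
    and beta: "1 - 2 * \<alpha> < \<beta>" "\<beta> \<le> \<alpha>"
    and rough: "w \<in> rough_paths0 T \<alpha>"
    and unique: "path_deriv_unique T \<alpha> \<beta> (fst w)"
begin

abbreviation "x \<equiv> fst w"

lemma exponents: "\<alpha> > 0" "\<beta> > 0" "\<alpha> + \<beta> > 0" using alpha beta by auto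

lemma x_holder: "holder_O T \<alpha> (incr x)"
  using rough exponents by (auto simp: rough_paths0_def Omega_iff)

lemma x_cont: "continuous_on {0..T} x"
  using x_holder exponents holder_O_continuous_on by blast

lemma area_holder: "holder_O T (2 * \<alpha>) (area w)"
proof (rule unif_holder_cong)
  show "holder_O T (2 * \<alpha>) (snd w)"
    using rough by (auto simp: rough_paths0_def Omega2_def bdd_above_holder_quotients_iff)
qed (simp add: area_def)

text \<open>The leading term is a bounded derivative times an increment of x, so a controlled path
  has the regularity \<alpha> of x and not merely \<beta>. The gain is what gives Taylor errors the
  orders 2\<alpha> and 3\<alpha>.\<close>

lemma controlled_holder:
  assumes "holder_O T \<beta> (incr \<theta>')" "holder_O T (\<alpha> + \<beta>) (remainder x \<theta> \<theta>')"
  shows "holder_O T \<alpha> (incr \<theta>)"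
proof -
  have "continuous_on {0..T} \<theta>'" using assms(1) exponents holder_O_continuous_on by blast
  from bigO_on_triangle_bounded(1)[OF this]
  have "bigO_on (triangle T) (\<lambda>i. snd i - fst i) \<alpha> (\<lambda>i. row_app (\<theta>' (fst i)) (incr x (fst i) (snd i)))"
    using x_holder by (intro bigO_on_bilinear[OF bounded_bilinear_row_app, where a = 0 and b = \<alpha>])
      (auto simp: holder_O_iff_bigO)
  moreover have "bigO_on (triangle T) (\<lambda>i. snd i - fst i) \<alpha> (\<lambda>i. remainder x \<theta> \<theta>' (fst i) (snd i))"
    using unif_holder_mono[OF assms(2), of \<alpha>] exponents by (simp add: holder_O_iff_bigO)
  ultimately have "bigO_on (triangle T) (\<lambda>i. snd i - fst i) \<alpha>
     (\<lambda>i. row_app (\<theta>' (fst i)) (incr x (fst i) (snd i)) + remainder x \<theta> \<theta>' (fst i) (snd i))"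
    by (rule bigO_on_add)
  then show ?thesis by (simp add: holder_O_iff_bigO remainder_def)
qed

text \<open>From here on only growth bounds have to be checked: the bounds make \<theta>, and with
  it the remainder, continuous.\<close>

lemma is_path_deriv_iff:
  "is_path_deriv T \<alpha> \<beta> x \<theta> \<theta>' \<longleftrightarrow>
     holder_O T \<beta> (incr \<theta>') \<and> holder_O T (\<alpha> + \<beta>) (remainder x \<theta> \<theta>')"
proof -
  have "continuous_on (triangle T) (\<lambda>(s, t). remainder x \<theta> \<theta>' s t)"
    if "holder_O T \<beta> (incr \<theta>')" "holder_O T (\<alpha> + \<beta>) (remainder x \<theta> \<theta>')"
  proof -
    have c: "continuous_on {0..T} \<theta>'" "continuous_on {0..T} \<theta>"
      using that controlled_holder[OF that] exponents holder_O_continuous_on by blast+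
    note c = c[THEN continuous_on_triangle(1)] c[THEN continuous_on_triangle(2)]
      x_cont[THEN continuous_on_triangle(1)] x_cont[THEN continuous_on_triangle(2)]
    show ?thesis
      unfolding remainder_def incr_def case_prod_beta
      by (intro continuous_intros row_app.continuous_on c)
  qed
  then show ?thesis
    using exponents by (auto simp: is_path_deriv_def Omega_iff Omega2_def bdd_above_holder_quotients_iff)
qed

lemma is_path_deriv_holder:
  assumes "is_path_deriv T \<alpha> \<beta> x \<theta> \<theta>'"
  shows "holder_O T \<alpha> (incr \<theta>)" "holder_O T \<beta> (incr \<theta>)" "holder_O T \<beta> (incr \<theta>')"
    "holder_O T (\<alpha> + \<beta>) (remainder x \<theta> \<theta>')" "continuous_on {0..T} \<theta>" "continuous_on {0..T} \<theta>'"
proof -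
  show *: "holder_O T \<beta> (incr \<theta>')" "holder_O T (\<alpha> + \<beta>) (remainder x \<theta> \<theta>')"
    using assms by (auto simp: is_path_deriv_iff)
  show "holder_O T \<alpha> (incr \<theta>)" using controlled_holder[OF *] .
  then show "holder_O T \<beta> (incr \<theta>)" using unif_holder_mono beta by blast
  then show "continuous_on {0..T} \<theta>" "continuous_on {0..T} \<theta>'"
    using * exponents holder_O_continuous_on by blast+
qed

lemma controlled1_iff: "\<theta> \<in> controlled1 T \<alpha> \<beta> x \<longleftrightarrow> (\<exists>\<theta>'. is_path_deriv T \<alpha> \<beta> x \<theta> \<theta>')"
  using is_path_deriv_holder(2) exponents by (auto simp: controlled1_def Omega_iff)

lemma is_path_deriv_cong:
  assumes "is_path_deriv T \<alpha> \<beta> x \<theta> \<theta>'"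
    "\<And>t. t \<in> {0..T} \<Longrightarrow> \<eta> t = \<theta> t" "\<And>t. t \<in> {0..T} \<Longrightarrow> \<eta>' t = \<theta>' t"
  shows "is_path_deriv T \<alpha> \<beta> x \<eta> \<eta>'"
proof -
  have "holder_O T \<beta> (incr \<eta>')"
    by (rule unif_holder_cong[OF is_path_deriv_holder(3)[OF assms(1)]]) (use assms in \<open>auto simp: incr_def\<close>)
  moreover have "holder_O T (\<alpha> + \<beta>) (remainder x \<eta> \<eta>')"
    by (rule unif_holder_cong[OF is_path_deriv_holder(4)[OF assms(1)]])
      (use assms in \<open>auto simp: incr_def remainder_def\<close>)
  ultimately show ?thesis by (simp add: is_path_deriv_iff)
qed

lemma is_path_deriv_linear:
  assumes "is_path_deriv T \<alpha> \<beta> x \<theta> \<theta>'" and h: "bounded_linear h"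
  shows "is_path_deriv T \<alpha> \<beta> x (\<lambda>t. h (\<theta> t)) (\<lambda>t. \<chi> j. h (\<theta>' t $ j))"
proof -
  interpret h: bounded_linear h by fact
  have hv: "bounded_linear (\<lambda>a. \<chi> j. h (a $ j))"
    by (intro bounded_linear_vec_lambda bounded_linear_compose[OF h bounded_linear_vec_nth])
  have "holder_O T \<beta> (incr (\<lambda>t. \<chi> j. h (\<theta>' t $ j)))"
    unfolding holder_O_iff_bigO
    by (rule bigO_on_cong[OF bigO_on_bounded_linear[OF hv is_path_deriv_holder(3)[OF assms(1), unfolded holder_O_iff_bigO]]])
      (simp add: incr_def h.diff vec_eq_iff)
  moreover have "holder_O T (\<alpha> + \<beta>) (remainder x (\<lambda>t. h (\<theta> t)) (\<lambda>t. \<chi> j. h (\<theta>' t $ j)))"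
    unfolding holder_O_iff_bigO
    by (rule bigO_on_cong[OF bigO_on_bounded_linear[OF h is_path_deriv_holder(4)[OF assms(1), unfolded holder_O_iff_bigO]]])
      (simp add: incr_def remainder_def h.diff row_app_def h.sum h.scaleR)
  ultimately show ?thesis by (simp add: is_path_deriv_iff)
qed

lemma is_path_deriv_add:
  assumes "is_path_deriv T \<alpha> \<beta> x \<theta> \<theta>'" "is_path_deriv T \<alpha> \<beta> x \<eta> \<eta>'"
  shows "is_path_deriv T \<alpha> \<beta> x (\<lambda>t. \<theta> t + \<eta> t) (\<lambda>t. \<theta>' t + \<eta>' t)"
proof -
  note a = is_path_deriv_holder[OF assms(1), unfolded holder_O_iff_bigO]
  note b = is_path_deriv_holder[OF assms(2), unfolded holder_O_iff_bigO]
  have "holder_O T \<beta> (incr (\<lambda>t. \<theta>' t + \<eta>' t))"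
    unfolding holder_O_iff_bigO by (rule bigO_on_cong[OF bigO_on_add[OF a(3) b(3)]]) (simp add: incr_def)
  moreover have "holder_O T (\<alpha> + \<beta>) (remainder x (\<lambda>t. \<theta> t + \<eta> t) (\<lambda>t. \<theta>' t + \<eta>' t))"
    unfolding holder_O_iff_bigO
    by (rule bigO_on_cong[OF bigO_on_add[OF a(4) b(4)]]) (simp add: incr_def remainder_def row_app.add_left)
  ultimately show ?thesis by (simp add: is_path_deriv_iff)
qed

lemma is_path_deriv_diff:
  assumes "is_path_deriv T \<alpha> \<beta> x \<theta> \<theta>'" "is_path_deriv T \<alpha> \<beta> x \<eta> \<eta>'"
  shows "is_path_deriv T \<alpha> \<beta> x (\<lambda>t. \<theta> t - \<eta> t) (\<lambda>t. \<theta>' t - \<eta>' t)"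
proof -
  have "is_path_deriv T \<alpha> \<beta> x (\<lambda>t. - \<eta> t) (\<lambda>t. \<chi> j. - \<eta>' t $ j)"
    using is_path_deriv_linear[OF assms(2) bounded_linear_minus[OF bounded_linear_ident]] by simp
  from is_path_deriv_add[OF assms(1) this] show ?thesis
    by (rule is_path_deriv_cong) (simp_all add: vec_eq_iff)
qed

text \<open>The Leibniz rule. Besides the two remainders, the expansion leaves the product of the
  increments of p and q, which has order \<alpha> + \<beta> because p is \<alpha>-Hoelder and q is
  \<beta>-Hoelder.\<close>

lemma is_path_deriv_bilinear:
  assumes h: "bounded_bilinear h"
    and p: "is_path_deriv T \<alpha> \<beta> x p p'" and q: "is_path_deriv T \<alpha> \<beta> x q q'"
  shows "is_path_deriv T \<alpha> \<beta> x (\<lambda>t. h (p t) (q t)) (\<lambda>t. \<chi> j. h (p' t $ j) (q t) + h (p t) (q' t $ j))"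
proof -
  interpret h: bounded_bilinear h by fact
  let ?S = "triangle T" and ?r = "\<lambda>i. snd i - fst i"
  note P = is_path_deriv_holder[OF p, unfolded holder_O_iff_bigO]
  note Q = is_path_deriv_holder[OF q, unfolded holder_O_iff_bigO]
  note X = x_holder[unfolded holder_O_iff_bigO]
  note bdd = bigO_on_triangle_bounded
  note hl = bounded_bilinear_vec_left[OF h] and hr = bounded_bilinear_vec_right[OF h]
  have "holder_O T \<beta> (incr (\<lambda>t. \<chi> j. h (p' t $ j) (q t) + h (p t) (q' t $ j)))"
    unfolding holder_O_iff_bigO
  proof (rule bigO_on_cong)
    show "bigO_on ?S ?r \<beta> (\<lambda>i. ((\<chi> j. h (incr p' (fst i) (snd i) $ j) (q (snd i)))
        + (\<chi> j. h (p' (fst i) $ j) (incr q (fst i) (snd i))))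
        + ((\<chi> j. h (incr p (fst i) (snd i)) (q' (snd i) $ j))
        + (\<chi> j. h (p (fst i)) (incr q' (fst i) (snd i) $ j))))"
      by (intro bigO_on_add bigO_on_bilinear[OF hl, where a = \<beta> and b = 0]
          bigO_on_bilinear[OF hl, where a = 0 and b = \<beta>] bigO_on_bilinear[OF hr, where a = \<beta> and b = 0]
          bigO_on_bilinear[OF hr, where a = 0 and b = \<beta>] P Q bdd) auto
  qed (simp add: incr_def vec_eq_iff h.diff_left h.diff_right)
  moreover have "holder_O T (\<alpha> + \<beta>) (remainder x (\<lambda>t. h (p t) (q t))
      (\<lambda>t. \<chi> j. h (p' t $ j) (q t) + h (p t) (q' t $ j)))"
    unfolding holder_O_iff_bigO
  proof (rule bigO_on_cong)
    show "bigO_on ?S ?r (\<alpha> + \<beta>) (\<lambda>i. (h (remainder x p p' (fst i) (snd i)) (q (fst i))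
        + h (p (fst i)) (remainder x q q' (fst i) (snd i)))
        + h (incr p (fst i) (snd i)) (incr q (fst i) (snd i)))"
      by (intro bigO_on_add bigO_on_bilinear[OF h, where a = "\<alpha> + \<beta>" and b = 0]
          bigO_on_bilinear[OF h, where a = 0 and b = "\<alpha> + \<beta>"]
          bigO_on_bilinear[OF h, where a = \<alpha> and b = \<beta>] P Q bdd) auto
  next
    fix i
    have "row_app (\<chi> j. h (p' s $ j) (q s) + h (p s) (q' s $ j)) v
       = h (row_app (p' s) v) (q s) + h (p s) (row_app (q' s) v)" for s v
      by (simp add: row_app_def h.sum_left h.sum_right h.scaleR_left h.scaleR_right scaleR_right_distrib sum.distrib)
    then show "remainder x (\<lambda>t. h (p t) (q t)) (\<lambda>t. \<chi> j. h (p' t $ j) (q t) + h (p t) (q' t $ j)) (fst i) (snd i)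
        = (h (remainder x p p' (fst i) (snd i)) (q (fst i))
        + h (p (fst i)) (remainder x q q' (fst i) (snd i)))
        + h (incr p (fst i) (snd i)) (incr q (fst i) (snd i))"
      by (simp add: remainder_def incr_def h.diff_left h.diff_right)
  qed
  ultimately show ?thesis by (simp add: is_path_deriv_iff)
qed

text \<open>Inner products with a fixed vector are real-valued controlled paths, to which the
  assumed uniqueness applies; all such products together determine the entries of the
  derivative.\<close>

lemma is_path_deriv_unique:
  fixes \<theta> :: "real \<Rightarrow> 'e::euclidean_space"
  assumes "is_path_deriv T \<alpha> \<beta> x \<theta> a" "is_path_deriv T \<alpha> \<beta> x \<theta> b" "t \<in> {0..T}"
  shows "a t = b t"
proof -
  have "a t $ j \<bullet> e = b t $ j \<bullet> e" for j and e :: 'e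
  proof -
    note lin = is_path_deriv_linear[OF _ bounded_linear_inner_left[of e]]
    have "(\<lambda>t. \<theta> t \<bullet> e) \<in> Omega T \<beta>"
      using is_path_deriv_holder(2)[OF lin[OF assms(1)]] exponents by (simp add: Omega_iff)
    then have "(\<chi> j. a t $ j \<bullet> e) = (\<chi> j. b t $ j \<bullet> e)"
      using unique[unfolded path_deriv_unique_def, rule_format, OF conjI[OF _ conjI[OF lin[OF assms(1)] lin[OF assms(2)]]] assms(3)]
      by simp
    then show ?thesis by (simp add: vec_eq_iff)
  qed
  then show ?thesis by (simp add: vec_eq_iff euclidean_eq_iff[of "a t $ _"])
qed

lemma path_deriv_controlled:
  "\<theta> \<in> controlled1 T \<alpha> \<beta> x \<Longrightarrow> is_path_deriv T \<alpha> \<beta> x \<theta> (path_deriv T \<alpha> \<beta> x \<theta>)"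
  unfolding path_deriv_def controlled1_iff by (rule someI_ex[of "is_path_deriv T \<alpha> \<beta> x \<theta>"])

lemma path_deriv_eq:
  fixes \<theta> :: "real \<Rightarrow> 'e::euclidean_space"
  assumes "is_path_deriv T \<alpha> \<beta> x \<theta> \<theta>'" "t \<in> {0..T}"
  shows "path_deriv T \<alpha> \<beta> x \<theta> t = \<theta>' t"
  using path_deriv_controlled assms controlled1_iff is_path_deriv_unique by blast

lemma controlled_field_is_path_deriv:
  "controlled_field T \<alpha> \<beta> x f \<Longrightarrow> is_path_deriv T \<alpha> \<beta> x (\<lambda>t. f t y) (\<lambda>t. domega T \<alpha> \<beta> x f t y)"
  unfolding domega_def controlled_field_def using path_deriv_controlled by blast

text \<open>Continuity in y under the norm controls the derivative through its Hoelder seminorm and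
  its value at time 0. The seminorms give uniform bounds on compact sets; the seminorm of the
  derivative and the value at 0 together give continuity of the derivative in y at each fixed
  time.\<close>

lemma controlled_field_unif_holder:
  fixes f :: "real \<Rightarrow> real^'m \<Rightarrow> 'e::euclidean_space"
  assumes f: "controlled_field T \<alpha> \<beta> x f" and K: "compact K"
  shows "unif_holder T \<beta> K (\<lambda>y. incr (\<lambda>t. domega T \<alpha> \<beta> x f t y))"
    and "unif_holder T (\<alpha> + \<beta>) K (\<lambda>y. remainder x (\<lambda>t. f t y) (\<lambda>t. domega T \<alpha> \<beta> x f t y))"
    and "t \<in> {0..T} \<Longrightarrow> ((\<lambda>z. domega T \<alpha> \<beta> x f t z) \<longlongrightarrow> domega T \<alpha> \<beta> x f t y) (at y)"
proof -
  let ?D = "domega T \<alpha> \<beta> x f"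
  let ?P = "\<lambda>z y. path_deriv T \<alpha> \<beta> x (\<lambda>t. f t z - f t y)"
  let ?N = "\<lambda>z y. controlled_tnorm T \<alpha> \<beta> x (\<lambda>t. f t z - f t y)"
  note d = controlled_field_is_path_deriv[OF f]
  have lim: "((\<lambda>z. ?N z y) \<longlongrightarrow> 0) (at y)" for y using f by (simp add: controlled_field_def)
  have dd: "is_path_deriv T \<alpha> \<beta> x (\<lambda>t. f t z - f t y) (\<lambda>t. ?D t z - ?D t y)" for z y
    by (rule is_path_deriv_diff[OF d d])
  \<comment> \<open>The norm refers to the derivative chosen for the difference, a choice unrelated
    to those made for z and for y; uniqueness makes it their difference.\<close>
  have P: "?P z y t = ?D t z - ?D t y" if "t \<in> {0..T}" for t z y
    by (rule path_deriv_eq[OF dd that])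
  have PD: "is_path_deriv T \<alpha> \<beta> x (\<lambda>t. f t z - f t y) (?P z y)" for z y
    using dd path_deriv_controlled controlled1_iff by blast
  note PH = is_path_deriv_holder[OF PD]
  have nonneg: "holder_norm2 T \<beta> (incr (?P z y)) \<ge> 0"
    "holder_norm2 T (\<alpha> + \<beta>) (remainder x (\<lambda>t. f t z - f t y) (?P z y)) \<ge> 0" for z y
    by (intro holder_norm2_nonneg PH T_pos)+
  have le: "holder_norm2 T \<beta> (incr (?P z y)) \<le> ?N z y"
     "holder_norm2 T (\<alpha> + \<beta>) (remainder x (\<lambda>t. f t z - f t y) (?P z y)) \<le> ?N z y"
     "norm (?P z y 0) \<le> ?N z y" for z y
    using nonneg[of z y] norm_ge_zero[of "?P z y 0"]
    unfolding controlled_tnorm_def controlled_norm_def holder_norm_def by linarith+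
  have b1: "norm (incr (\<lambda>t. ?D t z) s t - incr (\<lambda>t. ?D t y) s t) \<le> ?N z y * (t - s) powr \<beta>"
    if "0 \<le> s" "s < t" "t \<le> T" for z y s t
  proof -
    have "norm (incr (?P z y) s t) \<le> holder_norm2 T \<beta> (incr (?P z y)) * (t - s) powr \<beta>"
      by (rule norm_le_holder_norm2[OF PH(3) that])
    also have "\<dots> \<le> ?N z y * (t - s) powr \<beta>" by (intro mult_right_mono le) auto
    finally show ?thesis using P[of s z y] P[of t z y] that by (simp add: incr_def algebra_simps)
  qed
  show "unif_holder T \<beta> K (\<lambda>y. incr (\<lambda>t. ?D t y))"
    by (rule unif_holder_compact[OF K _ lim b1]) (rule is_path_deriv_holder(3)[OF d])
  have b2: "norm (remainder x (\<lambda>t. f t z) (\<lambda>t. ?D t z) s t - remainder x (\<lambda>t. f t y) (\<lambda>t. ?D t y) s t)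
      \<le> ?N z y * (t - s) powr (\<alpha> + \<beta>)" if "0 \<le> s" "s < t" "t \<le> T" for z y s t
  proof -
    have "norm (remainder x (\<lambda>t. f t z - f t y) (?P z y) s t)
        \<le> holder_norm2 T (\<alpha> + \<beta>) (remainder x (\<lambda>t. f t z - f t y) (?P z y)) * (t - s) powr (\<alpha> + \<beta>)"
      by (rule norm_le_holder_norm2[OF PH(4) that])
    also have "\<dots> \<le> ?N z y * (t - s) powr (\<alpha> + \<beta>)" by (intro mult_right_mono le) auto
    finally show ?thesis
      using P[of s z y] that by (simp add: remainder_def incr_def row_app.diff_left algebra_simps)
  qed
  show "unif_holder T (\<alpha> + \<beta>) K (\<lambda>y. remainder x (\<lambda>t. f t y) (\<lambda>t. ?D t y))"
    by (rule unif_holder_compact[OF K _ lim b2]) (rule is_path_deriv_holder(4)[OF d])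
  assume t: "t \<in> {0..T}"
  have "norm (?D t z - ?D t y) \<le> ?N z y * (1 + T powr \<beta>)" for z
  proof -
    have "norm (?D t z - ?D t y) \<le> norm (?D 0 z - ?D 0 y) + norm (incr (\<lambda>t. ?D t z) 0 t - incr (\<lambda>t. ?D t y) 0 t)"
      by (rule order_trans[OF _ norm_triangle_ineq]) (simp add: incr_def)
    also have "\<dots> \<le> ?N z y + ?N z y * T powr \<beta>"
    proof (rule add_mono)
      show N: "norm (?D 0 z - ?D 0 y) \<le> ?N z y" using le(3)[of z y] P[of 0 z y] T_pos by simp
      then have N0: "0 \<le> ?N z y" using norm_ge_zero order_trans by blast
      show "norm (incr (\<lambda>t. ?D t z) 0 t - incr (\<lambda>t. ?D t y) 0 t) \<le> ?N z y * T powr \<beta>"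
      proof (cases "t = 0")
        case True
        then show ?thesis using N0 by (simp add: incr_def)
      next
        case False
        then have "norm (incr (\<lambda>t. ?D t z) 0 t - incr (\<lambda>t. ?D t y) 0 t) \<le> ?N z y * (t - 0) powr \<beta>"
          using t by (intro b1) auto
        also have "\<dots> \<le> ?N z y * T powr \<beta>"
          using t exponents N0 by (intro mult_left_mono powr_mono2) auto
        finally show ?thesis .
      qed
    qed
    finally show ?thesis by (simp add: algebra_simps)
  qed
  moreover have "((\<lambda>z. ?N z y * (1 + T powr \<beta>)) \<longlongrightarrow> 0) (at y)"
    using tendsto_mult_left_zero[OF lim] .
  ultimately have "((\<lambda>z. ?D t z - ?D t y) \<longlongrightarrow> 0) (at y)"
    using Lim_null_comparison[of "\<lambda>z. ?D t z - ?D t y" "\<lambda>z. ?N z y * (1 + T powr \<beta>)"] by simp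
  then show "((\<lambda>z. ?D t z) \<longlongrightarrow> ?D t y) (at y)" by (simp add: LIM_zero_iff)
qed

end

section \<open>Taylor expansion in the space variable\<close>

lemma dy_has_derivative:
  fixes g :: "real \<Rightarrow> real^'m \<Rightarrow> 'e::real_normed_vector"
  assumes "g \<in> C1_loc T" "t \<in> {0..T}"
  shows "(g t has_derivative row_app (dy g t y)) (at y within S)"
proof -
  have d: "(g t has_derivative frechet_derivative (g t) (at y)) (at y)"
    unfolding frechet_derivative_works[symmetric] using assms by (auto simp: C1_loc_def)
  then have lin: "linear (frechet_derivative (g t) (at y))" by (rule has_derivative_linear)
  have "frechet_derivative (g t) (at y) v = row_app (dy g t y) v" for v
  proof -
    have "v = (\<Sum>k\<in>UNIV. v $ k *\<^sub>R axis k 1)"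
      using basis_expansion[of v] by (simp add: scalar_mult_eq_scaleR)
    then have "frechet_derivative (g t) (at y) v
        = frechet_derivative (g t) (at y) (\<Sum>k\<in>UNIV. v $ k *\<^sub>R axis k 1)" by simp
    also have "\<dots> = row_app (dy g t y) v"
      by (simp add: linear_sum[OF lin] linear_scale[OF lin] row_app_def dy_def)
    finally show ?thesis .
  qed
  then show ?thesis using d has_derivative_at_withinI by (metis ext)
qed

lemma onorm_row_app_le:
  fixes a :: "'e::real_normed_vector^'m"
  assumes "norm a \<le> c"
  shows "onorm (row_app a) \<le> c * real CARD('m)"
proof (rule onorm_le)
  fix v :: "real^'m"
  have "norm (row_app a v) \<le> norm a * norm v * real CARD('m)" by (rule norm_row_app_le)
  also have "\<dots> \<le> c * norm v * real CARD('m)" using assms by (intro mult_right_mono) auto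
  finally show "norm (row_app a v) \<le> c * real CARD('m) * norm v" by (simp add: mult_ac)
qed

lemma C1_loc_bounded:
  fixes f :: "real \<Rightarrow> real^'m \<Rightarrow> 'e::real_normed_vector"
  assumes "continuous_on ({0..T} \<times> UNIV) (\<lambda>(t, y). f t y)"
  shows "\<exists>B\<ge>0. \<forall>s\<in>{0..T}. \<forall>y\<in>cball 0 R. norm (f s y) \<le> B"
proof -
  have "compact ((\<lambda>(t, y). f t y) ` ({0..T} \<times> cball 0 R))"
    using assms by (intro compact_continuous_image compact_Times) (auto intro: continuous_on_subset)
  then obtain B where B: "\<forall>v\<in>(\<lambda>(t, y). f t y) ` ({0..T} \<times> cball 0 R). norm v \<le> B"
    using compact_imp_bounded bounded_iff by metis
  show ?thesis
  proof (intro exI[of _ "\<bar>B\<bar>"] conjI ballI)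
    fix s y assume "s \<in> {0..T}" "y \<in> (cball 0 R :: (real^'m) set)"
    then have "norm (f s y) \<le> B" using B by (auto intro!: image_eqI[of _ _ "(s, y)"])
    then show "norm (f s y) \<le> \<bar>B\<bar>" by simp
  qed simp
qed

lemma C1_loc_lipschitz:
  fixes g :: "real \<Rightarrow> real^'m \<Rightarrow> 'e::real_normed_vector"
  assumes g: "g \<in> C1_loc T"
  shows "\<exists>C\<ge>0. \<forall>s\<in>{0..T}. \<forall>y\<in>cball 0 R. \<forall>z\<in>cball 0 R. norm (g s z - g s y) \<le> C * norm (z - y)"
proof -
  define K where "K = real CARD('m)"
  obtain B where B: "B \<ge> 0" "\<forall>s\<in>{0..T}. \<forall>y\<in>cball 0 R. norm (dy g s y) \<le> B"
    using C1_loc_bounded[of T "dy g" R] g by (auto simp: C1_loc_def)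
  show ?thesis
  proof (intro exI[of _ "B * K"] conjI ballI)
    fix s and y z :: "real^'m" assume s: "s \<in> {0..T}" and yz: "y \<in> cball 0 R" "z \<in> cball 0 R"
    show "norm (g s z - g s y) \<le> B * K * norm (z - y)"
    proof (rule differentiable_bound[OF convex_cball])
      show "(g s has_derivative row_app (dy g s u)) (at u within cball 0 R)" for u
        by (rule dy_has_derivative[OF g s])
      show "onorm (row_app (dy g s u)) \<le> B * K" if "u \<in> cball 0 R" for u
      unfolding K_def using B(2) s that by (intro onorm_row_app_le) auto
    qed (use yz in auto)
  qed (use B in \<open>auto simp: K_def\<close>)
qed

text \<open>The mean value inequality on the segment from y to z for g minus its linear part at y,
  whose derivative is small because \<open>dy g\<close> is Lipschitz on the ball.\<close>

lemma C2_loc_taylor: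
  fixes g :: "real \<Rightarrow> real^'m \<Rightarrow> 'e::real_normed_vector"
  assumes g: "g \<in> C2_loc T"
  shows "\<exists>C\<ge>0. \<forall>s\<in>{0..T}. \<forall>y\<in>cball 0 R. \<forall>z\<in>cball 0 R.
    norm (g s z - g s y - row_app (dy g s y) (z - y)) \<le> C * norm (z - y) ^ 2"
proof -
  have g1: "g \<in> C1_loc T" and g2: "dy g \<in> C1_loc T" using g by (auto simp: C2_loc_def)
  define K where "K = real CARD('m)"
  obtain L where L: "L \<ge> 0" "\<forall>s\<in>{0..T}. \<forall>y\<in>cball 0 R. \<forall>z\<in>cball 0 R. norm (dy g s z - dy g s y) \<le> L * norm (z - y)"
    using C1_loc_lipschitz[OF g2] by blast
  show ?thesis
  proof (intro exI[of _ "L * K"] conjI ballI)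
    fix s and y z :: "real^'m" assume s: "s \<in> {0..T}" and yz: "y \<in> cball 0 R" "z \<in> cball 0 R"
    define f where "f u = g s u - row_app (dy g s y) u" for u
    have "norm (f z - f y) \<le> (L * norm (z - y) * K) * norm (z - y)"
    proof (rule differentiable_bound[OF convex_closed_segment])
      show "(f has_derivative row_app (dy g s u - dy g s y)) (at u within closed_segment y z)" for u
        unfolding f_def row_app.diff_left
        by (intro has_derivative_diff dy_has_derivative[OF g1 s]
            bounded_linear_imp_has_derivative row_app.bounded_linear_right)
      fix u assume u: "u \<in> closed_segment y z"
      then have ub: "u \<in> cball 0 R" using yz closed_segment_subset convex_cball by blast
      have uy: "norm (u - y) \<le> norm (z - y)" using segment_bound(1)[OF u] by (simp add: norm_minus_commute)
      have "norm (dy g s u - dy g s y) \<le> L * norm (u - y)" using L(2) s yz ub by blast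
      also have "\<dots> \<le> L * norm (z - y)" using uy L(1) by (rule mult_left_mono)
      finally have le: "norm (dy g s u - dy g s y) \<le> L * norm (z - y)" .
      show "onorm (row_app (dy g s u - dy g s y)) \<le> L * norm (z - y) * K"
        unfolding K_def by (rule onorm_row_app_le[OF le])
    qed auto
    then show "norm (g s z - g s y - row_app (dy g s y) (z - y)) \<le> L * K * norm (z - y) ^ 2"
      by (simp add: f_def row_app.diff_right algebra_simps power2_eq_square)
  qed (use L in \<open>auto simp: K_def\<close>)
qed

text \<open>Both mixed derivatives are the limit of the same second difference quotient; the Taylor
  bound for \<open>dy g\<close> makes the error of the quotient at scale \<open>h\<close> of order \<open>h\<close>.\<close>

lemma dy_dy_symmetric:
  fixes g :: "real \<Rightarrow> real^'m \<Rightarrow> 'e::real_normed_vector"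
  assumes g: "g \<in> C2_loc T" and dg: "dy g \<in> C2_loc T" and s: "s \<in> {0..T}"
  shows "row_app (row_app (dy (dy g) s y) a) b = row_app (row_app (dy (dy g) s y) b) a"
proof -
  define M where "M = dy (dy g) s y"
  have g1: "g \<in> C1_loc T" using g by (auto simp: C2_loc_def)
  define K where "K = real CARD('m)"
  \<comment> \<open>For 0 < h \<le> 1 the ball of radius R contains all points at which the Taylor
    bound is used, namely those of the segments along which the difference quotient is
    estimated.\<close>
  define R where "R = norm y + norm a + norm b"
  obtain L where L: "L \<ge> 0" "\<forall>s\<in>{0..T}. \<forall>y\<in>cball 0 R. \<forall>z\<in>cball 0 R.
      norm (dy g s z - dy g s y - row_app (dy (dy g) s y) (z - y)) \<le> L * norm (z - y) ^ 2"
    using C2_loc_taylor[OF dg] by blast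
  define q where "q h = g s (y + h *\<^sub>R a + h *\<^sub>R b) - g s (y + h *\<^sub>R a) - g s (y + h *\<^sub>R b) + g s y" for h
  \<comment> \<open>Take the difference in direction d first, then apply the mean value inequality
    in direction c. Since \<open>q\<close> is symmetric in a and b, the claim can be used with (c,
    d) = (a, b) and with (c, d) = (b, a).\<close>
  have half: "norm (q h - h\<^sup>2 *\<^sub>R row_app (row_app M d) c) \<le> (2 * L * (norm c + norm d)\<^sup>2 * K * norm c) * h ^ 3"
    if h: "0 < h" "h \<le> 1" and cd: "norm y + norm c + norm d = R"
      "q h = g s (y + h *\<^sub>R c + h *\<^sub>R d) - g s (y + h *\<^sub>R c) - g s (y + h *\<^sub>R d) + g s y" for h c d
  proof -
    define f where "f u = g s (u + h *\<^sub>R d) - g s u - row_app (row_app M (h *\<^sub>R d)) u" for u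
    define c2 where "c2 = L * (h * (norm c + norm d))\<^sup>2"
    have "norm (f (y + h *\<^sub>R c) - f y) \<le> (2 * c2 * K) * norm (y + h *\<^sub>R c - y)"
    proof (rule differentiable_bound[OF convex_closed_segment[of y "y + h *\<^sub>R c"]])
      show "(f has_derivative row_app (dy g s (u + h *\<^sub>R d) - dy g s u - row_app M (h *\<^sub>R d)))
          (at u within closed_segment y (y + h *\<^sub>R c))" for u
      proof -
        have "((\<lambda>u. g s (u + h *\<^sub>R d)) has_derivative (\<lambda>v. row_app (dy g s (u + h *\<^sub>R d)) v))
            (at u within closed_segment y (y + h *\<^sub>R c))"
          by (rule has_derivative_compose[OF _ dy_has_derivative[OF g1 s]])
            (auto intro!: derivative_eq_intros)
        then show ?thesis
          unfolding f_def row_app.diff_left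
          by (intro has_derivative_diff dy_has_derivative[OF g1 s]
              bounded_linear_imp_has_derivative row_app.bounded_linear_right)
      qed
      fix u assume u: "u \<in> closed_segment y (y + h *\<^sub>R c)"
      have uy: "norm (u - y) \<le> h * norm c" using segment_bound(1)[OF u] h by (simp add: norm_minus_commute)
      have hc: "h * norm c \<le> norm c" "h * norm d \<le> norm d" using h by (auto intro: mult_left_le_one_le)
      have ub': "norm u \<le> norm y + norm c"
        using norm_triangle_ineq[of y "u - y"] uy hc by simp
      have ud': "norm (u + h *\<^sub>R d) \<le> norm y + norm c + norm d"
        using norm_triangle_ineq[of u "h *\<^sub>R d"] ub' hc h by simp
      have ub: "norm u \<le> R" and ud: "norm (u + h *\<^sub>R d) \<le> R" and yb: "norm y \<le> R"
        using ub' ud' norm_ge_zero[of c] norm_ge_zero[of d] unfolding cd(1)[symmetric] by linarith+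
      have udy: "norm (u + h *\<^sub>R d - y) \<le> h * (norm c + norm d)"
        using norm_triangle_ineq[of "u - y" "h *\<^sub>R d"] uy h by (simp add: algebra_simps)
      have uy': "norm (u - y) \<le> h * (norm c + norm d)"
        using uy h by (simp add: distrib_left add_increasing2)
      have "norm (dy g s (u + h *\<^sub>R d) - dy g s y - row_app M (u + h *\<^sub>R d - y)) \<le> L * norm (u + h *\<^sub>R d - y) ^ 2"
        unfolding M_def using L(2) s ud yb by auto
      also have "\<dots> \<le> c2" unfolding c2_def using udy L(1) by (intro mult_left_mono power_mono) auto
      finally have e1: "norm (dy g s (u + h *\<^sub>R d) - dy g s y - row_app M (u + h *\<^sub>R d - y)) \<le> c2" .
      have "norm (dy g s u - dy g s y - row_app M (u - y)) \<le> L * norm (u - y) ^ 2"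
        unfolding M_def using L(2) s ub yb by auto
      also have "\<dots> \<le> c2" unfolding c2_def using uy' L(1) by (intro mult_left_mono power_mono) auto
      finally have e2: "norm (dy g s u - dy g s y - row_app M (u - y)) \<le> c2" .
      have "dy g s (u + h *\<^sub>R d) - dy g s u - row_app M (h *\<^sub>R d)
          = (dy g s (u + h *\<^sub>R d) - dy g s y - row_app M (u + h *\<^sub>R d - y)) - (dy g s u - dy g s y - row_app M (u - y))"
        by (simp add: row_app.diff_right row_app.add_right)
      then have e: "norm (dy g s (u + h *\<^sub>R d) - dy g s u - row_app M (h *\<^sub>R d)) \<le> 2 * c2"
        using order_trans[OF norm_triangle_ineq4 add_mono[OF e1 e2]] by (simp only: mult_2)
      show "onorm (row_app (dy g s (u + h *\<^sub>R d) - dy g s u - row_app M (h *\<^sub>R d))) \<le> 2 * c2 * K"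
        unfolding K_def by (rule onorm_row_app_le[OF e])
    qed auto
    moreover have "f (y + h *\<^sub>R c) - f y = q h - h\<^sup>2 *\<^sub>R row_app (row_app M d) c"
      unfolding f_def cd(2)
      by (simp add: row_app.add_right row_app.scaleR_right row_app.scaleR_left power2_eq_square)
    moreover have "(2 * c2 * K) * norm (y + h *\<^sub>R c - y) = (2 * L * (norm c + norm d)\<^sup>2 * K * norm c) * h ^ 3"
      using h by (simp add: c2_def power2_eq_square power3_eq_cube)
    ultimately show ?thesis by (simp only:)
  qed
  define D where "D = 2 * L * (norm a + norm b)\<^sup>2 * K * norm a + 2 * L * (norm b + norm a)\<^sup>2 * K * norm b"
  define E where "E = row_app (row_app M a) b - row_app (row_app M b) a"
  have bound: "norm E \<le> D * h" if h: "0 < h" "h \<le> 1" for h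
  proof -
    have 1: "norm (q h - h\<^sup>2 *\<^sub>R row_app (row_app M b) a) \<le> (2 * L * (norm a + norm b)\<^sup>2 * K * norm a) * h ^ 3"
      by (rule half[OF h]) (simp_all add: R_def q_def)
    have 2: "norm (q h - h\<^sup>2 *\<^sub>R row_app (row_app M a) b) \<le> (2 * L * (norm b + norm a)\<^sup>2 * K * norm b) * h ^ 3"
      by (rule half[OF h]) (simp_all add: R_def q_def add_ac)
    have E: "h\<^sup>2 *\<^sub>R E = (q h - h\<^sup>2 *\<^sub>R row_app (row_app M b) a) - (q h - h\<^sup>2 *\<^sub>R row_app (row_app M a) b)"
      by (simp add: E_def scaleR_right_diff_distrib)
    have "norm (h\<^sup>2 *\<^sub>R E) \<le> D * h ^ 3"
      unfolding E D_def distrib_right by (rule order_trans[OF norm_triangle_ineq4 add_mono[OF 1 2]])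
    then have "h\<^sup>2 * norm E \<le> h\<^sup>2 * (D * h)" by (simp add: power2_eq_square power3_eq_cube mult_ac)
    then show ?thesis using h by simp
  qed
  have D0: "D \<ge> 0" using L by (simp add: D_def K_def)
  have "norm E \<le> 0"
  proof (rule field_le_epsilon)
    fix e :: real assume e: "e > 0"
    have "norm E \<le> D * min 1 (e / (D + 1))" using e D0 by (intro bound) auto
    also have "\<dots> \<le> D * (e / (D + 1))" using D0 by (intro mult_left_mono) auto
    also have "\<dots> \<le> e" using D0 e by (simp add: field_simps)
    finally show "norm E \<le> 0 + e" by simp
  qed
  then show ?thesis by (simp add: E_def M_def)
qed

text \<open>The mean value inequality again, now with an integrated error of order two. Symmetry of
  the second derivative enters because only then is \<open>row_app M (u - y)\<close> the derivative
  of half the quadratic form.\<close>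

lemma C3_taylor:
  fixes g :: "real \<Rightarrow> real^'m \<Rightarrow> 'e::real_normed_vector"
  assumes g: "g \<in> C2_loc T" and dg: "dy g \<in> C2_loc T"
  shows "\<exists>C\<ge>0. \<forall>s\<in>{0..T}. \<forall>y\<in>cball 0 R. \<forall>z\<in>cball 0 R.
    norm (g s z - g s y - row_app (dy g s y) (z - y)
      - (1/2) *\<^sub>R row_app (row_app (dy (dy g) s y) (z - y)) (z - y)) \<le> C * norm (z - y) ^ 3"
proof -
  have g1: "g \<in> C1_loc T" using g by (auto simp: C2_loc_def)
  define K where "K = real CARD('m)"
  obtain L where L: "L \<ge> 0" "\<forall>s\<in>{0..T}. \<forall>y\<in>cball 0 R. \<forall>z\<in>cball 0 R.
      norm (dy g s z - dy g s y - row_app (dy (dy g) s y) (z - y)) \<le> L * norm (z - y) ^ 2"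
    using C2_loc_taylor[OF dg] by blast
  show ?thesis
  proof (intro exI[of _ "L * K"] conjI ballI)
    fix s and y z :: "real^'m" assume s: "s \<in> {0..T}" and yz: "y \<in> cball 0 R" "z \<in> cball 0 R"
    define M where "M = dy (dy g) s y"
    have sym: "row_app (row_app M a) b = row_app (row_app M b) a" for a b
      unfolding M_def by (rule dy_dy_symmetric[OF g dg s])
    define f where "f u = g s u - row_app (dy g s y) u - (1/2) *\<^sub>R row_app (row_app M (u - y)) (u - y)" for u
    have "norm (f z - f y) \<le> (L * (norm (z - y))\<^sup>2 * K) * norm (z - y)"
    proof (rule differentiable_bound[OF convex_closed_segment])
      show "(f has_derivative row_app (dy g s u - dy g s y - row_app M (u - y))) (at u within closed_segment y z)" for u
      proof -
        have M: "((\<lambda>u. row_app M (u - y)) has_derivative (\<lambda>v. row_app M v)) (at u within closed_segment y z)"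
          by (rule has_derivative_eq_rhs[OF row_app.FDERIV[OF has_derivative_const has_derivative_diff[OF has_derivative_ident has_derivative_const]]])
            (simp add: row_app.zero_left)
        have "((\<lambda>u. row_app (row_app M (u - y)) (u - y)) has_derivative
            (\<lambda>v. row_app (row_app M (u - y)) v + row_app (row_app M v) (u - y))) (at u within closed_segment y z)"
          by (rule has_derivative_eq_rhs[OF row_app.FDERIV[OF M has_derivative_diff[OF has_derivative_ident has_derivative_const]]])
            simp
        then have Q: "((\<lambda>u. (1/2) *\<^sub>R row_app (row_app M (u - y)) (u - y)) has_derivative
            (\<lambda>v. row_app (row_app M (u - y)) v)) (at u within closed_segment y z)"
          by (rule has_derivative_eq_rhs[OF has_derivative_scaleR_right])
            (auto simp: sym[of _ "u - y"] scaleR_right_distrib[symmetric] simp flip: scaleR_left_distrib)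
        show ?thesis
          unfolding f_def row_app.diff_left
          by (intro has_derivative_diff Q dy_has_derivative[OF g1 s]
              bounded_linear_imp_has_derivative row_app.bounded_linear_right)
      qed
      fix u assume u: "u \<in> closed_segment y z"
      then have ub: "u \<in> cball 0 R" using yz closed_segment_subset convex_cball by blast
      have uy: "norm (u - y) \<le> norm (z - y)" using segment_bound(1)[OF u] by (simp add: norm_minus_commute)
      have "norm (dy g s u - dy g s y - row_app M (u - y)) \<le> L * (norm (u - y))\<^sup>2"
        unfolding M_def using L(2) s yz ub by blast
      also have "\<dots> \<le> L * (norm (z - y))\<^sup>2" using uy L(1) by (intro mult_left_mono power_mono) auto
      finally have le: "norm (dy g s u - dy g s y - row_app M (u - y)) \<le> L * (norm (z - y))\<^sup>2" .
      show "onorm (row_app (dy g s u - dy g s y - row_app M (u - y))) \<le> L * (norm (z - y))\<^sup>2 * K"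
        unfolding K_def by (rule onorm_row_app_le[OF le])
    qed auto
    moreover have "f z - f y = g s z - g s y - row_app (dy g s y) (z - y)
        - (1/2) *\<^sub>R row_app (row_app M (z - y)) (z - y)"
      by (simp add: f_def row_app.diff_right[of _ z y] row_app.zero_right)
    ultimately show "norm (g s z - g s y - row_app (dy g s y) (z - y)
      - (1/2) *\<^sub>R row_app (row_app (dy (dy g) s y) (z - y)) (z - y)) \<le> L * K * norm (z - y) ^ 3"
      by (simp add: M_def mult_ac power2_eq_square power3_eq_cube)
  qed (use L in \<open>auto simp: K_def\<close>)
qed

section \<open>Commutation of the space derivative and the path derivative\<close>

context rough_setting
begin

text \<open>The controlled expansions of \<open>dy g\<close> have constants uniform over the compact
  segment from y to y + h e, so they may be integrated along it. The integral of the path derivative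
  of \<open>dy g\<close> is then a path derivative of g(., y + h e) - g(., y), and differentiating
  at h = 0 gives the claim. The indices appear in opposite order because each differentiation adds
  its index on the outside.\<close>

lemma domega_dy_commute:
  fixes g :: "real \<Rightarrow> real^'m \<Rightarrow> 'e::euclidean_space"
  assumes g1: "g \<in> C1_loc T" and gc: "controlled_field T \<alpha> \<beta> x g"
    and dgc: "controlled_field T \<alpha> \<beta> x (dy g)" and og: "domega T \<alpha> \<beta> x g \<in> C1_loc T" and t: "t \<in> {0..T}"
  shows "domega T \<alpha> \<beta> x (dy g) t y $ j $ k = dy (domega T \<alpha> \<beta> x g) t y $ k $ j"
proof -
  define e :: "real^'m" where "e = axis k 1"
  define L :: "('e^'m)^'d \<Rightarrow> 'e^'d" where "L A = (\<chi> j. A $ j $ k)" for A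
  have L: "bounded_linear L"
    unfolding L_def[abs_def]
    by (intro bounded_linear_vec_lambda bounded_linear_compose[OF bounded_linear_vec_nth bounded_linear_vec_nth])
  interpret L: bounded_linear L by (rule L)
  obtain B where B: "B > 0" "\<And>A. norm (L A) \<le> norm A * B" using L.pos_bounded by blast
  let ?D = "domega T \<alpha> \<beta> x (dy g)"
  define p where "p s u = dy g s (y + u *\<^sub>R e) $ k" for s u
  define p' where "p' s u = L (?D s (y + u *\<^sub>R e))" for s u
  have re: "row_app a e = a $ k" for a :: "'z::real_normed_vector^'m"
    by (simp add: row_app_def e_def axis_def if_distrib[of "\<lambda>c. c *\<^sub>R _"] cong: if_cong)
  have vd: "((\<lambda>u. f s (y + u *\<^sub>R e)) has_vector_derivative dy f s (y + u *\<^sub>R e) $ k) (at u within S)"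
    if "f \<in> C1_loc T" "s \<in> {0..T}" for f :: "real \<Rightarrow> real^'m \<Rightarrow> 'z::real_normed_vector" and s u S
  proof -
    have "((\<lambda>u. f s (y + u *\<^sub>R e)) has_derivative (\<lambda>h. row_app (dy f s (y + u *\<^sub>R e)) (h *\<^sub>R e))) (at u within S)"
      by (rule has_derivative_compose[OF _ dy_has_derivative[OF that]]) (auto intro!: derivative_eq_intros)
    then show ?thesis by (simp add: has_vector_derivative_def row_app.scaleR_right re)
  qed
  have pint: "(p s has_integral (g s (y + h *\<^sub>R e) - g s y)) {0..h}" if "s \<in> {0..T}" "h \<ge> 0" for s h
    using fundamental_theorem_of_calculus[OF that(2), of "\<lambda>u. g s (y + u *\<^sub>R e)" "p s"] vd[OF g1 that(1)]
    unfolding p_def by simp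
  have p'cont: "continuous_on {0..h} (p' s)" if "s \<in> {0..T}" for s h
  proof -
    \<comment> \<open>The pointwise continuity in y does not refer to the compact set, so the empty
      set fills that argument.\<close>
    have "continuous_on UNIV (?D s)"
      using controlled_field_unif_holder(3)[OF dgc compact_empty that] by (simp add: continuous_on_def)
    then have "continuous_on {0..h} (\<lambda>u. ?D s (y + u *\<^sub>R e))"
      by (rule continuous_on_compose2) (auto intro!: continuous_intros)
    then show ?thesis unfolding p'_def by (rule L.continuous_on)
  qed
  define q where "q s h = integral {0..h} (p' s)" for s h
  have p'int: "(p' s has_integral q s h) {0..h}" if "s \<in> {0..T}" for s h
    unfolding q_def using integrable_continuous_interval[OF p'cont[OF that]] by (rule integrable_integral)
  have eq: "domega T \<alpha> \<beta> x g t (y + h *\<^sub>R e) - domega T \<alpha> \<beta> x g t y = q t h" if h: "0 \<le> h" for h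
  proof -
    have 1: "is_path_deriv T \<alpha> \<beta> x (\<lambda>s. g s (y + h *\<^sub>R e) - g s y)
        (\<lambda>s. domega T \<alpha> \<beta> x g s (y + h *\<^sub>R e) - domega T \<alpha> \<beta> x g s y)"
      by (intro is_path_deriv_diff controlled_field_is_path_deriv[OF gc])
    define K where "K = (\<lambda>u. y + u *\<^sub>R e) ` {0..h}"
    have K: "compact K" unfolding K_def by (intro compact_continuous_image continuous_intros) auto
    obtain C1 where C1: "C1 \<ge> 0" "\<forall>z\<in>K. \<forall>s t. 0 \<le> s \<and> s < t \<and> t \<le> T \<longrightarrow>
        norm (incr (\<lambda>t. ?D t z) s t) \<le> C1 * (t - s) powr \<beta>"
      using unif_holderD[OF controlled_field_unif_holder(1)[OF dgc K]] by blast
    obtain C2 where C2: "C2 \<ge> 0" "\<forall>z\<in>K. \<forall>s t. 0 \<le> s \<and> s < t \<and> t \<le> T \<longrightarrow>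
        norm (remainder x (\<lambda>t. dy g t z) (\<lambda>t. ?D t z) s t) \<le> C2 * (t - s) powr (\<alpha> + \<beta>)"
      using unif_holderD[OF controlled_field_unif_holder(2)[OF dgc K]] by blast
    have "norm (incr (\<lambda>s. q s h) s t) \<le> (B * C1 * h) * (t - s) powr \<beta>" if st: "0 \<le> s" "s < t" "t \<le> T" for s t
    proof -
      have "((\<lambda>u. p' t u - p' s u) has_integral (q t h - q s h)) {0..h}"
        using st by (intro has_integral_diff p'int) auto
      then have "norm (q t h - q s h) \<le> (B * C1 * (t - s) powr \<beta>) * measure lborel {0..h}"
      proof (rule has_integral_bound_real[where S = "{}", rotated 2])
        fix u assume "u \<in> {0..h} - {}"
        then have u: "norm (?D t (y + u *\<^sub>R e) - ?D s (y + u *\<^sub>R e)) \<le> C1 * (t - s) powr \<beta>"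
          using C1(2) st by (auto simp: K_def incr_def)
        have "norm (p' t u - p' s u) \<le> norm (?D t (y + u *\<^sub>R e) - ?D s (y + u *\<^sub>R e)) * B"
          using B(2) by (simp add: p'_def L.diff[symmetric])
        also have "\<dots> \<le> C1 * (t - s) powr \<beta> * B" using u B(1) by (intro mult_right_mono) auto
        finally show "norm (p' t u - p' s u) \<le> B * C1 * (t - s) powr \<beta>" by (simp add: mult_ac)
      qed (use B C1 in auto)
      then show ?thesis using h by (simp add: incr_def mult_ac)
    qed
    then have "holder_O T \<beta> (incr (\<lambda>s. q s h))" unfolding unif_holder_def by blast
    moreover have "norm (remainder x (\<lambda>s. g s (y + h *\<^sub>R e) - g s y) (\<lambda>s. q s h) s t) \<le> (C2 * h) * (t - s) powr (\<alpha> + \<beta>)"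
      if st: "0 \<le> s" "s < t" "t \<le> T" for s t
    proof -
      have "((\<lambda>u. p t u - p s u - row_app (p' s u) (incr x s t)) has_integral
         ((g t (y + h *\<^sub>R e) - g t y) - (g s (y + h *\<^sub>R e) - g s y) - row_app (q s h) (incr x s t))) {0..h}"
        using st h has_integral_linear[OF p'int[of s h] row_app.bounded_linear_left[of "incr x s t"]]
        by (intro has_integral_diff pint) (auto simp: o_def)
      then have "norm ((g t (y + h *\<^sub>R e) - g t y) - (g s (y + h *\<^sub>R e) - g s y) - row_app (q s h) (incr x s t))
          \<le> (C2 * (t - s) powr (\<alpha> + \<beta>)) * measure lborel {0..h}"
      proof (rule has_integral_bound_real[where S = "{}", rotated 2])
        fix u assume "u \<in> {0..h} - {}"
        then have u: "norm (remainder x (\<lambda>t. dy g t (y + u *\<^sub>R e)) (\<lambda>t. ?D t (y + u *\<^sub>R e)) s t) \<le> C2 * (t - s) powr (\<alpha> + \<beta>)"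
          using C2(2) st by (auto simp: K_def)
        have eq: "p t u - p s u - row_app (p' s u) (incr x s t)
            = remainder x (\<lambda>t. dy g t (y + u *\<^sub>R e)) (\<lambda>t. ?D t (y + u *\<^sub>R e)) s t $ k"
          by (simp add: p_def p'_def L_def remainder_def incr_def row_app_vec)
        show "norm (p t u - p s u - row_app (p' s u) (incr x s t)) \<le> C2 * (t - s) powr (\<alpha> + \<beta>)"
          unfolding eq by (rule order_trans[OF Finite_Cartesian_Product.norm_nth_le u])
      qed (use C2 in auto)
      then show ?thesis using h by (simp add: remainder_def incr_def mult_ac)
    qed
    then have "holder_O T (\<alpha> + \<beta>) (remainder x (\<lambda>s. g s (y + h *\<^sub>R e) - g s y) (\<lambda>s. q s h))"
      unfolding unif_holder_def by blast
    ultimately have 2: "is_path_deriv T \<alpha> \<beta> x (\<lambda>s. g s (y + h *\<^sub>R e) - g s y) (\<lambda>s. q s h)"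
      by (simp add: is_path_deriv_iff)
    show ?thesis by (rule is_path_deriv_unique[OF 1 2 t])
  qed
  \<comment> \<open>Here h = 0 is the left end of the interval of integration, so both derivatives
    are one-sided, taken within [0, 1], where they are still unique.\<close>
  have "((\<lambda>h. q t h) has_vector_derivative p' t 0) (at 0 within {0..1})"
    unfolding q_def using p'cont[OF t] by (intro integral_has_vector_derivative) auto
  then have "((\<lambda>h. domega T \<alpha> \<beta> x g t (y + h *\<^sub>R e) - domega T \<alpha> \<beta> x g t y) has_vector_derivative p' t 0) (at 0 within {0..1})"
    by (rule has_vector_derivative_transform[rotated 2]) (auto simp: eq)
  moreover have "((\<lambda>h. domega T \<alpha> \<beta> x g t (y + h *\<^sub>R e) - domega T \<alpha> \<beta> x g t y) has_vector_derivative
      dy (domega T \<alpha> \<beta> x g) t y $ k - 0) (at 0 within {0..1})"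
    using vd[OF og t, of 0] by (intro has_vector_derivative_diff has_vector_derivative_const) simp
  ultimately have "p' t 0 = dy (domega T \<alpha> \<beta> x g) t y $ k"
    using vector_derivative_unique_within[of 0 "{0..1::real}"]
    by (simp add: trivial_limit_within islimpt_Icc)
  then show ?thesis by (simp add: p'_def L_def vec_eq_iff)
qed

end

section \<open>The chain rule for path derivatives\<close>

lemma bigO_on_lipschitz:
  fixes f :: "real \<Rightarrow> real^'m \<Rightarrow> 'e::real_normed_vector"
  assumes f: "f \<in> C1_loc T" and zy: "bigO_on S r \<gamma> (\<lambda>i. z i - y i)"
    and S: "\<And>i. i \<in> S \<Longrightarrow> s i \<in> {0..T} \<and> y i \<in> cball 0 R \<and> z i \<in> cball 0 R"
  shows "bigO_on S r \<gamma> (\<lambda>i. f (s i) (z i) - f (s i) (y i))"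
proof -
  obtain C where "\<forall>s\<in>{0..T}. \<forall>y\<in>cball 0 R. \<forall>z\<in>cball 0 R. norm (f s z - f s y) \<le> C * norm (z - y)"
    using C1_loc_lipschitz[OF f] by blast
  then show ?thesis using S by (intro bigO_on_le[OF zy, where c = C]) blast
qed

lemma bigO_on_power:
  assumes V: "bigO_on S r \<gamma> V" and le: "\<And>i. i \<in> S \<Longrightarrow> norm (U i) \<le> c * norm (V i) ^ n" and "c \<ge> 0" "n > 0"
  shows "bigO_on S r (real n * \<gamma>) U"
proof -
  obtain C where C: "C \<ge> 0" "\<And>i. i \<in> S \<Longrightarrow> norm (V i) \<le> C * r i powr \<gamma>"
    using bigO_onD[OF V] by auto
  show ?thesis
  proof (rule bigO_onI[where C = "c * C ^ n"])
    fix i assume i: "i \<in> S"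
    have "norm (U i) \<le> c * norm (V i) ^ n" by (rule le[OF i])
    also have "\<dots> \<le> c * (C * r i powr \<gamma>) ^ n"
      using C(2)[OF i] \<open>c \<ge> 0\<close> by (intro mult_left_mono power_mono) auto
    also have "(C * r i powr \<gamma>) ^ n = C ^ n * r i powr (real n * \<gamma>)"
    proof -
      have "(r i powr \<gamma>) ^ n = r i powr (real n * \<gamma>)"
      proof (cases "r i = 0")
        case True
        then show ?thesis using \<open>n > 0\<close> by simp
      next
        case False
        then show ?thesis by (induction n) (auto simp: powr_add[symmetric] distrib_right)
      qed
      then show ?thesis by (simp add: power_mult_distrib)
    qed
    finally show "norm (U i) \<le> c * C ^ n * r i powr (real n * \<gamma>)" by (simp add: mult_ac)
  qed
qed

lemma bigO_on_taylor2:
  fixes g :: "real \<Rightarrow> real^'m \<Rightarrow> 'e::real_normed_vector"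
  assumes g: "g \<in> C2_loc T" and zy: "bigO_on S r \<gamma> (\<lambda>i. z i - y i)"
    and S: "\<And>i. i \<in> S \<Longrightarrow> s i \<in> {0..T} \<and> y i \<in> cball 0 R \<and> z i \<in> cball 0 R"
  shows "bigO_on S r (2 * \<gamma>) (\<lambda>i. g (s i) (z i) - g (s i) (y i) - row_app (dy g (s i) (y i)) (z i - y i))"
    (is "bigO_on S r _ ?U")
proof -
  obtain C where "C \<ge> 0" "\<forall>s\<in>{0..T}. \<forall>y\<in>cball 0 R. \<forall>z\<in>cball 0 R.
      norm (g s z - g s y - row_app (dy g s y) (z - y)) \<le> C * norm (z - y) ^ 2"
    using C2_loc_taylor[OF g] by blast
  then have "bigO_on S r (real 2 * \<gamma>) ?U"
    using S by (intro bigO_on_power[OF zy, where c = C]) (blast, simp_all)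
  then show ?thesis by simp
qed

lemma bigO_on_taylor3:
  fixes g :: "real \<Rightarrow> real^'m \<Rightarrow> 'e::real_normed_vector"
  assumes g: "g \<in> C2_loc T" "dy g \<in> C2_loc T" and zy: "bigO_on S r \<gamma> (\<lambda>i. z i - y i)"
    and S: "\<And>i. i \<in> S \<Longrightarrow> s i \<in> {0..T} \<and> y i \<in> cball 0 R \<and> z i \<in> cball 0 R"
  shows "bigO_on S r (3 * \<gamma>) (\<lambda>i. g (s i) (z i) - g (s i) (y i) - row_app (dy g (s i) (y i)) (z i - y i)
      - (1/2) *\<^sub>R row_app (row_app (dy (dy g) (s i) (y i)) (z i - y i)) (z i - y i))"
    (is "bigO_on S r _ ?U")
proof -
  obtain C where "C \<ge> 0" "\<forall>s\<in>{0..T}. \<forall>y\<in>cball 0 R. \<forall>z\<in>cball 0 R.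
      norm (g s z - g s y - row_app (dy g s y) (z - y)
        - (1/2) *\<^sub>R row_app (row_app (dy (dy g) s y) (z - y)) (z - y)) \<le> C * norm (z - y) ^ 3"
    using C3_taylor[OF g] by blast
  then have "bigO_on S r (real 3 * \<gamma>) ?U"
    using S by (intro bigO_on_power[OF zy, where c = C]) (blast, simp_all)
  then show ?thesis by simp
qed

lemma continuous_on_field_comp:
  fixes f :: "real \<Rightarrow> real^'m \<Rightarrow> 'e::real_normed_vector"
  assumes "f \<in> C1_loc T" "continuous_on {0..T} \<theta>"
  shows "continuous_on {0..T} (\<lambda>t. f t (\<theta> t))"
proof -
  have "continuous_on ({0..T} \<times> UNIV) (\<lambda>(t, y). f t y)" using assms(1) by (simp add: C1_loc_def)
  from continuous_on_compose2[OF this continuous_on_Pair[OF continuous_on_id assms(2)]]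
  show ?thesis by auto
qed

lemma continuous_path_in_cball:
  fixes \<theta> :: "real \<Rightarrow> 'e::real_normed_vector"
  assumes "continuous_on {0..T} \<theta>"
  shows "\<exists>R. \<forall>t\<in>{0..T}. \<theta> t \<in> cball 0 R"
proof -
  have "bounded (\<theta> ` {0..T})" using assms by (intro compact_imp_bounded compact_continuous_image) auto
  then show ?thesis unfolding bounded_iff by auto
qed

text \<open>Freezing the space variable at the right endpoint leaves a time increment, bounded
  uniformly over the ball, and a space increment at the left time, bounded by the Lipschitz constant
  of f.\<close>

lemma field_comp_holder:
  fixes f :: "real \<Rightarrow> real^'m \<Rightarrow> 'e::real_normed_vector"
  assumes f: "f \<in> C1_loc T" and unif: "unif_holder T \<gamma> (cball 0 R) (\<lambda>y. incr (\<lambda>t. f t y))" and \<gamma>: "\<gamma> \<ge> 0"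
    and \<theta>: "holder_O T \<gamma> (incr \<theta>)" "\<And>t. t \<in> {0..T} \<Longrightarrow> \<theta> t \<in> cball 0 R"
  shows "holder_O T \<gamma> (incr (\<lambda>t. f t (\<theta> t)))"
proof -
  let ?S = "triangle T" and ?r = "\<lambda>i. snd i - fst i"
  have S: "fst i \<in> {0..T} \<and> \<theta> (fst i) \<in> cball 0 R \<and> \<theta> (snd i) \<in> cball 0 R" if "i \<in> ?S" for i
    using that \<theta>(2)[of "fst i"] \<theta>(2)[of "snd i"] by (auto simp: triangle_def)
  have 1: "bigO_on ?S ?r \<gamma> (\<lambda>i. incr (\<lambda>t. f t (\<theta> (snd i))) (fst i) (snd i))"
    by (rule unif_holder_bigO[OF unif \<gamma>]) (use S in \<open>auto simp: triangle_def\<close>)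
  have 2: "bigO_on ?S ?r \<gamma> (\<lambda>i. f (fst i) (\<theta> (snd i)) - f (fst i) (\<theta> (fst i)))"
    using \<theta>(1) unfolding holder_O_iff_bigO incr_def by (rule bigO_on_lipschitz[OF f]) (rule S)
  show ?thesis
    unfolding holder_O_iff_bigO by (rule bigO_on_cong[OF bigO_on_add[OF 1 2]]) (simp add: incr_def)
qed

context rough_setting
begin

text \<open>\<open>C12_loc\<close> measures \<open>dy g\<close> in the norm of controlled paths, so
  its uniform Hoelder bound has to be recovered from the derivative and the remainder. This needs
  the derivative bounded on K and all times: it is continuous in y at time 0, hence bounded on K
  there, and its uniform Hoelder bound carries this to later times.\<close>

lemma controlled_field_unif_holder_path:
  fixes f :: "real \<Rightarrow> real^'m \<Rightarrow> 'e::euclidean_space"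
  assumes f: "controlled_field T \<alpha> \<beta> x f" and K: "compact K"
  shows "unif_holder T \<beta> K (\<lambda>y. incr (\<lambda>t. f t y))"
proof -
  let ?D = "domega T \<alpha> \<beta> x f"
  let ?S = "K \<times> triangle T" and ?r = "\<lambda>i. snd (snd i) - fst (snd i)"
  have "continuous_on K (?D 0)"
    using controlled_field_unif_holder(3)[OF f K, of 0] T_pos
    by (intro continuous_at_imp_continuous_on) (auto simp: isCont_def)
  then have "bounded (?D 0 ` K)" using K by (intro compact_imp_bounded compact_continuous_image)
  then obtain B where B: "\<forall>y\<in>K. norm (?D 0 y) \<le> B" unfolding bounded_iff by auto
  obtain C where C: "C \<ge> 0" "\<forall>y\<in>K. \<forall>s t. 0 \<le> s \<and> s < t \<and> t \<le> T \<longrightarrow> norm (incr (\<lambda>t. ?D t y) s t) \<le> C * (t - s) powr \<beta>"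
    using unif_holderD[OF controlled_field_unif_holder(1)[OF f K]] by blast
  have "norm (?D s y) \<le> B + C * T powr \<beta>" if "y \<in> K" "0 \<le> s" "s \<le> T" for y s
  proof (cases "s = 0")
    case True
    then show ?thesis using B C(1) that by (simp add: add_increasing2)
  next
    case False
    have "norm (?D s y) \<le> norm (?D 0 y) + norm (incr (\<lambda>t. ?D t y) 0 s)"
      by (rule order_trans[OF _ norm_triangle_ineq]) (simp add: incr_def)
    also have "\<dots> \<le> B + C * (s - 0) powr \<beta>" using B C(2)[rule_format, of y 0 s] that False by (intro add_mono) auto
    also have "\<dots> \<le> B + C * T powr \<beta>"
      using C(1) that exponents by (intro add_left_mono mult_left_mono powr_mono2) auto
    finally show ?thesis .
  qed
  then have D: "bigO_on ?S ?r 0 (\<lambda>i. ?D (fst (snd i)) (fst i))"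
    by (intro bigO_on_0I[where B = "B + C * T powr \<beta>"]) (auto simp: triangle_def)
  have X: "bigO_on ?S ?r \<beta> (\<lambda>i. incr x (fst (snd i)) (snd (snd i)))"
    using exponents by (intro holder_bigO[OF unif_holder_mono[OF x_holder beta(2)]]) (auto simp: triangle_def)
  have R: "bigO_on ?S ?r \<beta> (\<lambda>i. remainder x (\<lambda>t. f t (fst i)) (\<lambda>t. ?D t (fst i)) (fst (snd i)) (snd (snd i)))"
    using unif_holder_mono[OF controlled_field_unif_holder(2)[OF f K], of \<beta>] exponents
    unfolding unif_holder_iff_bigO by simp
  show ?thesis
    unfolding unif_holder_iff_bigO
    by (rule bigO_on_cong[OF bigO_on_add[OF bigO_on_bilinear[OF bounded_bilinear_row_app D X] R]])
      (simp_all add: remainder_def)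
qed

lemma chain_rule:
  fixes g :: "real \<Rightarrow> real^'m \<Rightarrow> 'e::euclidean_space"
  assumes g: "g \<in> C12_loc T \<alpha> \<beta> x" and \<theta>: "is_path_deriv T \<alpha> \<beta> x \<theta> \<theta>'"
  shows "is_path_deriv T \<alpha> \<beta> x (\<lambda>t. g t (\<theta> t))
    (\<lambda>t. domega T \<alpha> \<beta> x g t (\<theta> t) + row_comp (dy g t (\<theta> t)) (\<theta>' t))"
proof -
  let ?D = "domega T \<alpha> \<beta> x g"
  let ?S = "triangle T" and ?r = "\<lambda>i. snd i - fst i"
  have g2: "g \<in> C2_loc T" and dg1: "dy g \<in> C1_loc T"
    and gc: "controlled_field T \<alpha> \<beta> x g" and dgc: "controlled_field T \<alpha> \<beta> x (dy g)"
    and D1: "?D \<in> C1_loc T" and Dh: "holder_field T \<beta> ?D"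
    using g by (auto simp: C12_loc_def C2_loc_def C1_beta_loc_def)
  note P = is_path_deriv_holder[OF \<theta>]
  obtain R where R: "\<And>t. t \<in> {0..T} \<Longrightarrow> \<theta> t \<in> cball 0 R"
    using continuous_path_in_cball[OF P(5)] by blast
  have S: "fst i \<in> {0..T} \<and> \<theta> (fst i) \<in> cball 0 R \<and> \<theta> (snd i) \<in> cball 0 R" if "i \<in> ?S" for i
    using that R[of "fst i"] R[of "snd i"] by (auto simp: triangle_def)
  have mono: "bigO_on ?S ?r b U" if "bigO_on ?S ?r a U" "b \<le> a" for a b and U :: "real \<times> real \<Rightarrow> 'e"
    by (rule bigO_on_mono[OF that, where T = T]) (auto simp: triangle_def)
  note \<theta>inc = P(1)[unfolded holder_O_iff_bigO incr_def]
  have "holder_O T \<beta> (incr (\<lambda>t. ?D t (\<theta> t)))"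
    using exponents by (intro field_comp_holder[OF D1 holder_field_unif_holder[OF Dh] _ P(2) R]) auto
  then have H1: "bigO_on ?S ?r \<beta> (\<lambda>i. incr (\<lambda>t. ?D t (\<theta> t)) (fst i) (snd i))"
    by (simp add: holder_O_iff_bigO)
  have "holder_O T \<beta> (incr (\<lambda>t. dy g t (\<theta> t)))"
    using exponents by (intro field_comp_holder[OF dg1 controlled_field_unif_holder_path[OF dgc] _ P(2) R]) auto
  then have H2: "bigO_on ?S ?r \<beta> (\<lambda>i. incr (\<lambda>t. dy g t (\<theta> t)) (fst i) (snd i))"
    by (simp add: holder_O_iff_bigO)
  note bdd = bigO_on_triangle_bounded[OF continuous_on_field_comp[OF dg1 P(5)]] bigO_on_triangle_bounded[OF P(6)]
  have "holder_O T \<beta> (incr (\<lambda>t. ?D t (\<theta> t) + row_comp (dy g t (\<theta> t)) (\<theta>' t)))"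
    unfolding holder_O_iff_bigO
  proof (rule bigO_on_cong)
    show "bigO_on ?S ?r \<beta> (\<lambda>i. incr (\<lambda>t. ?D t (\<theta> t)) (fst i) (snd i)
        + (row_comp (incr (\<lambda>t. dy g t (\<theta> t)) (fst i) (snd i)) (\<theta>' (snd i))
          + row_comp (dy g (fst i) (\<theta> (fst i))) (incr \<theta>' (fst i) (snd i))))"
      using P(3) unfolding holder_O_iff_bigO
      by (intro bigO_on_add H1 bigO_on_bilinear[OF bounded_bilinear_row_comp H2 bdd(4)]
          bigO_on_bilinear[OF bounded_bilinear_row_comp bdd(1)]) auto
  qed (simp add: incr_def row_comp.diff_left row_comp.diff_right)
  moreover have "holder_O T (\<alpha> + \<beta>) (remainder x (\<lambda>t. g t (\<theta> t)) (\<lambda>t. ?D t (\<theta> t) + row_comp (dy g t (\<theta> t)) (\<theta>' t)))"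
    unfolding holder_O_iff_bigO
  proof (rule bigO_on_cong)
    have a: "bigO_on ?S ?r (\<alpha> + \<beta>) (\<lambda>i. remainder x (\<lambda>t. g t (\<theta> (snd i))) (\<lambda>t. ?D t (\<theta> (snd i))) (fst i) (snd i))"
      by (rule unif_holder_bigO[OF controlled_field_unif_holder(2)[OF gc compact_cball[of 0 R]]])
        (use S exponents in \<open>auto simp: triangle_def\<close>)
    have "bigO_on ?S ?r (\<alpha> + \<alpha>) (\<lambda>i. row_app (?D (fst i) (\<theta> (snd i)) - ?D (fst i) (\<theta> (fst i))) (incr x (fst i) (snd i)))"
      using x_holder unfolding holder_O_iff_bigO
      by (intro bigO_on_bilinear[OF bounded_bilinear_row_app bigO_on_lipschitz[OF D1 \<theta>inc S]]) auto
    from mono[OF this] have b: "bigO_on ?S ?r (\<alpha> + \<beta>)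
        (\<lambda>i. row_app (?D (fst i) (\<theta> (snd i)) - ?D (fst i) (\<theta> (fst i))) (incr x (fst i) (snd i)))"
      using beta by simp
    have c: "bigO_on ?S ?r (\<alpha> + \<beta>) (\<lambda>i. g (fst i) (\<theta> (snd i)) - g (fst i) (\<theta> (fst i))
        - row_app (dy g (fst i) (\<theta> (fst i))) (\<theta> (snd i) - \<theta> (fst i)))"
      by (rule mono[OF bigO_on_taylor2[OF g2 \<theta>inc S]]) (use beta in auto)
    have d: "bigO_on ?S ?r (\<alpha> + \<beta>) (\<lambda>i. row_app (dy g (fst i) (\<theta> (fst i))) (remainder x \<theta> \<theta>' (fst i) (snd i)))"
      using P(4) unfolding holder_O_iff_bigO
      by (intro bigO_on_bilinear[OF bounded_bilinear_row_app bdd(1)]) auto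
    show "bigO_on ?S ?r (\<alpha> + \<beta>) (\<lambda>i. remainder x (\<lambda>t. g t (\<theta> (snd i))) (\<lambda>t. ?D t (\<theta> (snd i))) (fst i) (snd i)
       + (row_app (?D (fst i) (\<theta> (snd i)) - ?D (fst i) (\<theta> (fst i))) (incr x (fst i) (snd i))
       + ((g (fst i) (\<theta> (snd i)) - g (fst i) (\<theta> (fst i))
        - row_app (dy g (fst i) (\<theta> (fst i))) (\<theta> (snd i) - \<theta> (fst i)))
       + row_app (dy g (fst i) (\<theta> (fst i))) (remainder x \<theta> \<theta>' (fst i) (snd i)))))"
      by (intro bigO_on_add a b c d)
  qed (simp add: remainder_def incr_def row_app.diff_left row_app.diff_right row_app.add_left row_app_row_comp)
  ultimately show ?thesis by (simp add: is_path_deriv_iff)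
qed

end

section \<open>Time derivatives and second-order remainders\<close>

lemma norm_diff_diff_le: "norm (a - b - c) \<le> norm a + norm b + norm (c :: 'a::real_normed_vector)"
  using norm_triangle_ineq4[of "a - b" c] norm_triangle_ineq4[of a b] by linarith

lemma bounded_bilinear_outer: "bounded_bilinear (outer :: real^'d \<Rightarrow> real^'d \<Rightarrow> real^'d^'d)"
proof -
  have "outer = (\<lambda>(a::real^'d) (b::real^'d). \<chi> i. (\<lambda>c w. \<chi> j. c * w $ j) (a $ i) b)"
    by (simp add: outer_def fun_eq_iff)
  then show ?thesis
    using bounded_bilinear_vec_left[OF bounded_bilinear_vec_right[OF bounded_bilinear_mult]] by metis
qed

interpretation outer: bounded_bilinear "outer :: real^'d \<Rightarrow> real^'d \<Rightarrow> real^'d^'d"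
  by (rule bounded_bilinear_outer)

lemma transpose_outer: "transpose (outer a b) = outer b a"
  by (simp add: transpose_def outer_def vec_eq_iff mult.commute)

lemma transpose_linear:
  fixes A B :: "'e::real_normed_vector^'n^'m"
  shows "transpose (A + B) = transpose A + transpose B" "transpose (A - B) = transpose A - transpose B"
    "transpose (0 :: 'e^'n^'m) = 0"
  by (simp_all add: transpose_def vec_eq_iff)

text \<open>The transpose and the order of arguments come from \<open>path_deriv\<close>, which puts
  the driving index outside: the first index of M belongs to the earlier increment.\<close>

lemma ddot_transpose_outer: "ddot (transpose M) (outer a b) = row_app (row_app M b) a"
  by (simp add: ddot_def row_app_def outer_def transpose_def scaleR_sum_right)

text \<open>The summand of \<open>has_rough_integral\<close>, with the second derivative as a free
  argument so that a computed derivative can stand in for the chosen one.\<close>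

definition rough_germ ::
  "'d::finite rough \<Rightarrow> (real \<Rightarrow> 'e::real_normed_vector^'d) \<Rightarrow> (real \<Rightarrow> 'e^'d^'d) \<Rightarrow> real \<Rightarrow> real \<Rightarrow> 'e" where
  "rough_germ w \<phi>' \<phi>'' s t = row_app (\<phi>' s) (incr (fst w) s t) + ddot (transpose (\<phi>'' s)) (transpose (area w s t))"

definition bracket_germ ::
  "'d::finite rough \<Rightarrow> (real \<Rightarrow> 'e::real_normed_vector^'d^'d) \<Rightarrow> real \<Rightarrow> real \<Rightarrow> 'e" where
  "bracket_germ w b s t = ddot (b s) (incr (bracket w) s t)"

text \<open>The error of one step of the equation in \<open>is_time_deriv\<close>. That equation
  will turn out to be equivalent to an error of order above 1.\<close>

definition remainder2 ::
  "'d::finite rough \<Rightarrow> (real \<Rightarrow> 'e::real_normed_vector) \<Rightarrow> (real \<Rightarrow> 'e^'d) \<Rightarrow> (real \<Rightarrow> 'e^'d^'d)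
   \<Rightarrow> (real \<Rightarrow> 'e^'d^'d) \<Rightarrow> real \<Rightarrow> real \<Rightarrow> 'e" where
  "remainder2 w \<phi> \<phi>' \<phi>'' D s t = incr \<phi> s t - rough_germ w \<phi>' \<phi>'' s t
     - bracket_germ w (\<lambda>s. D s + (1/2) *\<^sub>R transpose (\<phi>'' s)) s t"

definition antisym_area :: "'d::finite rough \<Rightarrow> real \<Rightarrow> real \<Rightarrow> real^'d^'d" where
  "antisym_area w s t = (1/2) *\<^sub>R (transpose (area w s t) - area w s t)"

context rough_setting
begin

text \<open>What \<open>sewing\<close> retains of the defect exponent 2\<alpha> + \<beta>: the
  midpoint between it and 1. It also lies below 3\<alpha>, so it serves as the common threshold for
  the errors of the Ito expansion.\<close>

abbreviation "\<nu> \<equiv> (1 + (2 * \<alpha> + \<beta>)) / 2"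

lemma nu_gt_1: "\<nu> > 1" "\<nu> \<le> 2 * \<alpha> + \<beta>" "\<nu> \<le> 3 * \<alpha>" "2 * \<alpha> + \<beta> > 1"
  using alpha beta by auto

section \<open>Chen's relation and increments of the bracket\<close>

lemma chen:
  assumes "0 \<le> s" "s < r" "r < t" "t \<le> T"
  shows "area w s t = area w s r + area w r t + outer (incr x s r) (incr x r t)"
proof -
  have "\<forall>s r t. 0 \<le> s \<and> s < r \<and> r < t \<and> t \<le> T \<longrightarrow>
      snd w s t - snd w s r - snd w r t = outer (incr x s r) (incr x r t)"
    using rough by (auto simp: rough_paths0_def)
  then have "snd w s t - snd w s r - snd w r t = outer (incr x s r) (incr x r t)" using assms by blast
  then show ?thesis using assms by (simp add: area_def algebra_simps)
qed

text \<open>The bracket is defined from the base point 0, but the cross terms of its outer square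
  cancel against those of Chen's relation and its transpose, so its increments are local. Chen's
  relation requires 0 < s, which leaves s = 0 as a separate case.\<close>

lemma incr_bracket:
  assumes "0 \<le> s" "s < t" "t \<le> T"
  shows "incr (bracket w) s t = outer (incr x s t) (incr x s t) - area w s t - transpose (area w s t)"
proof (cases "s = 0")
  case True
  have "bracket w 0 = 0" by (simp add: bracket_def incr_def area_def outer.zero_left transpose_linear)
  then show ?thesis using True by (simp add: incr_def bracket_def)
next
  case False
  then have "area w 0 t = area w 0 s + area w s t + outer (incr x 0 s) (incr x s t)"
    using assms by (intro chen) auto
  then show ?thesis
    by (simp add: incr_def bracket_def transpose_linear transpose_outer outer.diff_left outer.diff_right)
qed

lemma bracket_holder: "holder_O T (2 * \<alpha>) (incr (bracket w))"
proof -
  note X = x_holder[unfolded holder_O_iff_bigO] and A = area_holder[unfolded holder_O_iff_bigO]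
  have "bigO_on (triangle T) (\<lambda>i. snd i - fst i) (2 * \<alpha>)
      (\<lambda>i. outer (incr x (fst i) (snd i)) (incr x (fst i) (snd i)) - area w (fst i) (snd i)
         - transpose (area w (fst i) (snd i)))"
    by (intro bigO_on_diff A bigO_on_bilinear[OF bounded_bilinear_outer X X]
        bigO_on_bounded_linear[OF bounded_linear_transpose]) simp
  then show ?thesis
    unfolding holder_O_iff_bigO by (rule bigO_on_cong) (simp add: incr_bracket triangle_def split_beta)
qed

lemma antisym_area_holder: "holder_O T (2 * \<alpha>) (antisym_area w)"
proof -
  note A = area_holder[unfolded holder_O_iff_bigO]
  show ?thesis
    unfolding holder_O_iff_bigO antisym_area_def
    by (intro bigO_on_scaleR bigO_on_diff A bigO_on_bounded_linear[OF bounded_linear_transpose])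
qed

lemma remainder2_eq:
  assumes "0 \<le> s" "s < t" "t \<le> T"
  shows "remainder2 w \<phi> \<phi>' \<phi>'' D s t = incr \<phi> s t - row_app (\<phi>' s) (incr x s t)
    - (1/2) *\<^sub>R row_app (row_app (\<phi>'' s) (incr x s t)) (incr x s t)
    - ddot (transpose (\<phi>'' s)) (antisym_area w s t) - ddot (D s) (incr (bracket w) s t)"
proof -
  define M where "M = transpose (\<phi>'' s)"
  define a where "a = (1/2) *\<^sub>R ddot M (area w s t)"
  define b where "b = (1/2) *\<^sub>R ddot M (transpose (area w s t))"
  have e1: "row_app (row_app (\<phi>'' s) (incr x s t)) (incr x s t) = ddot M (outer (incr x s t) (incr x s t))"
    by (simp add: M_def ddot_transpose_outer)
  have e2: "ddot M (antisym_area w s t) = b - a"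
    by (simp add: antisym_area_def ddot.scaleR_right ddot.diff_right a_def b_def scaleR_right_diff_distrib)
  have e3: "ddot (D s + (1/2) *\<^sub>R M) (incr (bracket w) s t) = ddot (D s) (incr (bracket w) s t)
      + ((1/2) *\<^sub>R ddot M (outer (incr x s t) (incr x s t)) - a - b)"
    using incr_bracket[OF assms]
    by (simp add: ddot.add_left ddot.scaleR_left ddot.diff_right a_def b_def scaleR_right_diff_distrib)
  have e4: "ddot M (transpose (area w s t)) = b + b"
    by (simp add: b_def scaleR_left_distrib[symmetric])
  show ?thesis
    unfolding remainder2_def rough_germ_def bracket_germ_def M_def[symmetric] e1 e2 e3 e4
    by (simp add: algebra_simps)
qed

section \<open>Sewing of the rough germ and the bracket germ\<close>

lemma sub_triangle_bigO:
  assumes "unif_holder T \<gamma> Y U" "\<gamma> \<ge> 0"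
  shows "bigO_on {(y, s, r, t). y \<in> Y \<and> 0 \<le> s \<and> s < r \<and> r < t \<and> t \<le> T} (\<lambda>(y, s, r, t). t - s) \<gamma> (\<lambda>(y, s, r, t). U y s r)"
    and "bigO_on {(y, s, r, t). y \<in> Y \<and> 0 \<le> s \<and> s < r \<and> r < t \<and> t \<le> T} (\<lambda>(y, s, r, t). t - s) \<gamma> (\<lambda>(y, s, r, t). U y r t)"
  unfolding split_beta by (rule unif_holder_bigO[OF assms]; auto)+

text \<open>The outer product from Chen's relation cancels the linear part of the expansion of
  \<phi>', which works because the germ contracts with the transposed area. What remains is a
  controlled remainder times an increment of x, of order (\<alpha> + \<beta>) + \<alpha>, and an
  increment of \<phi>'' against the area, of order \<beta> + 2\<alpha>.\<close>

lemma rough_germ_delta: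
  assumes R: "unif_holder T (\<alpha> + \<beta>) Y (\<lambda>y. remainder x (\<phi>' y) (\<phi>'' y))"
    and H: "unif_holder T \<beta> Y (\<lambda>y. incr (\<phi>'' y))"
  shows "\<exists>K\<ge>0. \<forall>y\<in>Y. \<forall>s r t. 0 \<le> s \<and> s < r \<and> r < t \<and> t \<le> T \<longrightarrow>
    norm (rough_germ w (\<phi>' y) (\<phi>'' y) s t - rough_germ w (\<phi>' y) (\<phi>'' y) s r - rough_germ w (\<phi>' y) (\<phi>'' y) r t)
      \<le> K * (t - s) powr (2 * \<alpha> + \<beta>)"
proof -
  let ?S = "{(y, s, r, t). y \<in> Y \<and> 0 \<le> s \<and> s < r \<and> r < t \<and> t \<le> T}"
  let ?r = "\<lambda>(y, s, r, t). t - s"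
  have X: "unif_holder T \<alpha> Y (\<lambda>_. incr x)" and A: "unif_holder T (2 * \<alpha>) Y (\<lambda>_. area w)"
    using x_holder area_holder by (auto simp: unif_holder_def)
  have "bigO_on ?S ?r (2 * \<alpha> + \<beta>) (\<lambda>i. - row_app ((\<lambda>(y, s, r, t). remainder x (\<phi>' y) (\<phi>'' y) s r) i) ((\<lambda>(y, s, r, t). incr x r t) i)
      - ddot (transpose ((\<lambda>(y, s, r, t). incr (\<phi>'' y) s r) i)) (transpose ((\<lambda>(y, s, r, t). area w r t) i)))"
    using exponents
    by (intro bigO_on_diff bigO_on_minus bigO_on_bilinear[OF bounded_bilinear_row_app, where a = "\<alpha> + \<beta>" and b = \<alpha>]
        bigO_on_bilinear[OF bounded_bilinear_ddot, where a = \<beta> and b = "2 * \<alpha>"]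
        bigO_on_bounded_linear[OF bounded_linear_transpose]
        sub_triangle_bigO(1)[OF R] sub_triangle_bigO(1)[OF H] sub_triangle_bigO(2)[OF X] sub_triangle_bigO(2)[OF A]) auto
  then obtain K where K: "K \<ge> 0" "\<forall>i\<in>?S. norm (- row_app ((\<lambda>(y, s, r, t). remainder x (\<phi>' y) (\<phi>'' y) s r) i) ((\<lambda>(y, s, r, t). incr x r t) i)
      - ddot (transpose ((\<lambda>(y, s, r, t). incr (\<phi>'' y) s r) i)) (transpose ((\<lambda>(y, s, r, t). area w r t) i))) \<le> K * ?r i powr (2 * \<alpha> + \<beta>)"
    using bigO_onD by blast
  show ?thesis
  proof (intro exI[of _ K] conjI K(1) ballI allI impI)
    fix y s r t assume "y \<in> Y" and srt: "0 \<le> s \<and> s < r \<and> r < t \<and> t \<le> T"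
    then have "(y, s, r, t) \<in> ?S" by auto
    from K(2)[rule_format, OF this]
    have le: "norm (- row_app (remainder x (\<phi>' y) (\<phi>'' y) s r) (incr x r t)
        - ddot (transpose (incr (\<phi>'' y) s r)) (transpose (area w r t))) \<le> K * (t - s) powr (2 * \<alpha> + \<beta>)"
      by simp
    have A: "area w s t = area w s r + area w r t + outer (incr x s r) (incr x r t)"
      using srt by (intro chen) auto
    have "rough_germ w (\<phi>' y) (\<phi>'' y) s t - rough_germ w (\<phi>' y) (\<phi>'' y) s r - rough_germ w (\<phi>' y) (\<phi>'' y) r t
      = - row_app (remainder x (\<phi>' y) (\<phi>'' y) s r) (incr x r t) - ddot (transpose (incr (\<phi>'' y) s r)) (transpose (area w r t))"
      unfolding rough_germ_def A remainder_def incr_def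
      by (simp add: transpose_linear transpose_outer ddot.add_right ddot.diff_left ddot_transpose_outer
          row_app.diff_left row_app.diff_right)
    with le show "norm (rough_germ w (\<phi>' y) (\<phi>'' y) s t - rough_germ w (\<phi>' y) (\<phi>'' y) s r - rough_germ w (\<phi>' y) (\<phi>'' y) r t)
      \<le> K * (t - s) powr (2 * \<alpha> + \<beta>)" by simp
  qed
qed

text \<open>The Young case: additivity of the bracket increments leaves only an increment of b
  against one of the bracket, and \<beta> + 2\<alpha> > 1.\<close>

lemma bracket_germ_delta:
  assumes H: "unif_holder T \<beta> Y (\<lambda>y. incr (b y))"
  shows "\<exists>K\<ge>0. \<forall>y\<in>Y. \<forall>s r t. 0 \<le> s \<and> s < r \<and> r < t \<and> t \<le> T \<longrightarrow>
    norm (bracket_germ w (b y) s t - bracket_germ w (b y) s r - bracket_germ w (b y) r t)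
      \<le> K * (t - s) powr (2 * \<alpha> + \<beta>)"
proof -
  let ?S = "{(y, s, r, t). y \<in> Y \<and> 0 \<le> s \<and> s < r \<and> r < t \<and> t \<le> T}"
  let ?r = "\<lambda>(y, s, r, t). t - s"
  have X: "unif_holder T (2 * \<alpha>) Y (\<lambda>_. incr (bracket w))"
    using bracket_holder by (auto simp: unif_holder_def)
  have "bigO_on ?S ?r (2 * \<alpha> + \<beta>) (\<lambda>i. - ddot ((\<lambda>(y, s, r, t). incr (b y) s r) i) ((\<lambda>(y, s, r, t). incr (bracket w) r t) i))"
    using exponents
    by (intro bigO_on_minus bigO_on_bilinear[OF bounded_bilinear_ddot, where a = \<beta> and b = "2 * \<alpha>"]
        sub_triangle_bigO(1)[OF H] sub_triangle_bigO(2)[OF X]) auto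
  then obtain K where K: "K \<ge> 0" "\<forall>i\<in>?S. norm (- ddot ((\<lambda>(y, s, r, t). incr (b y) s r) i) ((\<lambda>(y, s, r, t). incr (bracket w) r t) i))
      \<le> K * ?r i powr (2 * \<alpha> + \<beta>)"
    using bigO_onD by blast
  show ?thesis
  proof (intro exI[of _ K] conjI K(1) ballI allI impI)
    fix y s r t assume "y \<in> Y" and srt: "0 \<le> s \<and> s < r \<and> r < t \<and> t \<le> T"
    then have "(y, s, r, t) \<in> ?S" by auto
    from K(2)[rule_format, OF this]
    have le: "norm (- ddot (incr (b y) s r) (incr (bracket w) r t)) \<le> K * (t - s) powr (2 * \<alpha> + \<beta>)"
      by simp
    have "bracket_germ w (b y) s t - bracket_germ w (b y) s r - bracket_germ w (b y) r t
      = - ddot (incr (b y) s r) (incr (bracket w) r t)"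
      unfolding bracket_germ_def incr_def by (simp add: ddot.diff_left ddot.diff_right)
    with le show "norm (bracket_germ w (b y) s t - bracket_germ w (b y) s r - bracket_germ w (b y) r t)
      \<le> K * (t - s) powr (2 * \<alpha> + \<beta>)" by simp
  qed
qed

lemma germ_diag: "rough_germ w \<phi>' \<phi>'' s s = 0" "bracket_germ w b s s = 0"
  by (simp_all add: rough_germ_def bracket_germ_def incr_def area_def row_app.zero_right ddot.zero_right transpose_linear)

text \<open>The order of the quantifiers is the point: the primitives depend on y, but C does not,
  since sewing multiplies the defect constant by a number independent of the germ.\<close>

lemma germs_sewn:
  fixes \<phi>' :: "'y \<Rightarrow> real \<Rightarrow> 'e::euclidean_space^'d"
  assumes R: "unif_holder T (\<alpha> + \<beta>) Y (\<lambda>y. remainder x (\<phi>' y) (\<phi>'' y))"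
    and H: "unif_holder T \<beta> Y (\<lambda>y. incr (\<phi>'' y))"
    and D: "unif_holder T \<beta> Y (\<lambda>y. incr (D y))"
  shows "\<exists>C\<ge>0. \<forall>y\<in>Y. \<exists>I J. \<forall>s t. 0 \<le> s \<and> s \<le> t \<and> t \<le> T \<longrightarrow>
     norm (I t - I s - rough_germ w (\<phi>' y) (\<phi>'' y) s t) \<le> C * (t - s) powr \<nu> \<and>
     norm (J t - J s - bracket_germ w (\<lambda>s. D y s + (1/2) *\<^sub>R transpose (\<phi>'' y s)) s t) \<le> C * (t - s) powr \<nu>"
proof -
  let ?b = "\<lambda>y s. D y s + (1/2) *\<^sub>R transpose (\<phi>'' y s)"
  have "bigO_on (Y \<times> triangle T) (\<lambda>i. snd (snd i) - fst (snd i)) \<beta>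
     (\<lambda>i. incr (D (fst i)) (fst (snd i)) (snd (snd i)) + (1/2) *\<^sub>R transpose (incr (\<phi>'' (fst i)) (fst (snd i)) (snd (snd i))))"
    using H D unfolding unif_holder_iff_bigO
    by (intro bigO_on_add bigO_on_scaleR bigO_on_bounded_linear[OF bounded_linear_transpose])
  then have b: "unif_holder T \<beta> Y (\<lambda>y. incr (?b y))"
    unfolding unif_holder_iff_bigO by (rule bigO_on_cong) (simp add: incr_def transpose_linear scaleR_right_diff_distrib)
  obtain K1 where K1: "K1 \<ge> 0" "\<forall>y\<in>Y. \<forall>s r t. 0 \<le> s \<and> s < r \<and> r < t \<and> t \<le> T \<longrightarrow>
    norm (rough_germ w (\<phi>' y) (\<phi>'' y) s t - rough_germ w (\<phi>' y) (\<phi>'' y) s r - rough_germ w (\<phi>' y) (\<phi>'' y) r t)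
      \<le> K1 * (t - s) powr (2 * \<alpha> + \<beta>)"
    using rough_germ_delta[OF R H] by blast
  obtain K2 where K2: "K2 \<ge> 0" "\<forall>y\<in>Y. \<forall>s r t. 0 \<le> s \<and> s < r \<and> r < t \<and> t \<le> T \<longrightarrow>
    norm (bracket_germ w (?b y) s t - bracket_germ w (?b y) s r - bracket_germ w (?b y) r t)
      \<le> K2 * (t - s) powr (2 * \<alpha> + \<beta>)"
    using bracket_germ_delta[OF b] by blast
  let ?c = "sew_const T (2 * \<alpha> + \<beta>)"
  define C where "C = (K1 + K2) * ?c"
  have c0: "?c \<ge> 0" using sew_const_nonneg nu_gt_1(4) by blast
  have C1: "K1 * ?c * d powr \<nu> \<le> C * d powr \<nu>" and C2: "K2 * ?c * d powr \<nu> \<le> C * d powr \<nu>" for d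
    using K1(1) K2(1) c0 unfolding C_def by (intro mult_right_mono; simp)+
  show ?thesis
  proof (intro exI[of _ C] conjI ballI)
    show "C \<ge> 0" using K1(1) K2(1) c0 by (simp add: C_def)
    fix y assume y: "y \<in> Y"
    have "\<exists>I. \<forall>s t. 0 \<le> s \<and> s \<le> t \<and> t \<le> T \<longrightarrow>
        norm (I t - I s - rough_germ w (\<phi>' y) (\<phi>'' y) s t) \<le> K1 * ?c * (t - s) powr \<nu>"
    proof (rule sewing[OF T_pos nu_gt_1(4) K1(1), of "rough_germ w (\<phi>' y) (\<phi>'' y)"])
      show "norm (rough_germ w (\<phi>' y) (\<phi>'' y) s t - rough_germ w (\<phi>' y) (\<phi>'' y) s r - rough_germ w (\<phi>' y) (\<phi>'' y) r t)
          \<le> K1 * (t - s) powr (2 * \<alpha> + \<beta>)" if "0 \<le> s" "s < r" "r < t" "t \<le> T" for s r t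
        using K1(2) y that by blast
    qed (auto simp: germ_diag)
    then obtain I where I: "\<forall>s t. 0 \<le> s \<and> s \<le> t \<and> t \<le> T \<longrightarrow>
        norm (I t - I s - rough_germ w (\<phi>' y) (\<phi>'' y) s t) \<le> K1 * ?c * (t - s) powr \<nu>" by blast
    have "\<exists>J. \<forall>s t. 0 \<le> s \<and> s \<le> t \<and> t \<le> T \<longrightarrow>
        norm (J t - J s - bracket_germ w (?b y) s t) \<le> K2 * ?c * (t - s) powr \<nu>"
    proof (rule sewing[OF T_pos nu_gt_1(4) K2(1), of "bracket_germ w (?b y)"])
      show "norm (bracket_germ w (?b y) s t - bracket_germ w (?b y) s r - bracket_germ w (?b y) r t)
          \<le> K2 * (t - s) powr (2 * \<alpha> + \<beta>)" if "0 \<le> s" "s < r" "r < t" "t \<le> T" for s r t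
        using K2(2) y that by blast
    qed (auto simp: germ_diag)
    then obtain J where J: "\<forall>s t. 0 \<le> s \<and> s \<le> t \<and> t \<le> T \<longrightarrow>
        norm (J t - J s - bracket_germ w (?b y) s t) \<le> K2 * ?c * (t - s) powr \<nu>" by blast
    show "\<exists>I J. \<forall>s t. 0 \<le> s \<and> s \<le> t \<and> t \<le> T \<longrightarrow>
       norm (I t - I s - rough_germ w (\<phi>' y) (\<phi>'' y) s t) \<le> C * (t - s) powr \<nu> \<and>
       norm (J t - J s - bracket_germ w (?b y) s t) \<le> C * (t - s) powr \<nu>"
    proof (rule exI[of _ I], rule exI[of _ J], intro allI impI)
      fix s t assume st: "0 \<le> s \<and> s \<le> t \<and> t \<le> T"
      show "norm (I t - I s - rough_germ w (\<phi>' y) (\<phi>'' y) s t) \<le> C * (t - s) powr \<nu> \<and>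
         norm (J t - J s - bracket_germ w (?b y) s t) \<le> C * (t - s) powr \<nu>"
        by (rule conjI[OF order_trans[OF I[rule_format, OF st] C1] order_trans[OF J[rule_format, OF st] C2]])
    qed
  qed
qed

section \<open>The integral equation and its local form\<close>

lemma has_rough_integral_iff:
  "has_rough_integral T \<alpha> \<beta> w \<phi>' t I \<longleftrightarrow>
     has_mesh_limit T (\<lambda>r u. rough_germ w \<phi>' (path_deriv T \<alpha> \<beta> x \<phi>') (min r t) (min u t)) I"
  by (simp add: has_rough_integral_def rough_germ_def path_deriv_mat_def)

lemma has_bracket_integral_iff:
  "has_bracket_integral T w b t J \<longleftrightarrow> has_mesh_limit T (\<lambda>r u. bracket_germ w b (min r t) (min u t)) J"
  by (simp add: has_bracket_integral_def bracket_germ_def)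

text \<open>The integrals in \<open>is_time_deriv\<close> exist separately for each upper limit and
  carry no rate. Uniqueness of mesh limits identifies them with increments of the sewn primitives,
  whose local error is known and uniform in y; subtracting the equation at s from that at t gives
  the increment.\<close>

lemma is_time_deriv_remainder2:
  fixes \<phi> :: "'y \<Rightarrow> real \<Rightarrow> 'e::euclidean_space"
  defines "\<phi>' \<equiv> \<lambda>y. path_deriv T \<alpha> \<beta> x (\<phi> y)"
  defines "\<phi>'' \<equiv> \<lambda>y. path_deriv T \<alpha> \<beta> x (\<phi>' y)"
  assumes R: "unif_holder T (\<alpha> + \<beta>) Y (\<lambda>y. remainder x (\<phi>' y) (\<phi>'' y))"
    and H: "unif_holder T \<beta> Y (\<lambda>y. incr (\<phi>'' y))"
    and D: "unif_holder T \<beta> Y (\<lambda>y. incr (D y))"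
    and td: "\<And>y. y \<in> Y \<Longrightarrow> is_time_deriv T \<alpha> \<beta> w (\<phi> y) (D y)"
  shows "unif_holder T \<nu> Y (\<lambda>y. remainder2 w (\<phi> y) (\<phi>' y) (\<phi>'' y) (D y))"
proof -
  let ?b = "\<lambda>y s. D y s + (1/2) *\<^sub>R transpose (\<phi>'' y s)"
  obtain C where C: "C \<ge> 0" "\<forall>y\<in>Y. \<exists>I J. \<forall>s t. 0 \<le> s \<and> s \<le> t \<and> t \<le> T \<longrightarrow>
     norm (I t - I s - rough_germ w (\<phi>' y) (\<phi>'' y) s t) \<le> C * (t - s) powr \<nu> \<and>
     norm (J t - J s - bracket_germ w (?b y) s t) \<le> C * (t - s) powr \<nu>"
    using germs_sewn[OF R H D] by blast
  have "norm (remainder2 w (\<phi> y) (\<phi>' y) (\<phi>'' y) (D y) s t) \<le> (C + C) * (t - s) powr \<nu>"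
    if y: "y \<in> Y" and st: "0 \<le> s" "s < t" "t \<le> T" for y s t
  proof -
    obtain I J where IJ: "\<forall>s t. 0 \<le> s \<and> s \<le> t \<and> t \<le> T \<longrightarrow>
       norm (I t - I s - rough_germ w (\<phi>' y) (\<phi>'' y) s t) \<le> C * (t - s) powr \<nu> \<and>
       norm (J t - J s - bracket_germ w (?b y) s t) \<le> C * (t - s) powr \<nu>"
      using C(2) y by blast
    have sum: "\<phi> y r - \<phi> y 0 = (I r - I 0) + (J r - J 0)" if r: "0 \<le> r" "r \<le> T" for r
    proof -
      have 1: "has_rough_integral T \<alpha> \<beta> w (\<phi>' y) r (I r - I 0)"
        unfolding has_rough_integral_iff \<phi>''_def[symmetric]
        using IJ by (intro has_mesh_limit_local[OF T_pos nu_gt_1(1) r, where C = C]) (simp add: \<phi>''_def)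
      have 2: "has_bracket_integral T w (?b y) r (J r - J 0)"
        unfolding has_bracket_integral_iff
        using IJ by (intro has_mesh_limit_local[OF T_pos nu_gt_1(1) r, where C = C]) simp
      have "\<exists>I' J'. has_rough_integral T \<alpha> \<beta> w (\<phi>' y) r I' \<and> has_bracket_integral T w (?b y) r J' \<and>
          \<phi> y r - \<phi> y 0 = I' + J'"
        using td[OF y] r
        unfolding is_time_deriv_def path_deriv2_def path_deriv_mat_def[abs_def] \<phi>'_def \<phi>''_def by simp
      then obtain I' J' where IJ': "has_rough_integral T \<alpha> \<beta> w (\<phi>' y) r I'" "has_bracket_integral T w (?b y) r J'"
        "\<phi> y r - \<phi> y 0 = I' + J'" by blast
      have "I' = I r - I 0" "J' = J r - J 0"
        using 1 2 IJ' has_mesh_limit_unique[OF T_pos] unfolding has_rough_integral_iff has_bracket_integral_iff by blast+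
      then show ?thesis using IJ'(3) by simp
    qed
    have "\<phi> y t - \<phi> y s = (I t - I s) + (J t - J s)"
    proof -
      have "\<phi> y t - \<phi> y s = (\<phi> y t - \<phi> y 0) - (\<phi> y s - \<phi> y 0)" by simp
      also have "\<dots> = (I t - I 0) + (J t - J 0) - ((I s - I 0) + (J s - J 0))"
        using sum[of t] sum[of s] st by simp
      finally show ?thesis by simp
    qed
    then have eq: "remainder2 w (\<phi> y) (\<phi>' y) (\<phi>'' y) (D y) s t
        = (I t - I s - rough_germ w (\<phi>' y) (\<phi>'' y) s t) + (J t - J s - bracket_germ w (?b y) s t)"
      by (simp add: remainder2_def incr_def)
    have le: "norm (I t - I s - rough_germ w (\<phi>' y) (\<phi>'' y) s t) \<le> C * (t - s) powr \<nu>"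
      "norm (J t - J s - bracket_germ w (?b y) s t) \<le> C * (t - s) powr \<nu>"
      using IJ st by auto
    show ?thesis
      unfolding eq distrib_right by (rule order_trans[OF norm_triangle_ineq add_mono[OF le]])
  qed
  then show ?thesis unfolding unif_holder_def by blast
qed

text \<open>Subtracting the sewn primitives from \<phi> leaves a function with increments of order
  \<nu> > 1, hence a constant; this turns the local expansion back into the integral
  equation.\<close>

lemma is_time_derivI:
  fixes \<phi> :: "real \<Rightarrow> 'e::euclidean_space"
  defines "\<phi>' \<equiv> path_deriv T \<alpha> \<beta> x \<phi>"
  defines "\<phi>'' \<equiv> path_deriv T \<alpha> \<beta> x \<phi>'"
  assumes \<phi>': "\<phi>' \<in> controlled1 T \<alpha> \<beta> x" and D: "holder_O T \<beta> (incr D)"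
    and sym: "\<And>t. t \<in> {0..T} \<Longrightarrow> transpose (D t) = D t"
    and rem: "holder_O T \<nu> (remainder2 w \<phi> \<phi>' \<phi>'' D)"
  shows "is_time_deriv T \<alpha> \<beta> w \<phi> D"
proof -
  let ?b = "\<lambda>s. D s + (1/2) *\<^sub>R transpose (\<phi>'' s)"
  have pd: "is_path_deriv T \<alpha> \<beta> x \<phi>' \<phi>''" unfolding \<phi>''_def by (rule path_deriv_controlled[OF \<phi>'])
  obtain C I J where C: "C \<ge> 0" and IJ: "\<forall>s t. 0 \<le> s \<and> s \<le> t \<and> t \<le> T \<longrightarrow>
     norm (I t - I s - rough_germ w \<phi>' \<phi>'' s t) \<le> C * (t - s) powr \<nu> \<and>
     norm (J t - J s - bracket_germ w ?b s t) \<le> C * (t - s) powr \<nu>"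
    using germs_sewn[OF is_path_deriv_holder(4,3)[OF pd] D] by auto
  obtain E where E: "E \<ge> 0" "\<forall>s t. 0 \<le> s \<and> s < t \<and> t \<le> T \<longrightarrow> norm (remainder2 w \<phi> \<phi>' \<phi>'' D s t) \<le> E * (t - s) powr \<nu>"
    using unif_holderD[OF rem] by auto
  define f where "f t = \<phi> t - I t - J t" for t
  have const: "f t = f 0" if t: "0 \<le> t" "t \<le> T" for t
  proof (rule small_increments_const[OF T_pos nu_gt_1(1) t])
    fix s u assume su: "0 \<le> s" "s \<le> u" "u \<le> T"
    show "norm (f u - f s) \<le> (E + C + C) * (u - s) powr \<nu>"
    proof (cases "s = u")
      case False
      have eq: "f u - f s = remainder2 w \<phi> \<phi>' \<phi>'' D s u - (I u - I s - rough_germ w \<phi>' \<phi>'' s u)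
          - (J u - J s - bracket_germ w ?b s u)"
        by (simp add: f_def remainder2_def incr_def)
      have le: "norm (remainder2 w \<phi> \<phi>' \<phi>'' D s u) \<le> E * (u - s) powr \<nu>"
        "norm (I u - I s - rough_germ w \<phi>' \<phi>'' s u) \<le> C * (u - s) powr \<nu>"
        "norm (J u - J s - bracket_germ w ?b s u) \<le> C * (u - s) powr \<nu>"
        using E(2) IJ su False by auto
      show ?thesis
        unfolding eq distrib_right by (rule order_trans[OF norm_diff_diff_le add_mono[OF add_mono]]) (rule le)+
    qed simp
  qed
  have "\<exists>I' J'. has_rough_integral T \<alpha> \<beta> w \<phi>' t I' \<and> has_bracket_integral T w ?b t J' \<and> \<phi> t - \<phi> 0 = I' + J'"
    if t: "t \<in> {0..T}" for t
  proof (intro exI conjI)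
    show "has_rough_integral T \<alpha> \<beta> w \<phi>' t (I t - I 0)"
      unfolding has_rough_integral_iff
      using IJ t by (intro has_mesh_limit_local[OF T_pos nu_gt_1(1), where C = C]) (auto simp: \<phi>''_def)
    show "has_bracket_integral T w ?b t (J t - J 0)"
      unfolding has_bracket_integral_iff
      using IJ t by (intro has_mesh_limit_local[OF T_pos nu_gt_1(1), where C = C]) auto
    show "\<phi> t - \<phi> 0 = (I t - I 0) + (J t - J 0)"
      using const[of t] t by (simp add: f_def algebra_simps)
  qed
  then show ?thesis
    using sym D exponents
    by (auto simp: is_time_deriv_def path_deriv2_def path_deriv_mat_def[abs_def] \<phi>'_def \<phi>''_def Omega_iff)
qed

end

section \<open>The Ito formula\<close>

lemma row_app_row_comp_left: "row_app (\<chi> j. row_comp (P $ j) Q) v = row_comp (row_app P v) Q"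
  by (simp add: row_app_def[of _ v] row_comp.sum_left row_comp.scaleR_left)

lemma row_app_row_comp_right: "row_app (\<chi> j. row_comp P (Q $ j)) v = row_comp P (row_app Q v)"
  by (simp add: row_app_def[of _ v] row_comp.sum_right row_comp.scaleR_right)

lemma row_app_swap:
  assumes "\<And>i k. A $ i $ k = B $ k $ i"
  shows "row_app (row_app A v) p = row_app (row_app B p) v"
proof -
  have "row_app (row_app A v) p = (\<Sum>k\<in>UNIV. \<Sum>i\<in>UNIV. (p $ k * v $ i) *\<^sub>R A $ i $ k)"
    by (simp add: row_app_def scaleR_sum_right)
  also have "\<dots> = (\<Sum>i\<in>UNIV. \<Sum>k\<in>UNIV. (p $ k * v $ i) *\<^sub>R A $ i $ k)" by (rule sum.swap)
  also have "\<dots> = row_app (row_app B p) v"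
    by (simp add: row_app_def scaleR_sum_right assms mult.commute)
  finally show ?thesis .
qed

lemma ddot_symmetric_antisymmetric:
  fixes C :: "'e::real_normed_vector^'d^'d"
  assumes C: "\<And>i j. C $ i $ j = C $ j $ i" and B: "transpose B = - B"
  shows "ddot C B = 0"
proof -
  have B': "B $ j $ i = - B $ i $ j" for i j
    using arg_cong[OF B, of "\<lambda>M. M $ i $ j"] by (simp add: transpose_def)
  have "ddot C B = (\<Sum>j\<in>UNIV. \<Sum>i\<in>UNIV. B $ i $ j *\<^sub>R C $ i $ j)"
    unfolding ddot_def by (rule sum.swap)
  also have "\<dots> = (\<Sum>j\<in>UNIV. \<Sum>i\<in>UNIV. - (B $ j $ i *\<^sub>R C $ j $ i))"
    by (intro sum.cong refl) (metis B' C scaleR_minus_left)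
  also have "\<dots> = - ddot C B" by (simp add: ddot_def sum_negf)
  finally have "ddot C B = - ddot C B" .
  then have "2 *\<^sub>R ddot C B = 0" by (simp add: scaleR_2 eq_neg_iff_add_eq_0)
  then show ?thesis by simp
qed

lemma ddot_row_app_vec:
  fixes P :: "'e::real_normed_vector^'m"
  shows "ddot (\<chi> i j. row_app P (Q $ i $ j)) B = row_app P (ddot Q B)"
  by (simp add: ddot_def row_app.sum_right row_app.scaleR_right)

text \<open>The second path derivative of \<open>g(t, \<theta>\<^sub>t)\<close>, with the values \<open>D2\<close>, \<open>H\<close>, \<open>K\<close>, \<open>G\<close>, \<open>G0\<close> of
  \<open>\<partial>\<^sub>\<omega>\<partial>\<^sub>\<omega> g\<close>, \<open>\<partial>\<^sub>y\<partial>\<^sub>\<omega> g\<close>, \<open>\<partial>\<^sub>\<omega>\<partial>\<^sub>y g\<close>, \<open>\<partial>\<^sub>y\<partial>\<^sub>y g\<close>, \<open>\<partial>\<^sub>y g\<close>.\<close>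

definition comp_deriv2 ::
  "'e::real_normed_vector^'d^'d \<Rightarrow> 'e^'d^'m \<Rightarrow> 'e^'m^'d \<Rightarrow> 'e^'m^'m \<Rightarrow> 'e^'m \<Rightarrow> real^'m^'d \<Rightarrow> real^'m^'d^'d \<Rightarrow> 'e^'d^'d"
where
  "comp_deriv2 D2 H K G G0 \<theta>1 \<theta>2 =
     (D2 + row_comp H \<theta>1) + (\<chi> j. row_comp ((K + row_comp G \<theta>1) $ j) \<theta>1 + row_comp G0 (\<theta>2 $ j))"

lemma comp_deriv2_quadratic:
  assumes K: "\<And>i k. K $ i $ k = H $ k $ i"
  shows "row_app (row_app (comp_deriv2 D2 H K G G0 \<theta>1 \<theta>2) v) v = row_app (row_app D2 v) v
    + 2 *\<^sub>R row_app (row_app H (row_app \<theta>1 v)) v + row_app (row_app G (row_app \<theta>1 v)) (row_app \<theta>1 v)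
    + row_app G0 (row_app (row_app \<theta>2 v) v)"
proof -
  have split: "(\<chi> j. row_comp ((K + row_comp G \<theta>1) $ j) \<theta>1 + row_comp G0 (\<theta>2 $ j))
      = (\<chi> j. row_comp ((K + row_comp G \<theta>1) $ j) \<theta>1) + (\<chi> j. row_comp G0 (\<theta>2 $ j))"
    by (simp add: vec_eq_iff)
  show ?thesis
    unfolding comp_deriv2_def split row_app.add_left row_app_row_comp_left row_app_row_comp_right row_app_row_comp
    by (simp add: row_app_swap[OF K] scaleR_2)
qed

lemma comp_deriv2_antisymmetric:
  fixes H :: "'e::real_normed_vector^'d^'m"
  assumes K: "\<And>i k. K $ i $ k = H $ k $ i" and G: "\<And>a b. row_app (row_app G a) b = row_app (row_app G b) a"
    and B: "transpose B = - B"
  shows "ddot (transpose (comp_deriv2 D2 H K G G0 \<theta>1 \<theta>2)) B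
    = ddot (transpose D2) B + row_app G0 (ddot (transpose \<theta>2) B)"
proof -
  define C where "C = row_comp H \<theta>1 + (\<chi> j. row_comp ((K + row_comp G \<theta>1) $ j) \<theta>1)"
  have HK: "row_app H a $ i = row_app (K $ i) a" for i a
    by (simp add: row_app_def K)
  have "C $ j $ i = row_app (K $ i) (\<theta>1 $ j) + row_app (K $ j) (\<theta>1 $ i) + row_app (row_app G (\<theta>1 $ j)) (\<theta>1 $ i)" for i j
    by (simp add: C_def row_comp_def HK row_app.add_left)
  then have C: "C $ i $ j = C $ j $ i" for i j
    using G[of "\<theta>1 $ i" "\<theta>1 $ j"] by simp
  have "transpose (comp_deriv2 D2 H K G G0 \<theta>1 \<theta>2)
      = transpose D2 + C + (\<chi> i j. row_app G0 (transpose \<theta>2 $ i $ j))"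
    using C by (simp add: comp_deriv2_def vec_eq_iff transpose_def C_def row_comp_def)
  then show ?thesis
    by (simp add: ddot.add_left ddot_row_app_vec ddot_symmetric_antisymmetric[OF C B])
qed

lemma transpose_antisym_area: "transpose (antisym_area w s t) = - antisym_area w s t"
  by (simp add: antisym_area_def transpose_def vec_eq_iff field_simps)

section \<open>Second-order expansion of the composition\<close>

context rough_setting
begin

text \<open>The remainder of the composition is written as a sum of nine errors \<open>E1\<close> to
  \<open>E9\<close>, each of order at least \<nu>. Once they are bounded, the final identity is pure
  algebra: it combines bilinearity with the symmetry of mixed derivatives.\<close>

lemma ito_remainder2:
  fixes g :: "real \<Rightarrow> real^'m \<Rightarrow> 'e::euclidean_space"
  defines "D1 \<equiv> domega T \<alpha> \<beta> x g"
  defines "D2 \<equiv> domega T \<alpha> \<beta> x D1"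
  defines "K \<equiv> domega T \<alpha> \<beta> x (dy g)"
  assumes g: "g \<in> C23_loc T \<alpha> \<beta> w" and Dg: "is_time_deriv_field T \<alpha> \<beta> w g Dg"
    and \<theta>: "is_path_deriv T \<alpha> \<beta> x \<theta> \<theta>1" and \<theta>1: "is_path_deriv T \<alpha> \<beta> x \<theta>1 \<theta>2"
    and \<theta>rem: "holder_O T \<nu> (remainder2 w \<theta> \<theta>1 \<theta>2 D\<theta>)"
  shows "holder_O T \<nu> (remainder2 w (\<lambda>t. g t (\<theta> t)) (\<lambda>t. D1 t (\<theta> t) + row_comp (dy g t (\<theta> t)) (\<theta>1 t))
    (\<lambda>t. comp_deriv2 (D2 t (\<theta> t)) (dy D1 t (\<theta> t)) (K t (\<theta> t)) (dy (dy g) t (\<theta> t)) (dy g t (\<theta> t)) (\<theta>1 t) (\<theta>2 t))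
    (\<lambda>t. Dg t (\<theta> t) + (\<chi> i j. row_app (dy g t (\<theta> t)) (D\<theta> t $ i $ j))))"
proof -
  let ?S = "triangle T" and ?r = "\<lambda>i. snd i - fst i"
  have g12: "g \<in> C12_loc T \<alpha> \<beta> x" and D12: "D1 \<in> C12_loc T \<alpha> \<beta> x" and G12: "dy g \<in> C12_loc T \<alpha> \<beta> x"
    using g by (auto simp: C23_loc_def D1_def)
  have g2: "g \<in> C2_loc T" "dy g \<in> C2_loc T" "D1 \<in> C2_loc T" "g \<in> C1_loc T" "dy g \<in> C1_loc T" "D1 \<in> C1_loc T"
    "dy D1 \<in> C1_loc T" "dy (dy g) \<in> C1_loc T" "D2 \<in> C1_loc T"
    and fields: "controlled_field T \<alpha> \<beta> x g" "controlled_field T \<alpha> \<beta> x (dy g)" "controlled_field T \<alpha> \<beta> x D1"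
    using g12 D12 G12 by (auto simp: C12_loc_def C2_loc_def C1_beta_loc_def D2_def)
  have Dg1: "Dg \<in> C1_loc T" and Dgh: "holder_field T \<beta> Dg" and td: "\<And>y. is_time_deriv T \<alpha> \<beta> w (\<lambda>t. g t y) (\<lambda>t. Dg t y)"
    using Dg by (auto simp: is_time_deriv_field_def C1_beta_loc_def)
  have comm: "K t y $ j $ k = dy D1 t y $ k $ j" if "t \<in> {0..T}" for t y j k
    unfolding K_def D1_def by (rule domega_dy_commute[OF g2(4) fields(1,2) g2(6)[unfolded D1_def] that])
  note P = is_path_deriv_holder[OF \<theta>]
  obtain R where R: "\<And>t. t \<in> {0..T} \<Longrightarrow> \<theta> t \<in> cball 0 R"
    using continuous_path_in_cball[OF P(5)] by blast
  have S: "fst i \<in> {0..T} \<and> \<theta> (fst i) \<in> cball 0 R \<and> \<theta> (snd i) \<in> cball 0 R" if "i \<in> ?S" for i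
    using that R[of "fst i"] R[of "snd i"] by (auto simp: triangle_def)
  have mono: "bigO_on ?S ?r \<nu> U" if "bigO_on ?S ?r a U" "\<nu> \<le> a" for a and U :: "real \<times> real \<Rightarrow> 'e"
    by (rule bigO_on_mono[OF that, where T = T]) (auto simp: triangle_def)
  note X = x_holder[unfolded holder_O_iff_bigO]
  note A = antisym_area_holder[unfolded holder_O_iff_bigO]
  note Y = bracket_holder[unfolded holder_O_iff_bigO]
  note u = P(1)[unfolded holder_O_iff_bigO incr_def]
  have p: "bigO_on ?S ?r \<alpha> (\<lambda>i. row_app (\<theta>1 (fst i)) (incr x (fst i) (snd i)))"
    by (rule bigO_on_bilinear[OF bounded_bilinear_row_app bigO_on_triangle_bounded(1)[OF P(6)] X]) simp
  have up: "bigO_on ?S ?r (\<alpha> + \<beta>) (\<lambda>i. \<theta> (snd i) - \<theta> (fst i) - row_app (\<theta>1 (fst i)) (incr x (fst i) (snd i)))"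
    using P(4) by (simp add: holder_O_iff_bigO remainder_def incr_def)
  have pd: "path_deriv T \<alpha> \<beta> x (\<lambda>t. g t y) = (\<lambda>t. D1 t y)" "path_deriv T \<alpha> \<beta> x (\<lambda>t. D1 t y) = (\<lambda>t. D2 t y)" for y
    by (simp_all add: D1_def D2_def domega_def fun_eq_iff)
  have E1: "bigO_on ?S ?r \<nu> (\<lambda>i. remainder2 w (\<lambda>t. g t (\<theta> (snd i))) (\<lambda>t. D1 t (\<theta> (snd i)))
      (\<lambda>t. D2 t (\<theta> (snd i))) (\<lambda>t. Dg t (\<theta> (snd i))) (fst i) (snd i))"
  proof -
    have "unif_holder T \<nu> (cball 0 R) (\<lambda>y. remainder2 w (\<lambda>t. g t y) (\<lambda>t. D1 t y) (\<lambda>t. D2 t y) (\<lambda>t. Dg t y))"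
      using is_time_deriv_remainder2[of "cball 0 R" "\<lambda>y t. g t y" "\<lambda>y t. Dg t y", unfolded pd]
        controlled_field_unif_holder(1,2)[OF fields(3) compact_cball[of 0 R], folded D2_def]
        holder_field_unif_holder[OF Dgh compact_cball[of 0 R]] exponents td by simp
    from unif_holder_bigO[OF this, where S = ?S and y = "\<lambda>i. \<theta> (snd i)" and s = fst and t = snd and r = ?r]
    show ?thesis using S nu_gt_1 by (auto simp: triangle_def)
  qed
  have E2: "bigO_on ?S ?r \<nu> (\<lambda>i. row_app (D1 (fst i) (\<theta> (snd i)) - D1 (fst i) (\<theta> (fst i))
      - row_app (dy D1 (fst i) (\<theta> (fst i))) (\<theta> (snd i) - \<theta> (fst i))) (incr x (fst i) (snd i)))"
    by (rule mono[OF bigO_on_bilinear[OF bounded_bilinear_row_app bigO_on_taylor2[OF g2(3) u S] X refl]])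
      (use nu_gt_1 in auto)
  note D2l = bigO_on_lipschitz[OF g2(9) u S]
  have E3: "bigO_on ?S ?r \<nu> (\<lambda>i. (1/2) *\<^sub>R row_app (row_app (D2 (fst i) (\<theta> (snd i)) - D2 (fst i) (\<theta> (fst i)))
      (incr x (fst i) (snd i))) (incr x (fst i) (snd i)))"
    by (rule bigO_on_scaleR[OF mono[OF bigO_on_bilinear[OF bounded_bilinear_row_app
            bigO_on_bilinear[OF bounded_bilinear_row_app D2l X refl] X refl]]])
      (use nu_gt_1 in auto)
  have E4: "bigO_on ?S ?r \<nu> (\<lambda>i. ddot (transpose (D2 (fst i) (\<theta> (snd i)) - D2 (fst i) (\<theta> (fst i))))
      (antisym_area w (fst i) (snd i)))"
    by (rule mono[OF bigO_on_bilinear[OF bounded_bilinear_ddot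
            bigO_on_bounded_linear[OF bounded_linear_transpose D2l] A refl]])
      (use nu_gt_1 in auto)
  have E5: "bigO_on ?S ?r \<nu> (\<lambda>i. ddot (Dg (fst i) (\<theta> (snd i)) - Dg (fst i) (\<theta> (fst i)))
      (incr (bracket w) (fst i) (snd i)))"
    by (rule mono[OF bigO_on_bilinear[OF bounded_bilinear_ddot bigO_on_lipschitz[OF Dg1 u S] Y refl]])
      (use nu_gt_1 in auto)
  \<comment> \<open>Expansion in space at time s. The quadratic term has order 2\<alpha> < 1 and has
    to stay, so the Taylor formula is taken to third order.\<close>
  have E6: "bigO_on ?S ?r \<nu> (\<lambda>i. g (fst i) (\<theta> (snd i)) - g (fst i) (\<theta> (fst i))
      - row_app (dy g (fst i) (\<theta> (fst i))) (\<theta> (snd i) - \<theta> (fst i))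
      - (1/2) *\<^sub>R row_app (row_app (dy (dy g) (fst i) (\<theta> (fst i))) (\<theta> (snd i) - \<theta> (fst i))) (\<theta> (snd i) - \<theta> (fst i)))"
    by (rule mono[OF bigO_on_taylor3[OF g2(1,2) u S]]) (use nu_gt_1 in auto)
  have E7: "bigO_on ?S ?r \<nu> (\<lambda>i. row_app (dy g (fst i) (\<theta> (fst i))) (remainder2 w \<theta> \<theta>1 \<theta>2 D\<theta> (fst i) (snd i)))"
    by (rule bigO_on_bilinear[OF bounded_bilinear_row_app
          bigO_on_triangle_bounded(1)[OF continuous_on_field_comp[OF g2(5) P(5)]] \<theta>rem[unfolded holder_O_iff_bigO]]) simp
  \<comment> \<open>\<open>E8\<close> and \<open>E9\<close> replace the increment of \<theta> by its
    linear part in x, in the cross term and in the quadratic term. The replacement error has order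
    \<alpha> + \<beta> and is multiplied by a factor of order \<alpha>.\<close>
  have E8: "bigO_on ?S ?r \<nu> (\<lambda>i. row_app (row_app (dy D1 (fst i) (\<theta> (fst i)))
      (\<theta> (snd i) - \<theta> (fst i) - row_app (\<theta>1 (fst i)) (incr x (fst i) (snd i)))) (incr x (fst i) (snd i)))"
    by (rule mono[OF bigO_on_bilinear[OF bounded_bilinear_row_app bigO_on_bilinear[OF bounded_bilinear_row_app
          bigO_on_triangle_bounded(1)[OF continuous_on_field_comp[OF g2(7) P(5)]] up refl] X refl]])
      (use nu_gt_1 in auto)
  note G = bigO_on_triangle_bounded(1)[OF continuous_on_field_comp[OF g2(8) P(5)]]
  have E9: "bigO_on ?S ?r \<nu> (\<lambda>i. (1/2) *\<^sub>R (row_app (row_app (dy (dy g) (fst i) (\<theta> (fst i)))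
        (\<theta> (snd i) - \<theta> (fst i) - row_app (\<theta>1 (fst i)) (incr x (fst i) (snd i)))) (\<theta> (snd i) - \<theta> (fst i))
      + row_app (row_app (dy (dy g) (fst i) (\<theta> (fst i))) (row_app (\<theta>1 (fst i)) (incr x (fst i) (snd i))))
        (\<theta> (snd i) - \<theta> (fst i) - row_app (\<theta>1 (fst i)) (incr x (fst i) (snd i)))))"
    by (rule bigO_on_scaleR[OF bigO_on_add[OF
          mono[OF bigO_on_bilinear[OF bounded_bilinear_row_app bigO_on_bilinear[OF bounded_bilinear_row_app G up refl] u refl]]
          mono[OF bigO_on_bilinear[OF bounded_bilinear_row_app bigO_on_bilinear[OF bounded_bilinear_row_app G p refl] up refl]]]])
      (use nu_gt_1 in auto)
  note all = bigO_on_add[OF bigO_on_add[OF bigO_on_add[OF bigO_on_add[OF bigO_on_add[OF bigO_on_add[OF bigO_on_add[OF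
    bigO_on_add[OF E1 E2] E3] E4] E5] E6] E7] E8] E9]
  show ?thesis
    unfolding holder_O_iff_bigO
  proof (rule bigO_on_cong[OF all])
    fix i assume i: "i \<in> ?S"
    define s where "s = fst i"
    define t where "t = snd i"
    have st: "0 \<le> s" "s < t" "t \<le> T" and s: "s \<in> {0..T}" using i by (auto simp: triangle_def s_def t_def)
    define y where "y = \<theta> s"
    define z where "z = \<theta> t"
    define v where "v = incr x s t"
    define B where "B = antisym_area w s t"
    define Z where "Z = incr (bracket w) s t"
    have K: "K s y $ a $ b = dy D1 s y $ b $ a" for a b by (rule comm[OF s])
    have sym: "row_app (row_app (dy (dy g) s y) a) b = row_app (row_app (dy (dy g) s y) b) a" for a b
      by (rule dy_dy_symmetric[OF g2(1,2) s])
    have Bt: "transpose B = - B" unfolding B_def by (rule transpose_antisym_area)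
    show "remainder2 w (\<lambda>t. g t (\<theta> t)) (\<lambda>t. D1 t (\<theta> t) + row_comp (dy g t (\<theta> t)) (\<theta>1 t))
        (\<lambda>t. comp_deriv2 (D2 t (\<theta> t)) (dy D1 t (\<theta> t)) (K t (\<theta> t)) (dy (dy g) t (\<theta> t)) (dy g t (\<theta> t)) (\<theta>1 t) (\<theta>2 t))
        (\<lambda>t. Dg t (\<theta> t) + (\<chi> i j. row_app (dy g t (\<theta> t)) (D\<theta> t $ i $ j))) (fst i) (snd i) =
      remainder2 w (\<lambda>t. g t (\<theta> (snd i))) (\<lambda>t. D1 t (\<theta> (snd i))) (\<lambda>t. D2 t (\<theta> (snd i))) (\<lambda>t. Dg t (\<theta> (snd i))) (fst i) (snd i)
      + row_app (D1 (fst i) (\<theta> (snd i)) - D1 (fst i) (\<theta> (fst i))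
          - row_app (dy D1 (fst i) (\<theta> (fst i))) (\<theta> (snd i) - \<theta> (fst i))) (incr x (fst i) (snd i))
      + (1/2) *\<^sub>R row_app (row_app (D2 (fst i) (\<theta> (snd i)) - D2 (fst i) (\<theta> (fst i))) (incr x (fst i) (snd i))) (incr x (fst i) (snd i))
      + ddot (transpose (D2 (fst i) (\<theta> (snd i)) - D2 (fst i) (\<theta> (fst i)))) (antisym_area w (fst i) (snd i))
      + ddot (Dg (fst i) (\<theta> (snd i)) - Dg (fst i) (\<theta> (fst i))) (incr (bracket w) (fst i) (snd i))
      + (g (fst i) (\<theta> (snd i)) - g (fst i) (\<theta> (fst i)) - row_app (dy g (fst i) (\<theta> (fst i))) (\<theta> (snd i) - \<theta> (fst i))
          - (1/2) *\<^sub>R row_app (row_app (dy (dy g) (fst i) (\<theta> (fst i))) (\<theta> (snd i) - \<theta> (fst i))) (\<theta> (snd i) - \<theta> (fst i)))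
      + row_app (dy g (fst i) (\<theta> (fst i))) (remainder2 w \<theta> \<theta>1 \<theta>2 D\<theta> (fst i) (snd i))
      + row_app (row_app (dy D1 (fst i) (\<theta> (fst i))) (\<theta> (snd i) - \<theta> (fst i) - row_app (\<theta>1 (fst i)) (incr x (fst i) (snd i)))) (incr x (fst i) (snd i))
      + (1/2) *\<^sub>R (row_app (row_app (dy (dy g) (fst i) (\<theta> (fst i)))
            (\<theta> (snd i) - \<theta> (fst i) - row_app (\<theta>1 (fst i)) (incr x (fst i) (snd i)))) (\<theta> (snd i) - \<theta> (fst i))
          + row_app (row_app (dy (dy g) (fst i) (\<theta> (fst i))) (row_app (\<theta>1 (fst i)) (incr x (fst i) (snd i))))
            (\<theta> (snd i) - \<theta> (fst i) - row_app (\<theta>1 (fst i)) (incr x (fst i) (snd i))))"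
      unfolding s_def[symmetric] t_def[symmetric] remainder2_eq[OF st] v_def[symmetric] B_def[symmetric] Z_def[symmetric]
        y_def[symmetric] z_def[symmetric] comp_deriv2_quadratic[OF K] comp_deriv2_antisymmetric[OF K sym Bt]
        row_app.add_left row_app_row_comp ddot.add_left ddot_row_app_vec
      by (simp add: incr_def y_def[symmetric] z_def[symmetric] row_app.diff_left row_app.diff_right ddot.diff_left
          row_app.add_left row_app.add_right row_app.scaleR_right transpose_linear algebra_simps)
  qed
qed

lemma remainder2_cong:
  assumes "\<And>t. t \<in> {0..T} \<Longrightarrow> \<phi> t = \<psi> t" "\<And>t. t \<in> {0..T} \<Longrightarrow> \<phi>' t = \<psi>' t"
    "\<And>t. t \<in> {0..T} \<Longrightarrow> \<phi>'' t = \<psi>'' t" "holder_O T \<gamma> (remainder2 w \<psi> \<psi>' \<psi>'' D)"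
  shows "holder_O T \<gamma> (remainder2 w \<phi> \<phi>' \<phi>'' D)"
  by (rule unif_holder_cong[OF assms(4)])
    (simp add: assms(1-3) remainder2_def rough_germ_def bracket_germ_def incr_def)

text \<open>The path derivative of \<eta> is a field along \<theta> plus a product of such a field
  with the derivative of \<theta>, so it is controlled as well. The time derivative then follows
  from the local form of the equation, used first for \<theta> and for g and then conversely for
  \<eta>.\<close>

lemma ito_chain_rule:
  fixes g :: "real \<Rightarrow> real^'m \<Rightarrow> 'e::euclidean_space" and \<eta> :: "real \<Rightarrow> 'e"
  assumes \<theta>: "\<theta> \<in> controlled2 T \<alpha> \<beta> w" and g: "g \<in> C23_loc T \<alpha> \<beta> w"
    and D\<theta>: "is_time_deriv T \<alpha> \<beta> w \<theta> D\<theta>" and Dg: "is_time_deriv_field T \<alpha> \<beta> w g Dg"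
    and \<eta>: "\<And>t. t \<in> {0..T} \<Longrightarrow> \<eta> t = g t (\<theta> t)"
  shows "path_deriv T \<alpha> \<beta> x \<eta> \<in> controlled1 T \<alpha> \<beta> x"
    and "is_time_deriv T \<alpha> \<beta> w \<eta> (\<lambda>t. Dg t (\<theta> t) + (\<chi> i j. row_app (dy g t (\<theta> t)) (D\<theta> t $ i $ j)))"
proof -
  let ?D1 = "domega T \<alpha> \<beta> x g" and ?K = "domega T \<alpha> \<beta> x (dy g)"
  let ?D2 = "domega T \<alpha> \<beta> x ?D1"
  let ?D = "\<lambda>t. Dg t (\<theta> t) + (\<chi> i j. row_app (dy g t (\<theta> t)) (D\<theta> t $ i $ j))"
  define \<theta>1 where "\<theta>1 = path_deriv T \<alpha> \<beta> x \<theta>"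
  define \<theta>2 where "\<theta>2 = path_deriv T \<alpha> \<beta> x \<theta>1"
  define \<eta>1 where "\<eta>1 t = ?D1 t (\<theta> t) + row_comp (dy g t (\<theta> t)) (\<theta>1 t)" for t
  define \<eta>2 where "\<eta>2 t = comp_deriv2 (?D2 t (\<theta> t)) (dy ?D1 t (\<theta> t)) (?K t (\<theta> t)) (dy (dy g) t (\<theta> t))
    (dy g t (\<theta> t)) (\<theta>1 t) (\<theta>2 t)" for t
  have \<theta>1: "is_path_deriv T \<alpha> \<beta> x \<theta> \<theta>1" and \<theta>2: "is_path_deriv T \<alpha> \<beta> x \<theta>1 \<theta>2"
    using \<theta> path_deriv_controlled unfolding controlled2_def \<theta>1_def \<theta>2_def by blast+
  have g12: "g \<in> C12_loc T \<alpha> \<beta> x" and D12: "?D1 \<in> C12_loc T \<alpha> \<beta> x" and G12: "dy g \<in> C12_loc T \<alpha> \<beta> x"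
    using g by (auto simp: C23_loc_def)
  have \<eta>1: "is_path_deriv T \<alpha> \<beta> x \<eta> \<eta>1"
    by (rule is_path_deriv_cong[OF chain_rule[OF g12 \<theta>1]]) (simp_all add: \<eta> \<eta>1_def)
  have \<eta>2: "is_path_deriv T \<alpha> \<beta> x \<eta>1 \<eta>2"
    unfolding \<eta>1_def[abs_def] \<eta>2_def[abs_def] comp_deriv2_def
    by (intro is_path_deriv_add chain_rule[OF D12 \<theta>1]
        is_path_deriv_bilinear[OF bounded_bilinear_row_comp chain_rule[OF G12 \<theta>1] \<theta>2])
  have p1: "path_deriv T \<alpha> \<beta> x \<eta> t = \<eta>1 t" if "t \<in> {0..T}" for t by (rule path_deriv_eq[OF \<eta>1 that])
  have p2: "is_path_deriv T \<alpha> \<beta> x (path_deriv T \<alpha> \<beta> x \<eta>) \<eta>2"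
    by (rule is_path_deriv_cong[OF \<eta>2]) (simp_all add: p1)
  then show c: "path_deriv T \<alpha> \<beta> x \<eta> \<in> controlled1 T \<alpha> \<beta> x" unfolding controlled1_iff by blast
  have D\<theta>h: "holder_O T \<beta> (incr D\<theta>)" and D\<theta>s: "\<And>t. t \<in> {0..T} \<Longrightarrow> transpose (D\<theta> t) = D\<theta> t"
    using D\<theta> exponents by (auto simp: is_time_deriv_def Omega_iff)
  have Dg1: "Dg \<in> C1_loc T" and Dgh: "holder_field T \<beta> Dg"
    and Dgs: "\<And>t y. t \<in> {0..T} \<Longrightarrow> transpose (Dg t y) = Dg t y"
    using Dg by (auto simp: is_time_deriv_field_def C1_beta_loc_def is_time_deriv_def)
  have \<theta>rem: "holder_O T \<nu> (remainder2 w \<theta> \<theta>1 \<theta>2 D\<theta>)"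
    using is_time_deriv_remainder2[of "{()}" "\<lambda>_. \<theta>" "\<lambda>_. D\<theta>", folded \<theta>1_def, folded \<theta>2_def]
      is_path_deriv_holder(3,4)[OF \<theta>2] D\<theta>h D\<theta> by simp
  note P = is_path_deriv_holder[OF \<theta>1]
  obtain R where R: "\<And>t. t \<in> {0..T} \<Longrightarrow> \<theta> t \<in> cball 0 R"
    using continuous_path_in_cball[OF P(5)] by blast
  have dg1: "dy g \<in> C1_loc T" and dgc: "controlled_field T \<alpha> \<beta> x (dy g)"
    using g12 by (auto simp: C12_loc_def C2_loc_def)
  have Dh: "holder_O T \<beta> (incr ?D)"
  proof -
    have 1: "holder_O T \<beta> (incr (\<lambda>t. Dg t (\<theta> t)))"
      using exponents by (intro field_comp_holder[OF Dg1 holder_field_unif_holder[OF Dgh] _ P(2) R]) auto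
    have 2: "holder_O T \<beta> (incr (\<lambda>t. dy g t (\<theta> t)))"
      using exponents by (intro field_comp_holder[OF dg1 controlled_field_unif_holder_path[OF dgc] _ P(2) R]) auto
    note h = bounded_bilinear_vec_right[OF bounded_bilinear_vec_right[OF bounded_bilinear_row_app]]
    note bdd = bigO_on_triangle_bounded[OF continuous_on_field_comp[OF dg1 P(5)]]
      bigO_on_triangle_bounded[OF holder_O_continuous_on[OF D\<theta>h exponents(2)]]
    show ?thesis
      unfolding holder_O_iff_bigO
      by (rule bigO_on_cong[OF bigO_on_add[OF 1[unfolded holder_O_iff_bigO]
              bigO_on_add[OF bigO_on_bilinear[OF h 2[unfolded holder_O_iff_bigO] bdd(4)]
                bigO_on_bilinear[OF h bdd(1) D\<theta>h[unfolded holder_O_iff_bigO]]]]])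
        (simp_all add: incr_def vec_eq_iff row_app.diff_left row_app.diff_right)
  qed
  have Ds: "transpose (?D t) = ?D t" if "t \<in> {0..T}" for t
  proof -
    have sym: "D\<theta> t $ i $ j = D\<theta> t $ j $ i" for i j
      using arg_cong[OF D\<theta>s[OF that], of "\<lambda>M. M $ i $ j"] by (simp add: transpose_def)
    have "transpose (\<chi> i j. row_app (dy g t (\<theta> t)) (D\<theta> t $ i $ j)) = (\<chi> i j. row_app (dy g t (\<theta> t)) (D\<theta> t $ j $ i))"
      by (simp add: transpose_def)
    then show ?thesis unfolding transpose_linear Dgs[OF that] by (simp add: sym)
  qed
  \<comment> \<open>\<open>is_time_derivI\<close> asks for the chosen derivatives. They agree with
    the computed ones on [0, T], and \<open>holder_O\<close> looks no further.\<close>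
  have "holder_O T \<nu> (remainder2 w \<eta> (path_deriv T \<alpha> \<beta> x \<eta>) (path_deriv T \<alpha> \<beta> x (path_deriv T \<alpha> \<beta> x \<eta>)) ?D)"
  proof (rule remainder2_cong)
    show "holder_O T \<nu> (remainder2 w (\<lambda>t. g t (\<theta> t)) \<eta>1 \<eta>2 ?D)"
      unfolding \<eta>1_def[abs_def] \<eta>2_def[abs_def] by (rule ito_remainder2[OF g Dg \<theta>1 \<theta>2 \<theta>rem])
  qed (simp_all add: \<eta> p1 path_deriv_eq[OF p2])
  then show "is_time_deriv T \<alpha> \<beta> w \<eta> ?D"
    by (intro is_time_derivI[OF c Dh] Ds)
qed

end

theorem theorem3p4:
  fixes T \<alpha> \<beta> :: real
    and w :: "'d::finite rough"
    and \<theta> :: "real \<Rightarrow> real^'m"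
    and g :: "real \<Rightarrow> real^'m \<Rightarrow> 'e::euclidean_space"
    and \<eta> :: "real \<Rightarrow> 'e"
  assumes "T > 0"
    and "1/3 < \<alpha>" and "\<alpha> < 1/2"
    and "1 - 2 * \<alpha> < \<beta>" and "\<beta> \<le> \<alpha>"
    and "w \<in> rough_paths T \<alpha>"
    and "path_deriv_unique T \<alpha> \<beta> (fst w)"
    and "\<theta> \<in> controlled1 T \<alpha> \<beta> (fst w)"
    and "g \<in> C12_loc T \<alpha> \<beta> (fst w)"
    and "\<And>t. t \<in> {0..T} \<Longrightarrow> \<eta> t = g t (\<theta> t)"
  shows
    "(\<eta> \<in> controlled1 T \<alpha> \<beta> (fst w) \<and>
      (\<forall>t\<in>{0..T}. path_deriv T \<alpha> \<beta> (fst w) \<eta> t =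
         domega T \<alpha> \<beta> (fst w) g t (\<theta> t)
         + (\<chi> j. \<Sum>k\<in>UNIV. (path_deriv T \<alpha> \<beta> (fst w) (\<lambda>s. \<theta> s $ k) t $ j) *\<^sub>R (dy g t (\<theta> t) $ k))))
     \<and>
     (\<theta> \<in> controlled2 T \<alpha> \<beta> w \<and> g \<in> C23_loc T \<alpha> \<beta> w \<longrightarrow>
        \<eta> \<in> controlled2 T \<alpha> \<beta> w \<and>
        (\<forall>D\<theta> Dg. is_time_deriv T \<alpha> \<beta> w \<theta> D\<theta> \<and> is_time_deriv_field T \<alpha> \<beta> w g Dg \<longrightarrow>
           is_time_deriv T \<alpha> \<beta> w \<eta>
             (\<lambda>t. Dg t (\<theta> t)
                + (\<chi> i j. \<Sum>k\<in>UNIV. (D\<theta> t $ i $ j $ k) *\<^sub>R (dy g t (\<theta> t) $ k)))))"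
proof -
  interpret rough_setting T \<alpha> \<beta> w
    using assms(1-7) by unfold_locales (auto simp: rough_paths_def)
  have \<theta>: "is_path_deriv T \<alpha> \<beta> (fst w) \<theta> (path_deriv T \<alpha> \<beta> (fst w) \<theta>)"
    by (rule path_deriv_controlled[OF assms(8)])
  \<comment> \<open>The formula refers to derivatives chosen for each coordinate of \<theta>
    separately; uniqueness identifies them with the coordinates of the derivative of
    \<theta>.\<close>
  have comp: "path_deriv T \<alpha> \<beta> (fst w) (\<lambda>s. \<theta> s $ k) t $ j = path_deriv T \<alpha> \<beta> (fst w) \<theta> t $ j $ k"
    if "t \<in> {0..T}" for t j k
    using path_deriv_eq[OF is_path_deriv_linear[OF \<theta> bounded_linear_vec_nth] that] by simp
  have \<eta>: "is_path_deriv T \<alpha> \<beta> (fst w) \<eta> (\<lambda>t. domega T \<alpha> \<beta> (fst w) g t (\<theta> t)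
      + row_comp (dy g t (\<theta> t)) (path_deriv T \<alpha> \<beta> (fst w) \<theta> t))"
    by (rule is_path_deriv_cong[OF chain_rule[OF assms(9) \<theta>]]) (simp_all add: assms(10))
  have \<eta>c: "\<eta> \<in> controlled1 T \<alpha> \<beta> (fst w)" using \<eta> controlled1_iff by blast
  have D: "is_time_deriv T \<alpha> \<beta> w \<eta> (\<lambda>t. Dg t (\<theta> t)
      + (\<chi> i j. \<Sum>k\<in>UNIV. (D\<theta> t $ i $ j $ k) *\<^sub>R (dy g t (\<theta> t) $ k)))"
    if "\<theta> \<in> controlled2 T \<alpha> \<beta> w" "g \<in> C23_loc T \<alpha> \<beta> w" "is_time_deriv T \<alpha> \<beta> w \<theta> D\<theta>"
      "is_time_deriv_field T \<alpha> \<beta> w g Dg" for D\<theta> Dg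
    using ito_chain_rule(2)[OF that assms(10)] by (simp add: row_app_def)
  have "\<eta> \<in> controlled2 T \<alpha> \<beta> w" if *: "\<theta> \<in> controlled2 T \<alpha> \<beta> w" "g \<in> C23_loc T \<alpha> \<beta> w"
  proof -
    obtain D\<theta> where D\<theta>: "is_time_deriv T \<alpha> \<beta> w \<theta> D\<theta>" using *(1) by (auto simp: controlled2_def)
    obtain Dg where Dg: "is_time_deriv_field T \<alpha> \<beta> w g Dg" using *(2) by (auto simp: C23_loc_def)
    show ?thesis
      using ito_chain_rule(1)[OF * D\<theta> Dg assms(10)] D[OF * D\<theta> Dg] \<eta>c by (auto simp: controlled2_def)
  qed
  moreover have "path_deriv T \<alpha> \<beta> (fst w) \<eta> t = domega T \<alpha> \<beta> (fst w) g t (\<theta> t)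
      + (\<chi> j. \<Sum>k\<in>UNIV. (path_deriv T \<alpha> \<beta> (fst w) (\<lambda>s. \<theta> s $ k) t $ j) *\<^sub>R (dy g t (\<theta> t) $ k))"
    if "t \<in> {0..T}" for t
    using path_deriv_eq[OF \<eta> that] by (simp add: comp[OF that] row_comp_def row_app_def)
  ultimately show ?thesis using \<eta>c D by blast
qed

end
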